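(* Let $T:\mathcal{H}\to\mathcal{H}$ be a shift operator with multiplicity $m$ on a separable infinite dimensional Hilbert space $\mathcal{H}$, and let $\mathcal{M}\subset\mathcal{H}$ be a nonzero nearly $T^{-1}$ invariant subspace. Let $G_0:=[g_1,g_2,\dots,g_l]^t$ be a matrix containing an orthonormal basis $(g_i)_{i\in\{1,\dots,l\}}$ of $\mathcal{M}\ominus(\mathcal{M}\cap T\mathcal{H})$. Then there exist a nonnegative integer $l'\le l$ and an operator-valued inner function $\Phi\in H^\infty(\mathbb{D},\mathcal{L}(\mathbb{C}^{l'},\mathbb{C}^l))$, unique up to unitary equivalence, such that $$\mathcal{M}=\{f\in\mathcal{H}:\ \exists\, h\in H^2(\mathbb{D},\mathbb{C}^l)\ominus\Phi H^2(\mathbb{D},\mathbb{C}^{l'}),\ f=h(T)G_0\}.$$ Besides, there is an isometric mapping $$Q:\mathcal{M}\to H^2(\mathbb{D},\mathbb{C}^l)\ominus\Phi H^2(\mathbb{D},\mathbb{C}^{l'})\quad\text{given by}\quad Q(f)=h,$$ where $f=h(T)G_0$.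
   Context: Here $\mathbb{D}$ is the open unit disc and $\mathbb{T}$ the unit circle. "Subspace" means closed linear subspace. $H^2(\mathbb{D},\mathbb{C}^l)$ is the $\mathbb{C}^l$-valued Hardy space; its elements are written as rows $[h_1,\dots,h_l]$ with $h_i\in H^2(\mathbb{D})$. An operator $T\in\mathcal{B}(\mathcal{H})$ is a shift operator if it is an isometry and $\|T^{*n}f\|\to0$ as $n\to\infty$ for all $f\in\mathcal{H}$. It has multiplicity $m$ (a finite positive integer) if $\dim(\mathcal{H}\ominus T\mathcal{H})=m$. For a left invertible $T\in\mathcal{B}(\mathcal{H})$, a subspace $\mathcal{M}\subset\mathcal{H}$ is nearly $T^{-1}$ invariant if, for every $g\in\mathcal{H}$ with $Tg\in\mathcal{M}$, one has $g\in\mathcal{M}$. For $T$ a shift operator of multiplicity $m$ and $\mathcal{M}\neq\{0\}$ nearly $T^{-1}$ invariant, $l:=\dim[\mathcal{M}\ominus(\mathcal{M}\cap T\mathcal{H})]$ satisfies $1\le l\le m$. $\Phi\in H^\infty(\mathbb{D},\mathcal{L}(\mathbb{C}^{l'},\mathbb{C}^l))$ is an operator-valued inner function if $\Phi(e^{iw})$ is an isometry a.e. on $\mathbb{T}$ (if $l'=0$, then $\Phi H^2(\mathbb{D},\mathbb{C}^{l'})=\{0\}$). Let $e_1,\dots,e_m$ be an orthonormal basis of $\mathcal{K}=\mathcal{H}\ominus T\mathcal{H}$, let $\delta^m_j$ be the $j$-th standard basis vector of $\mathbb{C}^m$, and let $U:\mathcal{H}\to H^2(\mathbb{D},\mathbb{C}^m)$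 be the unitary map with $U(T^ie_j)=z^i\delta_j^m$ for $i\ge0$, $1\le j\le m$. For $h=[h_1,\dots,h_l]\in H^2(\mathbb{D},\mathbb{C}^l)$ with $h_i(z)=\sum_{k\ge0}h_{i,k}z^k$, write $h(T)=[h_1(T),\dots,h_l(T)]$, $h_i(T)=\sum_{k\ge0}h_{i,k}T^k$, and $h(T)G_0=\sum_{i=1}^l h_i(T)g_i$. The identity $f=h(T)G_0$ is understood via $U$: it means $Uf=\sum_{i=1}^l h_i\,(Ug_i)$ as $\mathbb{C}^m$-valued analytic functions on $\mathbb{D}$ (equivalently, for each $n\ge0$ the component of $f$ in $T^n\mathcal{K}$, with respect to $\mathcal{H}=\bigoplus_{n\ge0}T^n\mathcal{K}$, equals that of the finite sum $\sum_{i=1}^l\sum_{k=0}^n h_{i,k}T^kg_i$). *)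

theory Defs
  imports "HOL-Analysis.Analysis" "Jordan_Normal_Form.Schur_Decomposition"
begin

text \<open>Here \<open>$\<close> is the indexing of dimension-carrying vectors (\<^const>\<open>vec_index\<close>), not that
  of \<open>'a ^ 'n\<close>. Vectors of \<open>\<complex>\<^sup>n\<close> are the elements of \<open>carrier_vec n\<close>, linear maps
  \<open>\<complex>\<^sup>p \<rightarrow> \<complex>\<^sup>n\<close> those of \<open>carrier_mat n p\<close>. Indices start at 0.\<close>
unbundle no vec_syntax

text \<open>The inner product \<open>cinner\<close> is linear in its first argument. The underlying real inner
  product is its real part, so the norm is \<open>sqrt (Re (cinner x x))\<close>.\<close>

class complex_hilbert = real_inner + complete_space +
  fixes scaleC :: "complex \<Rightarrow> 'a \<Rightarrow> 'a" (infixr "*\<^sub>C" 75)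
    and cinner :: "'a \<Rightarrow> 'a \<Rightarrow> complex"
  assumes scaleC_add_right: "a *\<^sub>C (x + y) = a *\<^sub>C x + a *\<^sub>C y"
    and scaleC_add_left: "(a + b) *\<^sub>C x = a *\<^sub>C x + b *\<^sub>C x"
    and scaleC_scaleC: "a *\<^sub>C b *\<^sub>C x = (a * b) *\<^sub>C x"
    and scaleC_of_real: "complex_of_real r *\<^sub>C x = r *\<^sub>R x"
    and cinner_commute: "cinner x y = cnj (cinner y x)"
    and cinner_add_left: "cinner (x + y) z = cinner x z + cinner y z"
    and cinner_scaleC_left: "cinner (a *\<^sub>C x) y = a * cinner x y"
    and Re_cinner: "Re (cinner x y) = inner x y"

global_interpretation complex_vector:
    vector_space "scaleC :: complex \<Rightarrow> 'a \<Rightarrow> 'a :: complex_hilbert"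
  defines csubspace = complex_vector.subspace
    and cspan = complex_vector.span
    and cdim = complex_vector.dim
proof unfold_locales
  fix x :: 'a
  show "1 *\<^sub>C x = x" using scaleC_of_real[of 1 x] by simp
qed (simp_all add: scaleC_add_right scaleC_add_left scaleC_scaleC)

text \<open>The Hilbert space difference \<open>M \<ominus> N\<close>; \<open>N\<close> need not be contained in \<open>M\<close>.\<close>
definition ortho_diff :: "'a::complex_hilbert set \<Rightarrow> 'a set \<Rightarrow> 'a set" where
  "ortho_diff M N = {x \<in> M. \<forall>y\<in>N. cinner x y = 0}"

definition onb_of :: "nat \<Rightarrow> (nat \<Rightarrow> 'a::complex_hilbert) \<Rightarrow> 'a set \<Rightarrow> bool" where
  "onb_of n b S \<longleftrightarrow>
     (\<forall>i<n. \<forall>j<n. cinner (b i) (b j) = (if i = j then 1 else 0)) \<and> cspan (b ` {..<n}) = S"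

definition cadjoint :: "('a::complex_hilbert \<Rightarrow> 'a) \<Rightarrow> 'a \<Rightarrow> 'a" where
  "cadjoint T = (SOME S. \<forall>x y. cinner (T x) y = cinner x (S y))"

definition shift_operator :: "('a::complex_hilbert \<Rightarrow> 'a) \<Rightarrow> bool" where
  "shift_operator T \<longleftrightarrow>
     Vector_Spaces.linear scaleC scaleC T \<and> (\<forall>x. norm (T x) = norm x) \<and>
     (\<forall>x. (\<lambda>n. norm ((cadjoint T ^^ n) x)) \<longlonglongrightarrow> 0)"

text \<open>\<^const>\<open>cdim\<close> is 0 on infinite-dimensional spaces, so \<open>0 < m\<close> also
  forces \<open>ortho_diff UNIV (range T)\<close> to be finite-dimensional.\<close>
definition shift_of_multiplicity :: "('a::complex_hilbert \<Rightarrow> 'a) \<Rightarrow> nat \<Rightarrow> bool" where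
  "shift_of_multiplicity T m \<longleftrightarrow>
     shift_operator T \<and> 0 < m \<and> cdim (ortho_diff UNIV (range T)) = m"

definition nearly_inverse_invariant :: "('a::complex_hilbert \<Rightarrow> 'a) \<Rightarrow> 'a set \<Rightarrow> bool" where
  "nearly_inverse_invariant T M \<longleftrightarrow>
     csubspace M \<and> closed M \<and> (\<forall>x. T x \<in> M \<longrightarrow> x \<in> M)"

text \<open>Functions on the unit disc are extended by 0 to the whole plane, so that equality of
  functions on the disc is equality in HOL.\<close>

definition taylor_coeff :: "(complex \<Rightarrow> complex) \<Rightarrow> nat \<Rightarrow> complex" where
  "taylor_coeff f k = (deriv ^^ k) f 0 / fact k"

definition H2 :: "nat \<Rightarrow> (complex \<Rightarrow> complex vec) set" where
  "H2 n = {h. (\<forall>z. h z \<in> carrier_vec n) \<and>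
     (\<forall>z. z \<notin> ball 0 1 \<longrightarrow> h z = 0\<^sub>v n) \<and>
     (\<forall>i<n. (\<lambda>z. h z $ i) holomorphic_on ball 0 1 \<and>
        summable (\<lambda>k. (cmod (taylor_coeff (\<lambda>z. h z $ i) k))\<^sup>2))}"

definition H2_inner ::
  "nat \<Rightarrow> (complex \<Rightarrow> complex vec) \<Rightarrow> (complex \<Rightarrow> complex vec) \<Rightarrow> complex" where
  "H2_inner n h h' = (\<Sum>i<n. \<Sum>k. taylor_coeff (\<lambda>z. h z $ i) k * cnj (taylor_coeff (\<lambda>z. h' z $ i) k))"

definition H2_norm :: "nat \<Rightarrow> (complex \<Rightarrow> complex vec) \<Rightarrow> real" where
  "H2_norm n h = sqrt (Re (H2_inner n h h))"

definition linear_isometry_into_H2 ::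
  "nat \<Rightarrow> 'a::complex_hilbert set \<Rightarrow> ('a \<Rightarrow> complex \<Rightarrow> complex vec) \<Rightarrow> bool" where
  "linear_isometry_into_H2 n M Q \<longleftrightarrow>
     (\<forall>x\<in>M. Q x \<in> H2 n) \<and>
     (\<forall>x\<in>M. \<forall>y\<in>M. Q (x + y) = (\<lambda>z. Q x z + Q y z)) \<and>
     (\<forall>c. \<forall>x\<in>M. Q (c *\<^sub>C x) = (\<lambda>z. c \<cdot>\<^sub>v Q x z)) \<and>
     (\<forall>x\<in>M. H2_norm n (Q x) = norm x)"

text \<open>The unitary map \<open>U\<close> onto \<open>H\<^sup>2(\<complex>\<^sup>m)\<close> with \<open>U (T\<^sup>i e\<^sub>j) = z\<^sup>i \<delta>\<^sub>j\<close>.\<close>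
definition wold_unitary ::
  "('a::complex_hilbert \<Rightarrow> 'a) \<Rightarrow> nat \<Rightarrow> (nat \<Rightarrow> 'a) \<Rightarrow> ('a \<Rightarrow> complex \<Rightarrow> complex vec) \<Rightarrow> bool" where
  "wold_unitary T m e U \<longleftrightarrow>
     linear_isometry_into_H2 m UNIV U \<and> range U = H2 m \<and>
     (\<forall>i. \<forall>j<m. U ((T ^^ i) (e j)) =
        (\<lambda>z. if z \<in> ball 0 1 then z ^ i \<cdot>\<^sub>v unit_vec m j else 0\<^sub>v m))"

definition Hinf :: "nat \<Rightarrow> nat \<Rightarrow> (complex \<Rightarrow> complex mat) set" where
  "Hinf n p = {\<Phi>. (\<forall>z. \<Phi> z \<in> carrier_mat n p) \<and>
     (\<forall>z. z \<notin> ball 0 1 \<longrightarrow> \<Phi> z = 0\<^sub>m n p) \<and>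
     (\<forall>i<n. \<forall>j<p. (\<lambda>z. \<Phi> z $$ (i, j)) holomorphic_on ball 0 1) \<and>
     (\<exists>C. \<forall>z\<in>ball 0 1. \<forall>i<n. \<forall>j<p. cmod (\<Phi> z $$ (i, j)) \<le> C)}"

definition isometry_mat :: "nat \<Rightarrow> nat \<Rightarrow> complex mat \<Rightarrow> bool" where
  "isometry_mat n p A \<longleftrightarrow>
     A \<in> carrier_mat n p \<and> (\<forall>v\<in>carrier_vec p. (A *\<^sub>v v) \<bullet>c (A *\<^sub>v v) = v \<bullet>c v)"

definition unitary_mat :: "nat \<Rightarrow> complex mat \<Rightarrow> bool" where
  "unitary_mat n V \<longleftrightarrow>
     V \<in> carrier_mat n n \<and> mat_adjoint V * V = 1\<^sub>m n \<and> V * mat_adjoint V = 1\<^sub>m n"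

text \<open>\<open>A\<close> is the boundary value \<open>\<Phi>(e\<^sup>i\<^sup>w)\<close>, taken as a radial limit.\<close>
definition inner_function :: "nat \<Rightarrow> nat \<Rightarrow> (complex \<Rightarrow> complex mat) \<Rightarrow> bool" where
  "inner_function n p \<Phi> \<longleftrightarrow> \<Phi> \<in> Hinf n p \<and>
     (AE w in lebesgue_on {0..2*pi}. \<exists>A. isometry_mat n p A \<and>
        (\<forall>i<n. \<forall>j<p. ((\<lambda>r. \<Phi> (complex_of_real r * cis w) $$ (i, j)) \<longlongrightarrow> A $$ (i, j)) (at_left 1)))"

text \<open>The space \<open>H\<^sup>2(\<complex>\<^sup>n) \<ominus> \<Phi> H\<^sup>2(\<complex>\<^sup>p)\<close>.\<close>
definition model_space ::
  "nat \<Rightarrow> nat \<Rightarrow> (complex \<Rightarrow> complex mat) \<Rightarrow> (complex \<Rightarrow> complex vec) set" where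
  "model_space n p \<Phi> = {h \<in> H2 n. \<forall>k\<in>H2 p. H2_inner n h (\<lambda>z. \<Phi> z *\<^sub>v k z) = 0}"

text \<open>\<open>f = h(T)G\<^sub>0\<close> means \<open>Uf = \<Sum>\<^sub>i h\<^sub>i (U g\<^sub>i)\<close> on the disc.\<close>
definition represented_by ::
  "nat \<Rightarrow> ('a \<Rightarrow> complex \<Rightarrow> complex vec) \<Rightarrow> nat \<Rightarrow> (nat \<Rightarrow> 'a) \<Rightarrow>
    'a::complex_hilbert \<Rightarrow> (complex \<Rightarrow> complex vec) \<Rightarrow> bool" where
  "represented_by m U l g f h \<longleftrightarrow>
     (\<forall>z\<in>ball 0 1. \<forall>j<m. U f z $ j = (\<Sum>i<l. h z $ i * U (g i) z $ j))"

end

theory Submission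
  imports Defs "HOL-Complex_Analysis.Complex_Analysis"
begin

text \<open>
  Hitt's algorithm writes \<open>f \<in> M\<close> as \<open>f = \<Sum>\<^sub>i c\<^sub>i g\<^sub>i + T (X f)\<close> with \<open>c\<^sub>i = \<langle>f, g\<^sub>i\<rangle>\<close> and \<open>X f \<in> M\<close>.
  Iterating gives \<open>Q f = h\<close> with coefficients \<open>\<langle>X\<^sup>k f, g\<^sub>i\<rangle>\<close>, and \<open>Q\<close> is isometric because the powers of
  \<open>X = T\<^sup>* (1 - P)\<close>, where \<open>P\<close> projects onto the span of the \<open>g\<^sub>i\<close>, tend strongly to 0. The image \<open>Q M\<close>
  is closed and invariant under the backward shift, so by Beurling-Lax it is \<open>H\<^sup>2 \<ominus> \<Phi> H\<^sup>2\<close>, the columns of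
  \<open>\<Phi>\<close> being an orthonormal basis of the wandering subspace of the orthogonal complement of \<open>Q M\<close>.

  That \<open>\<Phi>\<close> is isometric almost everywhere on the circle is equivalent to its columns \<open>\<phi>\<^sub>i\<close> being bounded with
  \<open>\<langle>z\<^sup>k \<phi>\<^sub>i, \<phi>\<^sub>j\<rangle> = \<delta>\<^sub>i\<^sub>j \<delta>\<^sub>k\<^sub>0\<close>, these numbers being the Fourier coefficients of \<open>\<Phi>\<^sup>*\<Phi>\<close>. The radial limits
  come from a maximal inequality on \<open>L\<^sup>2\<close>.

  Hilbert space arguments about \<open>H\<^sup>2(\<complex>\<^sup>n)\<close> with \<open>n \<le> m\<close> take place inside the given space: \<open>H\<^sup>2(\<complex>\<^sup>n)\<close> is
  identified with the closed span of the \<open>T\<^sup>k e\<^sub>j\<close>, \<open>j < n\<close>. This suffices because the \<open>(U g\<^sub>i)(0)\<close> are linearly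
  independent, whence \<open>l \<le> m\<close>.
\<close>

section \<open>Fourier series and the Poisson kernel on the circle\<close>

text \<open>The maximal inequality behind the radial limits needs no covering argument. The maximum
  over radii is linearised by choosing, at every angle \<open>t\<close>, a radius attaining it; the
  result is dominated by an integral operator whose kernel is a Poisson kernel with radius depending
  on \<open>t\<close>. The Poisson kernel is nonincreasing in the chordal distance and loses at most
  a factor 4 when that distance doubles. So the product of two kernels with unrelated radii,
  integrated over their common variable, is controlled by the sum of the two kernels, uniformly in
  the choice of radii.

  In the stability of \<open>X\<close> the obstacle is that \<open>1 - P\<close> need not commute
  with \<open>B\<close>, so no single power of \<open>X\<close> is estimated directly. Only sums of
  squares over the powers are, which suffices because the norms decrease.

  In the uniqueness part a competing \<open>\<Psi>\<close> is known only through those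
  \<open>h\<close> in its model space for which \<open>h G_0\<close> comes from a vector of the
  Hilbert space. Further functions, with products outside \<open>H^2\<close>, have to be excluded by
  approximation.\<close>

abbreviation circ :: "real measure" where "circ \<equiv> lebesgue_on {0..2*pi}"

lemma finite_measure_circ: "finite_measure circ"
  by (simp add: finite_measure_lebesgue_on)

interpretation circ: finite_measure circ by (rule finite_measure_circ)

lemma measurable_ident_circ [measurable]: "(\<lambda>x. x) \<in> borel_measurable circ"
  by (rule continuous_imp_measurable_on_sets_lebesgue) auto

lemma measurable_circ: "f \<in> borel_measurable borel \<Longrightarrow> f \<in> borel_measurable circ"
  by (rule measurable_compose[OF measurable_ident_circ])

lemma measure_circ: "measure circ (space circ) = 2 * pi"
  by (simp add: measure_restrict_space)

lemma continuous_cis_cmul: "continuous_on A (\<lambda>t. cis (c * t))"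
  by (simp add: cis_conv_exp) (intro continuous_intros)

lemma measurable_cis [measurable]: "cis \<in> borel_measurable borel"
  using continuous_cis_cmul[of UNIV 1] by (intro borel_measurable_continuous_onI) simp

lemma measurable_cnj [measurable]: "cnj \<in> borel_measurable borel"
  by (intro borel_measurable_continuous_onI continuous_on_cnj continuous_on_id)

lemma integrable_circ_bounded:
  fixes f :: "real \<Rightarrow> 'b::{banach, second_countable_topology}"
  assumes "f \<in> borel_measurable circ" "\<And>t. norm (f t) \<le> C"
  shows "integrable circ f"
  by (rule circ.integrable_const_bound[of f C]) (use assms in auto)

lemma integral_cis_circ:
  "integral\<^sup>L circ (\<lambda>t. cis (of_int k * t)) = (if k = 0 then 2 * pi else 0)"
proof (cases "k = 0")
  case True
  then show ?thesis using measure_circ by (simp add: scaleR_conv_of_real)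
next
  case False
  have int: "integrable circ (\<lambda>t. cis (of_int k * t))"
    by (rule integrable_circ_bounded[where C = 1]) auto
  have "((\<lambda>t. cis (of_int k * t)) has_integral
      (cis (of_int k * (2*pi)) / (\<i> * of_int k) - cis (of_int k * 0) / (\<i> * of_int k))) {0..2*pi}"
  proof (rule fundamental_theorem_of_calculus)
    fix x assume "x \<in> {0..2*pi}"
    have "((\<lambda>t. exp (\<i> * of_int k * of_real t) / (\<i> * of_int k)) has_vector_derivative exp (\<i> * of_int k * of_real x)) (at x within {0..2*pi})"
      using False by (auto intro!: derivative_eq_intros has_vector_derivative_real_field simp: field_simps)
    then show "((\<lambda>a. cis (of_int k * a) / (\<i> * of_int k)) has_vector_derivative cis (of_int k * x)) (at x within {0..2*pi})"
      by (simp add: cis_conv_exp mult.assoc)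
  qed auto
  moreover have "cis (of_int k * (2*pi)) = 1"
    using cis_multiple_2pi[of "of_int k"] by (simp add: mult_ac)
  ultimately have "((\<lambda>t. cis (of_int k * t)) has_integral 0) {0..2*pi}" by simp
  then show ?thesis using False lebesgue_integral_eq_integral[OF int] by (simp add: integral_unique)
qed

definition fser :: "(nat \<Rightarrow> complex) \<Rightarrow> real \<Rightarrow> complex" where
  "fser a t = (\<Sum>n. a n * cis (real n * t))"

lemma fser_sums:
  assumes "summable (\<lambda>n. norm (a n))"
  shows "(\<lambda>n. a n * cis (real n * t)) sums fser a t" "norm (fser a t) \<le> (\<Sum>n. norm (a n))"
proof -
  have s: "summable (\<lambda>n. norm (a n * cis (real n * t)))" using assms by (simp add: norm_mult)
  show "(\<lambda>n. a n * cis (real n * t)) sums fser a t"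
    unfolding fser_def by (rule summable_sums[OF summable_norm_cancel[OF s]])
  show "norm (fser a t) \<le> (\<Sum>n. norm (a n))"
    unfolding fser_def using summable_norm[OF s] by (simp add: norm_mult)
qed

lemma measurable_fser [measurable]: "fser a \<in> borel_measurable borel"
  unfolding fser_def[abs_def] by measurable

lemma integral_mult_fser:
  assumes u: "u \<in> borel_measurable circ" "\<And>t. norm (u t) \<le> K" and a: "summable (\<lambda>n. norm (a n))"
  shows "(\<lambda>n. a n * (LINT t|circ. u t * cis (real n * t))) sums (LINT t|circ. u t * fser a t)"
proof -
  have K: "0 \<le> K" using u(2)[of 0] norm_ge_zero order_trans by blast
  have n: "norm (u t * (a n * cis (real n * t))) \<le> K * norm (a n)" for n t
    using u(2)[of t] by (simp add: norm_mult mult_right_mono)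
  note [measurable] = u(1)
  have i: "integrable circ (\<lambda>t. u t * (a n * cis (real n * t)))" for n
    by (rule integrable_circ_bounded[OF _ n]) measurable
  have sn: "summable (\<lambda>n. K * norm (a n))" using a by (rule summable_mult)
  have "(\<lambda>n. LINT t|circ. u t * (a n * cis (real n * t))) sums (LINT t|circ. (\<Sum>n. u t * (a n * cis (real n * t))))"
  proof (rule sums_integral[OF i])
    show "AE x in circ. summable (\<lambda>n. norm (u x * (a n * cis (real n * x))))"
      by (intro AE_I2 summable_comparison_test'[OF sn, of 0]) (use n in auto)
    have "norm (LINT x|circ. norm (u x * (a n * cis (real n * x)))) \<le> (2*pi) * (K * norm (a n))" for n
    proof -
      have "(LINT x|circ. norm (u x * (a n * cis (real n * x)))) \<le> (LINT x|circ. K * norm (a n))"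
        by (rule integral_mono) (use i n in auto)
      then show ?thesis using measure_circ by (simp add: mult_ac)
    qed
    then show "summable (\<lambda>n. LINT x|circ. norm (u x * (a n * cis (real n * x))))"
      by (intro summable_comparison_test'[OF summable_mult[OF sn], of 0]) auto
  qed
  moreover have "(\<Sum>n. u t * (a n * cis (real n * t))) = u t * fser a t" for t
    unfolding fser_def by (rule suminf_mult[OF sums_summable[OF fser_sums(1)[OF a]]])
  moreover have "(LINT t|circ. u t * (a n * cis (real n * t))) = a n * (LINT t|circ. u t * cis (real n * t))" for n
    by (subst integral_mult_right_zero[symmetric]) (simp add: mult_ac)
  ultimately show ?thesis by simp
qed

text \<open>Orthogonality of the exponentials picks from \<open>fser b\<close> the single
  coefficient of index \<open>n + k\<close>. The lag \<open>k\<close> is kept because Gram functions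
  of wandering families will be tested against all powers of \<open>cis\<close>.\<close>

lemma parseval_fser:
  assumes a: "summable (\<lambda>n. norm (a n))" and b: "summable (\<lambda>n. norm (b n))"
  shows "(\<lambda>n. 2 * pi * (a n * cnj (b (n + k)))) sums
     (LINT t|circ. cis (real k * t) * fser a t * cnj (fser b t))"
proof -
  have c: "(LINT t|circ. cis (real k * t) * cnj (fser b t) * cis (real n * t)) = 2 * pi * cnj (b (n + k))" for n
  proof -
    have "(\<lambda>j. b j * (LINT t|circ. cis (- real (n + k) * t) * cis (real j * t))) sums
        (LINT t|circ. cis (- real (n + k) * t) * fser b t)"
      by (rule integral_mult_fser[OF _ _ b, where K = 1]) auto
    moreover have "(LINT t|circ. cis (- real (n + k) * t) * cis (real j * t)) = (if j = n + k then 2 * pi else 0)" for j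
    proof -
      have e: "cis (- real (n + k) * t) * cis (real j * t) = cis (of_int (int j - int (n + k)) * t)" for t
        by (simp add: cis_mult algebra_simps)
      show ?thesis unfolding e integral_cis_circ by auto
    qed
    then have "(\<lambda>j. b j * (LINT t|circ. cis (- real (n + k) * t) * cis (real j * t))) = (\<lambda>j. if j = n + k then b j * (2 * pi) else 0)"
      by auto
    ultimately have "(LINT t|circ. cis (- real (n + k) * t) * fser b t) = b (n + k) * (2 * pi)"
      using sums_single[of "n + k" "\<lambda>j. b j * (2 * pi)"] sums_unique2 by auto
    then have "cnj (LINT t|circ. cis (- real (n + k) * t) * fser b t) = 2 * pi * cnj (b (n + k))" by simp
    moreover have "cnj (cis (- real (n + k) * t)) = cis (real k * t) * cis (real n * t)" for t
      by (simp add: cis_cnj cis_mult algebra_simps)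
    then have "(\<lambda>t. cnj (cis (- real (n + k) * t) * fser b t)) = (\<lambda>t. cis (real k * t) * cnj (fser b t) * cis (real n * t))"
      by (simp only: complex_cnj_mult mult_ac)
    moreover have "cnj (LINT t|circ. cis (- real (n + k) * t) * fser b t) = (LINT t|circ. cnj (cis (- real (n + k) * t) * fser b t))"
      by (rule Bochner_Integration.integral_cnj[symmetric])
    ultimately show ?thesis by (simp only:)
  qed
  have "(\<lambda>n. a n * (LINT t|circ. cis (real k * t) * cnj (fser b t) * cis (real n * t))) sums
     (LINT t|circ. cis (real k * t) * cnj (fser b t) * fser a t)"
    by (rule integral_mult_fser[OF _ _ a, where K = "\<Sum>n. norm (b n)"])
      (use fser_sums(2)[OF b] in \<open>auto simp: norm_mult\<close>)
  then show ?thesis unfolding c by (simp add: mult_ac)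
qed

section \<open>The Poisson kernel: reproduction of polynomials and a three-point inequality\<close>

definition poisson :: "real \<Rightarrow> real \<Rightarrow> real" where
  "poisson r t = (1 - r\<^sup>2) / (cmod (1 - of_real r * cis t))\<^sup>2"

lemma measurable_poisson [measurable (raw)]:
  assumes [measurable]: "f \<in> borel_measurable M" "g \<in> borel_measurable M"
  shows "(\<lambda>x. poisson (f x) (g x)) \<in> borel_measurable M"
proof -
  have "cis \<in> borel_measurable borel" by (rule measurable_cis)
  then have [measurable]: "(\<lambda>x. cis (g x)) \<in> borel_measurable M"
    by (rule measurable_compose[OF assms(2)])
  show ?thesis unfolding poisson_def by measurable
qed

context
  fixes r :: real
  assumes r: "0 \<le> r" "r < 1"
begin

text \<open>This exhibits the kernel as a nonincreasing function of the chordal distance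
  \<open>cmod (1 - cis t)\<close>; the comparisons below go through that distance.\<close>

lemma norm_one_minus_cis: "(cmod (1 - of_real r * cis t))\<^sup>2 = (1 - r)\<^sup>2 + r * (cmod (1 - cis t))\<^sup>2"
proof -
  have "(sin t)\<^sup>2 = 1 - (cos t)\<^sup>2" by (rule sin_squared_eq)
  then have "r\<^sup>2 * (sin t)\<^sup>2 = r\<^sup>2 * (1 - (cos t)\<^sup>2)" by simp
  with \<open>(sin t)\<^sup>2 = 1 - (cos t)\<^sup>2\<close> show ?thesis
    by (simp add: cmod_power2 power_mult_distrib power2_diff algebra_simps)
qed

lemma norm_one_minus_cis_ge: "1 - r \<le> cmod (1 - of_real r * cis t)"
  using norm_triangle_ineq2[of 1 "of_real r * cis t"] r by (simp add: norm_mult)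

lemma poisson_nonneg: "0 \<le> poisson r t"
  unfolding poisson_def using r by (simp add: power_le_one)

lemma poisson_le: "poisson r t \<le> 2 / (1 - r)"
proof -
  have "poisson r t \<le> (1 - r\<^sup>2) / (1 - r)\<^sup>2"
    unfolding poisson_def using r norm_one_minus_cis_ge[of t]
    by (intro divide_left_mono power_mono mult_pos_pos) (auto simp: power_le_one)
  also have "\<dots> = (1 + r) / (1 - r)"
  proof -
    have "1 - r\<^sup>2 = (1 + r) * (1 - r)" by (simp add: power2_eq_square algebra_simps)
    then show ?thesis using r by (simp add: power2_eq_square)
  qed
  also have "\<dots> \<le> 2 / (1 - r)" using r by (intro divide_right_mono) auto
  finally show ?thesis .
qed

text \<open>In the denominator the summand \<open>(1 - r)^2\<close> is the same on both sides and
  the other one changes by a factor of at most \<open>2^2\<close>, hence the constant 4 for every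
  radius.\<close>

lemma poisson_compare:
  assumes "cmod (1 - cis x) \<le> 2 * cmod (1 - cis y)"
  shows "poisson r y \<le> 4 * poisson r x"
proof -
  let ?N = "\<lambda>t. (cmod (1 - of_real r * cis t))\<^sup>2"
  have pos: "0 < ?N t" for t using norm_one_minus_cis_ge[of t] r by auto
  have "(cmod (1 - cis x))\<^sup>2 \<le> (2 * cmod (1 - cis y))\<^sup>2"
    by (rule power_mono[OF assms]) simp
  then have "r * (cmod (1 - cis x))\<^sup>2 \<le> r * (4 * (cmod (1 - cis y))\<^sup>2)"
    using r by (intro mult_left_mono) (simp_all add: power_mult_distrib)
  then have "?N x \<le> 4 * ?N y"
    unfolding norm_one_minus_cis using r by (simp add: algebra_simps)
      (smt (verit) zero_le_power2 power2_diff)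
  then have "(1 - r\<^sup>2) * ?N x \<le> (1 - r\<^sup>2) * (4 * ?N y)"
    using r by (intro mult_left_mono) (auto simp: power_le_one)
  then have "(1 - r\<^sup>2) / ?N y \<le> 4 * ((1 - r\<^sup>2) / ?N x)"
    using pos[of x] pos[of y] by (simp only: pos_divide_le_eq times_divide_eq_right times_divide_eq_left pos_le_divide_eq mult_ac)
  then show ?thesis unfolding poisson_def .
qed

lemma poisson_sym: "poisson r (- t) = poisson r t"
proof -
  have "1 - of_real r * cis (- t) = cnj (1 - of_real r * cis t)" by (simp add: cis_cnj)
  then show ?thesis unfolding poisson_def by (metis complex_mod_cnj)
qed

text \<open>The kernel is \<open>1 - r^2\<close> times the squared modulus of the geometric series
  with ratio \<open>r * cis (x - t)\<close>, so lagged Parseval computes its Fourier coefficients.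
  The diagonal geometric sum \<open>1 / (1 - r^2)\<close> cancels the prefactor.\<close>

lemma integral_poisson_cis:
  "(LINT x|circ. of_real (poisson r (x - t)) * cis (real k * x)) = 2 * pi * (of_real r * cis t) ^ k"
proof -
  let ?a = "\<lambda>n. (of_real r * cis (- t)) ^ n"
  have sa: "summable (\<lambda>n. norm (?a n))" using r by (simp add: norm_power norm_mult summable_geometric)
  have f: "fser ?a x = 1 / (1 - of_real r * cis (x - t))" for x
  proof -
    have "fser ?a x = (\<Sum>n. (of_real r * cis (x - t)) ^ n)"
      unfolding fser_def by (intro suminf_cong) (simp add: power_mult_distrib Complex.DeMoivre cis_mult right_diff_distrib add.commute)
    then show ?thesis using r by (simp add: suminf_geometric norm_mult)
  qed
  have p: "of_real (poisson r (x - t)) * cis (real k * x) = of_real (1 - r\<^sup>2) * (cis (real k * x) * fser ?a x * cnj (fser ?a x))" for x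
  proof -
    have "fser ?a x * cnj (fser ?a x) = of_real ((cmod (fser ?a x))\<^sup>2)" by (rule complex_norm_square[symmetric])
    also have "\<dots> = of_real (1 / (cmod (1 - of_real r * cis (x - t)))\<^sup>2)"
      unfolding f by (simp add: norm_divide power_divide)
    finally show ?thesis unfolding poisson_def by (simp add: field_simps)
  qed
  have s1: "(\<lambda>n. 2 * pi * (?a n * cnj (?a (n + k)))) sums (LINT x|circ. cis (real k * x) * fser ?a x * cnj (fser ?a x))"
    by (rule parseval_fser[OF sa sa])
  have e: "2 * pi * (?a n * cnj (?a (n + k))) = (2 * pi * (of_real r * cis t) ^ k) * of_real (r\<^sup>2) ^ n" for n
  proof -
    have "?a n * cnj (?a n) = of_real ((cmod (?a n))\<^sup>2)" by (rule complex_norm_square[symmetric])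
    also have "\<dots> = of_real (r\<^sup>2) ^ n" using r by (simp add: norm_power norm_mult power_mult[symmetric] mult.commute)
    finally have "?a n * cnj (?a n) = of_real (r\<^sup>2) ^ n" .
    moreover have "cnj (?a (n + k)) = cnj (?a n) * (of_real r * cis t) ^ k"
      by (simp add: power_add cis_cnj)
    ultimately have "?a n * cnj (?a (n + k)) = of_real (r\<^sup>2) ^ n * (of_real r * cis t) ^ k"
      by (simp only: mult.assoc[symmetric])
    then show ?thesis by (simp only: mult_ac)
  qed
  have s2: "(\<lambda>n. (2 * pi * (of_real r * cis t) ^ k) * of_real (r\<^sup>2) ^ n) sums ((2 * pi * (of_real r * cis t) ^ k) * (1 / (1 - complex_of_real (r\<^sup>2))))"
    using r by (intro sums_mult geometric_sums) (simp add: norm_power power_less_one_iff abs_square_less_1)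
  have "(LINT x|circ. cis (real k * x) * fser ?a x * cnj (fser ?a x)) = (2 * pi * (of_real r * cis t) ^ k) * (1 / (1 - complex_of_real (r\<^sup>2)))"
    by (rule sums_unique2[OF s1]) (subst e, rule s2)
  moreover have "1 - complex_of_real (r\<^sup>2) \<noteq> 0"
    using r by (metis abs_square_less_1 abs_of_nonneg eq_iff_diff_eq_0 less_irrefl of_real_1 of_real_eq_iff)
  ultimately show ?thesis unfolding p by simp
qed

lemma integrable_poisson_mult:
  fixes f :: "real \<Rightarrow> 'b::{banach, second_countable_topology, real_normed_algebra_1}"
  assumes [measurable]: "f \<in> borel_measurable circ" and "\<And>t. norm (f t) \<le> K"
  shows "integrable circ (\<lambda>x. of_real (poisson r (x - t)) * f x)"
proof (rule integrable_circ_bounded[where C = "2 / (1 - r) * K"])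
  show "norm (of_real (poisson r (x - t)) * f x) \<le> 2 / (1 - r) * K" for x
  proof -
    have "norm (of_real (poisson r (x - t)) * f x) \<le> poisson r (x - t) * norm (f x)"
      using norm_mult_ineq[of "of_real (poisson r (x - t)) :: 'b" "f x"] poisson_nonneg[of "x - t"] by simp
    also have "\<dots> \<le> 2 / (1 - r) * K"
      by (intro mult_mono poisson_le assms(2)) (use r in auto)
    finally show ?thesis .
  qed
qed measurable

lemma nn_integral_poisson: "(\<integral>\<^sup>+ x. ennreal (poisson r (x - t)) \<partial>circ) = ennreal (2 * pi)"
proof -
  have "integrable circ (\<lambda>x. poisson r (x - t))"
    using integrable_poisson_mult[of "\<lambda>_. 1::real" 1 t] by simp
  moreover have "(LINT x|circ. poisson r (x - t)) = 2 * pi"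
    using integral_poisson_cis[of t 0] by (simp flip: of_real_mult add: integral_complex_of_real del: of_real_mult)
  ultimately show ?thesis by (subst nn_integral_eq_integral) (auto simp: poisson_nonneg)
qed

text \<open>A polynomial is the Poisson integral of its boundary values. Working with polynomials
  avoids any boundary function at this stage.\<close>

lemma poisson_poly_le:
  "ennreal (2 * pi * cmod (\<Sum>n<N. a n * (of_real r * cis t) ^ n)) \<le>
   (\<integral>\<^sup>+ x. ennreal (poisson r (x - t)) * ennreal (cmod (\<Sum>n<N. a n * cis x ^ n)) \<partial>circ)"
proof -
  let ?q = "\<lambda>x. \<Sum>n<N. a n * cis x ^ n"
  have [measurable]: "?q \<in> borel_measurable circ" by measurable
  have qb: "norm (?q x) \<le> (\<Sum>n<N. cmod (a n))" for x
    by (rule order_trans[OF norm_sum]) (simp add: norm_mult norm_power)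
  have i1: "integrable circ (\<lambda>x. of_real (poisson r (x - t)) * (a n * cis (real n * x)))" for n
    by (rule integrable_poisson_mult[where K = "norm (a n)"]) (auto simp: norm_mult)
  have "(LINT x|circ. of_real (poisson r (x - t)) * ?q x) = (\<Sum>n<N. LINT x|circ. of_real (poisson r (x - t)) * (a n * cis (real n * x)))"
    unfolding sum_distrib_left Complex.DeMoivre by (rule Bochner_Integration.integral_sum) (rule i1)
  also have "\<dots> = (\<Sum>n<N. a n * (LINT x|circ. of_real (poisson r (x - t)) * cis (real n * x)))"
    by (intro sum.cong refl, subst integral_mult_right_zero[symmetric]) (simp add: mult_ac)
  also have "\<dots> = 2 * pi * (\<Sum>n<N. a n * (of_real r * cis t) ^ n)"
    unfolding integral_poisson_cis by (simp add: sum_distrib_left mult_ac)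
  finally have "2 * pi * cmod (\<Sum>n<N. a n * (of_real r * cis t) ^ n) = cmod (LINT x|circ. of_real (poisson r (x - t)) * ?q x)"
    by (simp add: norm_mult)
  also have "\<dots> \<le> (LINT x|circ. norm (of_real (poisson r (x - t)) * ?q x))"
    by (rule integral_norm_bound)
  also have "\<dots> = (LINT x|circ. poisson r (x - t) * cmod (?q x))"
    by (simp add: norm_mult poisson_nonneg)
  finally have "ennreal (2 * pi * cmod (\<Sum>n<N. a n * (of_real r * cis t) ^ n)) \<le> ennreal (LINT x|circ. poisson r (x - t) * cmod (?q x))"
    by (rule ennreal_leI)
  also have "\<dots> = (\<integral>\<^sup>+ x. ennreal (poisson r (x - t) * cmod (?q x)) \<partial>circ)"
    by (rule nn_integral_eq_integral[symmetric])
      (use integrable_poisson_mult[of "\<lambda>x. cmod (?q x)" _ t] qb in \<open>auto simp: poisson_nonneg\<close>)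
  finally show ?thesis by (simp add: ennreal_mult poisson_nonneg)
qed

end

text \<open>By the triangle inequality for chords, one of the distances from \<open>x\<close> to
  \<open>t\<close> and to \<open>u\<close> is at least half the distance between \<open>t\<close>
  and \<open>u\<close>; the corresponding kernel is then at most 4 times its value at
  \<open>u - t\<close>. The radii are unrelated because in the application each depends on its own
  angle.\<close>

lemma poisson_product_le:
  assumes r: "0 \<le> r" "r < 1" and s: "0 \<le> s" "s < 1"
  shows "poisson r (x - t) * poisson s (x - u) \<le>
     4 * (poisson r (u - t) * poisson s (x - u) + poisson r (x - t) * poisson s (u - t))"
proof -
  have "cis (x - t) - cis (u - t) = cis (u - t) * (cis (x - u) - 1)"
    by (simp add: cis_mult algebra_simps)
  then have "cmod (cis (x - t) - cis (u - t)) = cmod (1 - cis (x - u))"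
    by (simp add: norm_mult norm_minus_commute)
  then have "cmod (1 - cis (u - t)) \<le> cmod (1 - cis (x - t)) + cmod (1 - cis (x - u))"
    using norm_triangle_ineq[of "1 - cis (x - t)" "cis (x - t) - cis (u - t)"] by simp
  then consider "cmod (1 - cis (u - t)) \<le> 2 * cmod (1 - cis (x - t))" | "cmod (1 - cis (u - t)) \<le> 2 * cmod (1 - cis (x - u))"
    by linarith
  then show ?thesis
  proof cases
    case 1
    have "poisson r (x - t) * poisson s (x - u) \<le> (4 * poisson r (u - t)) * poisson s (x - u)"
      by (intro mult_right_mono poisson_compare r 1 poisson_nonneg s)
    then show ?thesis using mult_nonneg_nonneg[OF poisson_nonneg[OF r] poisson_nonneg[OF s]]
      by (simp add: algebra_simps) (smt (verit))
  next
    case 2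
    have "poisson r (x - t) * poisson s (x - u) \<le> poisson r (x - t) * (4 * poisson s (u - t))"
      by (intro mult_left_mono poisson_compare r 2 poisson_nonneg s)
    then show ?thesis using mult_nonneg_nonneg[OF poisson_nonneg[OF r] poisson_nonneg[OF s]]
      by (simp add: algebra_simps) (smt (verit))
  qed
qed

text \<open>In each summand of the pointwise bound only one kernel still depends on
  \<open>x\<close>; its integral \<open>2 * pi\<close> turns the factor 4 into
  \<open>8 * pi\<close>.\<close>

lemma nn_integral_poisson_product_le:
  assumes r: "0 \<le> r" "r < 1" and s: "0 \<le> s" "s < 1"
  shows "(\<integral>\<^sup>+ x. ennreal (poisson r (x - t)) * ennreal (poisson s (x - u)) \<partial>circ)
     \<le> ennreal (8 * pi) * (ennreal (poisson r (u - t)) + ennreal (poisson s (t - u)))"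
proof -
  have ps: "poisson s (u - t) = poisson s (t - u)" using poisson_sym[OF s, of "t - u"] by simp
  have "(\<integral>\<^sup>+ x. ennreal (poisson r (x - t)) * ennreal (poisson s (x - u)) \<partial>circ)
     \<le> (\<integral>\<^sup>+ x. 4 * ennreal (poisson r (u - t)) * ennreal (poisson s (x - u)) + 4 * ennreal (poisson s (t - u)) * ennreal (poisson r (x - t)) \<partial>circ)"
  proof (rule nn_integral_mono)
    fix x
    have "ennreal (poisson r (x - t) * poisson s (x - u)) \<le> ennreal (4 * (poisson r (u - t) * poisson s (x - u) + poisson r (x - t) * poisson s (u - t)))"
      by (rule ennreal_leI[OF poisson_product_le[OF r s]])
    then show "ennreal (poisson r (x - t)) * ennreal (poisson s (x - u)) \<le> 4 * ennreal (poisson r (u - t)) * ennreal (poisson s (x - u)) + 4 * ennreal (poisson s (t - u)) * ennreal (poisson r (x - t))"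
      unfolding ps by (simp add: ennreal_mult ennreal_plus poisson_nonneg r s distrib_left mult_ac)
  qed
  also have "\<dots> = 4 * ennreal (poisson r (u - t)) * ennreal (2 * pi) + 4 * ennreal (poisson s (t - u)) * ennreal (2 * pi)"
    by (simp add: nn_integral_add nn_integral_cmult nn_integral_poisson r s)
  also have "\<dots> = ennreal (8 * pi) * (ennreal (poisson r (u - t)) + ennreal (poisson s (t - u)))"
  proof -
    have "4 * ennreal p * ennreal (2 * pi) = ennreal (8 * pi) * ennreal p" if "0 \<le> p" for p
      using that by (simp flip: ennreal_mult ennreal_numeral)
    then show ?thesis by (simp add: distrib_left poisson_nonneg r s)
  qed
  finally show ?thesis .
qed

text \<open>A self-improving form of the \<open>TT\<^sup>*\<close> argument: an operator whose kernel satisfies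
  \<open>k k\<^sup>* \<le> C (k + k\<^sup>*)\<close> is bounded on \<open>L\<^sup>2\<close>.\<close>
lemma kernel_L2_bound:
  fixes u v :: "'a \<Rightarrow> ennreal" and k :: "'a \<Rightarrow> 'a \<Rightarrow> ennreal"
  assumes M: "finite_measure M"
    and u[measurable]: "u \<in> borel_measurable M" and v[measurable]: "v \<in> borel_measurable M"
    and k[measurable]: "(\<lambda>(t, x). k t x) \<in> borel_measurable (M \<Otimes>\<^sub>M M)"
    and uK: "\<And>t. u t \<le> ennreal K" and vK: "\<And>t. v t \<le> ennreal K" and kK: "\<And>t x. k t x \<le> ennreal K"
    and uv: "\<And>t. u t \<le> (\<integral>\<^sup>+ x. k t x * v x \<partial>M)"
    and kk: "\<And>s t. (\<integral>\<^sup>+ x. k t x * k s x \<partial>M) \<le> ennreal C * (k t s + k s t)"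
    and C: "0 \<le> C"
  shows "(\<integral>\<^sup>+ t. (u t)\<^sup>2 \<partial>M) \<le> ennreal (4 * C\<^sup>2) * (\<integral>\<^sup>+ t. (v t)\<^sup>2 \<partial>M)"
proof -
  interpret finite_measure M by fact
  interpret P: pair_sigma_finite M M by unfold_locales
  have [measurable (raw)]: "(\<lambda>x. k (f x) (g x)) \<in> borel_measurable N"
    if "f \<in> N \<rightarrow>\<^sub>M M" "g \<in> N \<rightarrow>\<^sub>M M" for f g N
    using measurable_compose[OF measurable_Pair[OF that] k] by simp
  \<comment> \<open>\<open>B\<close> is the transposed operator applied to \<open>u\<close>. The
    numbers below satisfy \<open>a \<le> e\<close>, \<open>e^2 \<le> b * c\<close>,
    \<open>d^2 \<le> a * b\<close> and \<open>b \<le> 2 * C * d\<close>; eliminating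
    \<open>b\<close>, \<open>d\<close> and \<open>e\<close> leaves
    \<open>a \<le> 4 * C^2 * c\<close>.\<close>
  define B where "B x = (\<integral>\<^sup>+ t. u t * k t x \<partial>M)" for x
  have [measurable]: "B \<in> borel_measurable M" unfolding B_def by measurable
  define a b c d e where "a = (\<integral>\<^sup>+ t. (u t)\<^sup>2 \<partial>M)" and "b = (\<integral>\<^sup>+ t. (B t)\<^sup>2 \<partial>M)"
    and "c = (\<integral>\<^sup>+ t. (v t)\<^sup>2 \<partial>M)" and "d = (\<integral>\<^sup>+ t. u t * B t \<partial>M)" and "e = (\<integral>\<^sup>+ x. B x * v x \<partial>M)"
  have fin: "(\<integral>\<^sup>+ t. f t \<partial>M) < \<infinity>" if "\<And>t. f t \<le> ennreal L" for f L
  proof -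
    have "(\<integral>\<^sup>+ t. f t \<partial>M) \<le> (\<integral>\<^sup>+ t. ennreal L \<partial>M)" by (rule nn_integral_mono) (rule that)
    also have "\<dots> < \<infinity>" by (simp add: emeasure_eq_measure ennreal_mult_less_top)
    finally show ?thesis .
  qed
  have mono2: "f * g \<le> ennreal (K' * K'')" if "f \<le> ennreal K'" "g \<le> ennreal K''" "0 \<le> K'" "0 \<le> K''" for f g K' K''
    using mult_mono[OF that(1,2)] that(3,4) by (simp add: ennreal_mult)
  have K0: "ennreal K = ennreal (max 0 K)" by (simp add: max_def ennreal_neg)
  define K' where "K' = max 0 K"
  have K': "0 \<le> K'" "\<And>t. u t \<le> ennreal K'" "\<And>t. v t \<le> ennreal K'" "\<And>t x. k t x \<le> ennreal K'"
    using uK vK kK K0 by (auto simp: K'_def)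
  have "B x \<le> (\<integral>\<^sup>+ t. ennreal (K' * K') \<partial>M)" for x
    unfolding B_def by (intro nn_integral_mono mono2 K')
  also have "\<dots> = ennreal (K' * K' * measure M (space M))"
    using K' by (simp add: emeasure_eq_measure ennreal_mult)
  finally obtain L where L: "0 \<le> L" "\<And>x. B x \<le> ennreal L"
    using K' by (metis measure_nonneg mult_nonneg_nonneg)
  \<comment> \<open>The bound \<open>K\<close> makes these integrals finite, so that
    \<open>a\<close> and \<open>b\<close> may be cancelled at the end; it does not enter the
    constant.\<close>
  have finite: "a < \<infinity>" "b < \<infinity>" "c < \<infinity>" "d < \<infinity>" "e < \<infinity>"
    unfolding a_def b_def c_def d_def e_def power2_eq_square
    by (rule fin[OF mono2[OF K'(2) K'(2) K'(1) K'(1)]] fin[OF mono2[OF L(2) L(2) L(1) L(1)]]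
      fin[OF mono2[OF K'(3) K'(3) K'(1) K'(1)]] fin[OF mono2[OF K'(2) L(2) K'(1) L(1)]]
      fin[OF mono2[OF L(2) K'(3) L(1) K'(1)]])+
  have ae: "a \<le> e"
  proof -
    have "a \<le> (\<integral>\<^sup>+ t. u t * (\<integral>\<^sup>+ x. k t x * v x \<partial>M) \<partial>M)"
      unfolding a_def power2_eq_square by (intro nn_integral_mono mult_left_mono uv) auto
    also have "\<dots> = (\<integral>\<^sup>+ t. \<integral>\<^sup>+ x. u t * k t x * v x \<partial>M \<partial>M)"
      by (intro nn_integral_cong) (simp add: nn_integral_cmult[symmetric] mult.assoc)
    also have "\<dots> = (\<integral>\<^sup>+ x. \<integral>\<^sup>+ t. u t * k t x * v x \<partial>M \<partial>M)"
      by (rule P.Fubini') measurable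
    also have "\<dots> = e" unfolding e_def B_def
      by (intro nn_integral_cong) (simp add: nn_integral_multc)
    finally show ?thesis .
  qed
  have e2: "e\<^sup>2 \<le> b * c" unfolding e_def b_def c_def by (rule Cauchy_Schwarz_nn_integral) measurable
  have d2: "d\<^sup>2 \<le> a * b" unfolding d_def a_def b_def by (rule Cauchy_Schwarz_nn_integral) measurable
  \<comment> \<open>Expanding the square of \<open>B\<close> and integrating over the inner variable
    first produces the composition of the kernel with its transpose, to which \<open>kk\<close>
    applies.\<close>
  have bd: "b \<le> ennreal C * (d + d)"
  proof -
    have "b = (\<integral>\<^sup>+ x. \<integral>\<^sup>+ t. \<integral>\<^sup>+ s. u t * u s * (k t x * k s x) \<partial>M \<partial>M \<partial>M)"
      unfolding b_def B_def power2_eq_square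
      by (intro nn_integral_cong)
        (simp add: nn_integral_multc[symmetric] nn_integral_cmult[symmetric] mult_ac)
    also have "\<dots> = (\<integral>\<^sup>+ t. \<integral>\<^sup>+ x. \<integral>\<^sup>+ s. u t * u s * (k t x * k s x) \<partial>M \<partial>M \<partial>M)"
      by (rule P.Fubini') measurable
    also have "\<dots> = (\<integral>\<^sup>+ t. \<integral>\<^sup>+ s. \<integral>\<^sup>+ x. u t * u s * (k t x * k s x) \<partial>M \<partial>M \<partial>M)"
      by (intro nn_integral_cong P.Fubini') measurable
    also have "\<dots> \<le> (\<integral>\<^sup>+ t. \<integral>\<^sup>+ s. ennreal C * (u s * (u t * k t s) + u t * (u s * k s t)) \<partial>M \<partial>M)"
    proof (intro nn_integral_mono)
      fix t s assume [measurable]: "t \<in> space M" "s \<in> space M"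
      have "(\<integral>\<^sup>+ x. u t * u s * (k t x * k s x) \<partial>M) = u t * u s * (\<integral>\<^sup>+ x. k t x * k s x \<partial>M)"
        by (rule nn_integral_cmult) measurable
      also have "\<dots> \<le> u t * u s * (ennreal C * (k t s + k s t))" by (intro mult_left_mono kk) auto
      finally show "(\<integral>\<^sup>+ x. u t * u s * (k t x * k s x) \<partial>M) \<le> ennreal C * (u s * (u t * k t s) + u t * (u s * k s t))"
        by (simp add: distrib_left mult_ac)
    qed
    also have "\<dots> = ennreal C * ((\<integral>\<^sup>+ t. \<integral>\<^sup>+ s. u s * (u t * k t s) \<partial>M \<partial>M) + (\<integral>\<^sup>+ t. \<integral>\<^sup>+ s. u t * (u s * k s t) \<partial>M \<partial>M))"
    proof -
      have "(\<integral>\<^sup>+ t. \<integral>\<^sup>+ s. ennreal C * (u s * (u t * k t s) + u t * (u s * k s t)) \<partial>M \<partial>M) =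
        (\<integral>\<^sup>+ t. ennreal C * ((\<integral>\<^sup>+ s. u s * (u t * k t s) \<partial>M) + (\<integral>\<^sup>+ s. u t * (u s * k s t) \<partial>M)) \<partial>M)"
      proof (intro nn_integral_cong)
        fix t assume [measurable]: "t \<in> space M"
        have "(\<integral>\<^sup>+ s. ennreal C * (u s * (u t * k t s) + u t * (u s * k s t)) \<partial>M) =
          ennreal C * (\<integral>\<^sup>+ s. u s * (u t * k t s) + u t * (u s * k s t) \<partial>M)"
          by (rule nn_integral_cmult) measurable
        also have "(\<integral>\<^sup>+ s. u s * (u t * k t s) + u t * (u s * k s t) \<partial>M) =
          (\<integral>\<^sup>+ s. u s * (u t * k t s) \<partial>M) + (\<integral>\<^sup>+ s. u t * (u s * k s t) \<partial>M)"
          by (rule nn_integral_add) measurable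
        finally show "(\<integral>\<^sup>+ s. ennreal C * (u s * (u t * k t s) + u t * (u s * k s t)) \<partial>M) =
          ennreal C * ((\<integral>\<^sup>+ s. u s * (u t * k t s) \<partial>M) + (\<integral>\<^sup>+ s. u t * (u s * k s t) \<partial>M))" .
      qed
      also have "\<dots> = ennreal C * (\<integral>\<^sup>+ t. (\<integral>\<^sup>+ s. u s * (u t * k t s) \<partial>M) + (\<integral>\<^sup>+ s. u t * (u s * k s t) \<partial>M) \<partial>M)"
        by (rule nn_integral_cmult) measurable
      also have "(\<integral>\<^sup>+ t. (\<integral>\<^sup>+ s. u s * (u t * k t s) \<partial>M) + (\<integral>\<^sup>+ s. u t * (u s * k s t) \<partial>M) \<partial>M) =
        (\<integral>\<^sup>+ t. \<integral>\<^sup>+ s. u s * (u t * k t s) \<partial>M \<partial>M) + (\<integral>\<^sup>+ t. \<integral>\<^sup>+ s. u t * (u s * k s t) \<partial>M \<partial>M)"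
        by (rule nn_integral_add) measurable
      finally show ?thesis .
    qed
    also have "(\<integral>\<^sup>+ t. \<integral>\<^sup>+ s. u t * (u s * k s t) \<partial>M \<partial>M) = d"
      unfolding d_def B_def by (intro nn_integral_cong nn_integral_cmult) measurable
    also have "(\<integral>\<^sup>+ t. \<integral>\<^sup>+ s. u s * (u t * k t s) \<partial>M \<partial>M) = d"
    proof -
      have "(\<integral>\<^sup>+ t. \<integral>\<^sup>+ s. u s * (u t * k t s) \<partial>M \<partial>M) = (\<integral>\<^sup>+ s. \<integral>\<^sup>+ t. u s * (u t * k t s) \<partial>M \<partial>M)"
        by (rule P.Fubini') measurable
      also have "\<dots> = d" unfolding d_def B_def by (intro nn_integral_cong nn_integral_cmult) measurable
      finally show ?thesis .
    qed
    finally show ?thesis .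
  qed
  obtain a' b' c' d' e' where r: "a = ennreal a'" "b = ennreal b'" "c = ennreal c'" "d = ennreal d'" "e = ennreal e'"
    "0 \<le> a'" "0 \<le> b'" "0 \<le> c'" "0 \<le> d'" "0 \<le> e'"
    using finite by (cases a; cases b; cases c; cases d; cases e) auto
  have i: "a' \<le> e'" "e'\<^sup>2 \<le> b' * c'" "d'\<^sup>2 \<le> a' * b'" "b' \<le> C * (d' + d')"
    using ae e2 d2 bd r(6-) C unfolding r(1-5) by (simp_all add: ennreal_power flip: ennreal_mult ennreal_plus)
  have "b'\<^sup>2 \<le> (C * (d' + d'))\<^sup>2" using i r by (intro power_mono) auto
  also have "\<dots> = 4 * C\<^sup>2 * d'\<^sup>2" by (simp add: power2_eq_square algebra_simps)
  also have "\<dots> \<le> 4 * C\<^sup>2 * (a' * b')" by (intro mult_left_mono i) auto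
  finally have "b' * b' \<le> (4 * C\<^sup>2 * a') * b'" by (simp add: power2_eq_square mult_ac)
  then have b: "b' \<le> 4 * C\<^sup>2 * a'" using r by (cases "b' = 0") (auto simp: mult_le_cancel_right)
  have "a'\<^sup>2 \<le> e'\<^sup>2" using i r by (intro power_mono) auto
  also have "\<dots> \<le> (4 * C\<^sup>2 * a') * c'" using i b r by (meson mult_right_mono order_trans)
  finally have "a' * a' \<le> (4 * C\<^sup>2 * c') * a'" by (simp add: power2_eq_square mult_ac)
  then have "a' \<le> 4 * C\<^sup>2 * c'" using r by (cases "a' = 0") (auto simp: mult_le_cancel_right)
  then have "a \<le> ennreal (4 * C\<^sup>2) * c" unfolding r(1,3) using r by (simp flip: ennreal_mult)
  then show ?thesis unfolding a_def c_def .
qed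

section \<open>Radial limits\<close>

lemma nn_integral_poly:
  "(\<integral>\<^sup>+ x. (ennreal (cmod (\<Sum>n<N. a n * cis x ^ n)))\<^sup>2 \<partial>circ) = ennreal (2 * pi * (\<Sum>n<N. (cmod (a n))\<^sup>2))"
proof -
  define b where "b n = (if n < N then a n else 0)" for n
  have s: "summable (\<lambda>n. norm (b n))" by (rule summable_finite[of "{..<N}"]) (auto simp: b_def)
  have f: "fser b x = (\<Sum>n<N. a n * cis x ^ n)" for x
  proof -
    have "fser b x = (\<Sum>n<N. b n * cis (real n * x))"
      unfolding fser_def by (rule suminf_finite) (auto simp: b_def)
    then show ?thesis by (simp add: Complex.DeMoivre b_def)
  qed
  have "(\<lambda>n. 2 * pi * (b n * cnj (b (n + 0)))) sums (LINT x|circ. cis (real 0 * x) * fser b x * cnj (fser b x))"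
    by (rule parseval_fser[OF s s])
  then have "(\<lambda>n. 2 * pi * (b n * cnj (b n))) sums (LINT x|circ. fser b x * cnj (fser b x))" by simp
  moreover have "(\<lambda>n. 2 * pi * (b n * cnj (b n))) sums (\<Sum>n<N. 2 * pi * (b n * cnj (b n)))"
    by (rule sums_finite) (auto simp: b_def)
  ultimately have "(LINT x|circ. fser b x * cnj (fser b x)) = (\<Sum>n<N. 2 * pi * (b n * cnj (b n)))"
    by (rule sums_unique2)
  also have "\<dots> = of_real (2 * pi * (\<Sum>n<N. (cmod (a n))\<^sup>2))"
    by (simp add: sum_distrib_left complex_norm_square b_def del: of_real_power)
  finally have "of_real (LINT x|circ. (cmod (fser b x))\<^sup>2) = (of_real (2 * pi * (\<Sum>n<N. (cmod (a n))\<^sup>2)) :: complex)"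
    by (simp add: complex_norm_square[symmetric] del: of_real_power)
  then have e: "(LINT x|circ. (cmod (fser b x))\<^sup>2) = 2 * pi * (\<Sum>n<N. (cmod (a n))\<^sup>2)"
    using of_real_eq_iff by blast
  have "integrable circ (\<lambda>x. (cmod (fser b x))\<^sup>2)"
    by (rule integrable_circ_bounded[where C = "(\<Sum>n. norm (b n))\<^sup>2"])
      (auto intro!: power_mono fser_sums(2)[OF s])
  then have "(\<integral>\<^sup>+ x. ennreal ((cmod (fser b x))\<^sup>2) \<partial>circ) = ennreal (2 * pi * (\<Sum>n<N. (cmod (a n))\<^sup>2))"
    by (subst nn_integral_eq_integral) (auto simp: e)
  then show ?thesis unfolding f by (simp add: ennreal_power)
qed

text \<open>For finitely many radii a maximising index \<open>r t\<close> depends measurably on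
  \<open>t\<close>, and the Poisson kernel with that radius, divided by \<open>2 * pi\<close>,
  satisfies the kernel condition with \<open>C = 4\<close>. This gives the constant
  \<open>4 * 4^2 * 2 * pi\<close>.\<close>

lemma nn_integral_max_poly_le:
  fixes \<rho> :: "nat \<Rightarrow> real"
  assumes \<rho>: "\<And>j. 0 \<le> \<rho> j" "\<And>j. \<rho> j < 1"
  shows "(\<integral>\<^sup>+ t. (ennreal (MAX j\<in>{..K}. cmod (\<Sum>n<N. a n * (of_real (\<rho> j) * cis t) ^ n)))\<^sup>2 \<partial>circ)
    \<le> ennreal (128 * pi * (\<Sum>n<N. (cmod (a n))\<^sup>2))"
proof -
  define c where "c j t = cmod (\<Sum>n<N. a n * (of_real (\<rho> j) * cis t) ^ n)" for j t
  have [measurable]: "c j \<in> borel_measurable circ" for j unfolding c_def[abs_def] by measurable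
  \<comment> \<open>\<open>r t\<close> is an index, not a radius; taking the least maximiser makes
    the choice measurable.\<close>
  define r where "r t = (LEAST k. k \<le> K \<and> (\<forall>j\<in>{..K}. c j t \<le> c k t))" for t
  have rm [measurable]: "r \<in> measurable circ (count_space UNIV)" unfolding r_def by measurable
  have rt: "r t \<le> K" "c (r t) t = (MAX j\<in>{..K}. c j t)" for t
  proof -
    have "(MAX j\<in>{..K}. c j t) \<in> (\<lambda>j. c j t) ` {..K}" by (rule Max_in) auto
    then obtain k where "k \<le> K" "c k t = (MAX j\<in>{..K}. c j t)" by (auto simp only: image_iff atMost_iff)
    then have "k \<le> K \<and> (\<forall>j\<in>{..K}. c j t \<le> c k t)" by simp
    then have *: "r t \<le> K \<and> (\<forall>j\<in>{..K}. c j t \<le> c (r t) t)" unfolding r_def by (rule LeastI)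
    then show "r t \<le> K" by blast
    show "c (r t) t = (MAX j\<in>{..K}. c j t)"
      by (rule sym, rule Max_eqI) (use * in auto)
  qed
  define k where "k t x = ennreal (poisson (\<rho> (r t)) (x - t) / (2 * pi))" for t x
  define v where "v x = ennreal (cmod (\<Sum>n<N. a n * cis x ^ n))" for x
  \<comment> \<open>A crude common bound. It depends on \<open>K\<close> and \<open>N\<close>, but
    the constant of the estimate does not.\<close>
  define L where "L = Max (insert (\<Sum>n<N. cmod (a n)) ((\<lambda>j. 2 / (1 - \<rho> j)) ` {..K}))"
  have L1: "(\<Sum>n<N. cmod (a n)) \<le> L" unfolding L_def by (rule Max_ge) auto
  have L2: "2 / (1 - \<rho> j) \<le> L" if "j \<le> K" for j unfolding L_def by (rule Max_ge) (use that in auto)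
  have pb: "cmod (\<Sum>n<N. a n * z ^ n) \<le> (\<Sum>n<N. cmod (a n))" if "cmod z \<le> 1" for z
    by (rule order_trans[OF norm_sum], rule sum_mono)
      (use that in \<open>auto simp: norm_mult norm_power intro!: mult_left_le power_le_one\<close>)
  have "(\<integral>\<^sup>+ t. (ennreal (c (r t) t))\<^sup>2 \<partial>circ) \<le> ennreal (4 * 4\<^sup>2) * (\<integral>\<^sup>+ t. (v t)\<^sup>2 \<partial>circ)"
  proof (rule kernel_L2_bound[where k = k and K = L])
    show "finite_measure circ" by (rule finite_measure_circ)
    have [measurable]: "\<rho> \<in> measurable (count_space UNIV) borel" by simp
    show "(\<lambda>t. ennreal (c (r t) t)) \<in> borel_measurable circ"
      using measurable_compose_countable[of "\<lambda>i t. ennreal (c i t)" circ borel r] by measurable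
    show "v \<in> borel_measurable circ" unfolding v_def[abs_def] by measurable
    show "(\<lambda>(t, x). k t x) \<in> borel_measurable (circ \<Otimes>\<^sub>M circ)"
      unfolding k_def by measurable
    show "ennreal (c (r t) t) \<le> ennreal L" for t
      unfolding c_def using \<rho>[of "r t"]
      by (intro ennreal_leI order_trans[OF pb L1]) (simp add: norm_mult)
    show "v t \<le> ennreal L" for t
      unfolding v_def by (intro ennreal_leI order_trans[OF pb L1]) simp
    show "k t x \<le> ennreal L" for t x
    proof -
      have "poisson (\<rho> (r t)) (x - t) / (2 * pi) \<le> poisson (\<rho> (r t)) (x - t) / 1"
        using pi_gt3 by (intro divide_left_mono poisson_nonneg \<rho>) auto
      also have "\<dots> \<le> L" using poisson_le[OF \<rho>, of "r t" "x - t"] L2[OF rt(1)[of t]] by simp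
      finally show ?thesis unfolding k_def by (rule ennreal_leI)
    qed
    have k: "k t x = ennreal (1 / (2 * pi)) * ennreal (poisson (\<rho> (r t)) (x - t))" for t x
      unfolding k_def by (simp flip: ennreal_mult' add: poisson_nonneg \<rho>)
    show "ennreal (c (r t) t) \<le> (\<integral>\<^sup>+ x. k t x * v x \<partial>circ)" for t
    proof -
      have "ennreal (c (r t) t) = ennreal (1 / (2 * pi)) * ennreal (2 * pi * c (r t) t)"
        by (subst ennreal_mult[symmetric]) (auto simp: c_def)
      also have "\<dots> \<le> ennreal (1 / (2 * pi)) * (\<integral>\<^sup>+ x. ennreal (poisson (\<rho> (r t)) (x - t)) * v x \<partial>circ)"
        unfolding c_def v_def by (intro mult_left_mono poisson_poly_le \<rho>) auto
      also have "\<dots> = (\<integral>\<^sup>+ x. k t x * v x \<partial>circ)"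
        unfolding k v_def mult.assoc by (rule nn_integral_cmult[symmetric]) measurable
      finally show ?thesis .
    qed
    show "(\<integral>\<^sup>+ x. k t x * k s x \<partial>circ) \<le> ennreal 4 * (k t s + k s t)" for s t
    proof -
      have "(\<integral>\<^sup>+ x. k t x * k s x \<partial>circ) = ennreal (1 / (2 * pi)) * (ennreal (1 / (2 * pi)) *
          (\<integral>\<^sup>+ x. ennreal (poisson (\<rho> (r t)) (x - t)) * ennreal (poisson (\<rho> (r s)) (x - s)) \<partial>circ))"
        unfolding k by (subst nn_integral_cmult[symmetric], simp)+ (simp add: mult_ac)
      also have "\<dots> \<le> ennreal (1 / (2 * pi)) * (ennreal (1 / (2 * pi)) *
          (ennreal (8 * pi) * (ennreal (poisson (\<rho> (r t)) (s - t)) + ennreal (poisson (\<rho> (r s)) (t - s)))))"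
        by (intro mult_left_mono nn_integral_poisson_product_le \<rho>) auto
      also have "\<dots> = (ennreal (1 / (2 * pi)) * ennreal (8 * pi)) * (k t s + k s t)"
        unfolding k by (simp only: distrib_left mult_ac)
      also have "ennreal (1 / (2 * pi)) * ennreal (8 * pi) = ennreal 4"
        by (subst ennreal_mult[symmetric]) auto
      finally show ?thesis .
    qed
  qed simp
  also have "\<dots> = ennreal (4 * 4\<^sup>2) * ennreal (2 * pi * (\<Sum>n<N. (cmod (a n))\<^sup>2))"
    unfolding v_def nn_integral_poly ..
  also have "\<dots> = ennreal (128 * pi * (\<Sum>n<N. (cmod (a n))\<^sup>2))"
    by (subst ennreal_mult[symmetric]) (auto intro!: sum_nonneg mult_nonneg_nonneg simp: mult.assoc)
  finally show ?thesis unfolding rt(2) unfolding c_def .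
qed

text \<open>Monotone convergence in the number of radii, possible because the constant for finitely
  many radii is independent of \<open>K\<close>.\<close>

lemma nn_integral_sup_poly_le:
  fixes \<rho> :: "nat \<Rightarrow> real"
  assumes \<rho>: "\<And>j. 0 \<le> \<rho> j" "\<And>j. \<rho> j < 1"
  shows "(\<integral>\<^sup>+ t. (SUP j. ennreal ((cmod (\<Sum>n<N. a n * (of_real (\<rho> j) * cis t) ^ n))\<^sup>2)) \<partial>circ)
    \<le> ennreal (128 * pi * (\<Sum>n<N. (cmod (a n))\<^sup>2))"
proof -
  define c where "c j t = cmod (\<Sum>n<N. a n * (of_real (\<rho> j) * cis t) ^ n)" for j t
  have [measurable]: "c j \<in> borel_measurable circ" for j unfolding c_def[abs_def] by measurable
  have c_nonneg: "0 \<le> c j t" for j t unfolding c_def by simp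
  define u where "u K t = (ennreal (MAX j\<in>{..K}. c j t))\<^sup>2" for K :: nat and t
  have [measurable]: "u K \<in> borel_measurable circ" for K unfolding u_def by measurable
  have "(\<integral>\<^sup>+ t. (SUP j. ennreal ((c j t)\<^sup>2)) \<partial>circ) \<le> (\<integral>\<^sup>+ t. (SUP K. u K t) \<partial>circ)"
  proof (intro nn_integral_mono SUP_mono)
    fix t j
    have "c j t \<le> (MAX j\<in>{..j}. c j t)" by (rule Max_ge) auto
    moreover have "0 \<le> (MAX j\<in>{..j}. c j t)" using c_nonneg[of j t] calculation by (rule order_trans)
    ultimately have "ennreal ((c j t)\<^sup>2) \<le> u j t"
      unfolding u_def
      by (subst ennreal_power) (use c_nonneg[of j t] in \<open>auto intro!: ennreal_leI power_mono\<close>)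
    then show "\<exists>K\<in>UNIV. ennreal ((c j t)\<^sup>2) \<le> u K t" by blast
  qed
  also have "\<dots> = (SUP K. \<integral>\<^sup>+ t. u K t \<partial>circ)"
  proof (rule nn_integral_monotone_convergence_SUP)
    show "incseq u"
      unfolding incseq_def le_fun_def u_def
      by (intro allI impI power_mono ennreal_leI Max_mono) auto
  qed measurable
  also have "\<dots> \<le> ennreal (128 * pi * (\<Sum>n<N. (cmod (a n))\<^sup>2))"
    unfolding u_def c_def by (intro SUP_least nn_integral_max_poly_le \<rho>)
  finally show ?thesis unfolding c_def .
qed

text \<open>Countability keeps the supremum over radii measurable. Density carries bounds for
  polynomials in \<open>r\<close> over to the whole interval, including the endpoint 1 where the
  limit is taken.\<close>

lemma dense_radii:
  obtains \<rho> :: "nat \<Rightarrow> real" where "\<And>j. 0 \<le> \<rho> j" "\<And>j. \<rho> j < 1" "{0..1} \<subseteq> closure (range \<rho>)"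
proof -
  let ?D = "\<rat> \<inter> {0..<1::real}"
  have D: "countable ?D" "?D \<noteq> {}" by (auto simp: countable_rat intro!: exI[of _ 0])
  have r: "range (from_nat_into ?D) = ?D" by (rule range_from_nat_into[OF D(2,1)])
  show thesis
  proof (rule that[of "from_nat_into ?D"])
    show "0 \<le> from_nat_into ?D j" "from_nat_into ?D j < 1" for j
      using from_nat_into[OF D(2), of j] by auto
    have "{0<..<1::real} \<subseteq> closure ?D"
    proof
      fix x :: real assume x: "x \<in> {0<..<1}"
      show "x \<in> closure ?D" unfolding closure_approachable
      proof (intro allI impI)
        fix e :: real assume "0 < e"
        then have "x < min 1 (x + e)" using x by auto
        then obtain q where "q \<in> \<rat>" "x < q" "q < min 1 (x + e)" using Rats_dense_in_real by blast
        then show "\<exists>y\<in>?D. dist y x < e" using x by (intro bexI[of _ q]) (auto simp: dist_real_def)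
      qed
    qed
    then have "closure {0<..<1::real} \<subseteq> closure ?D" by (rule closure_minimal) simp
    moreover have "closure {0<..<1::real} = {0..1}" by (rule closure_greaterThanLessThan) simp
    ultimately show "{0..1} \<subseteq> closure (range (from_nat_into ?D))" unfolding r by argo
  qed
qed

text \<open>Blocks of the Taylor series with rapidly decreasing \<open>H\<^sup>2\<close> norms converge, by the maximal
  inequality, uniformly along almost every radius.\<close>
lemma fatou_radial_limit:
  fixes a :: "nat \<Rightarrow> complex"
  assumes a: "summable (\<lambda>n. (cmod (a n))\<^sup>2)"
  shows "AE t in circ. \<exists>L. ((\<lambda>r. \<Sum>n. a n * (of_real r * cis t) ^ n) \<longlongrightarrow> L) (at_left 1)"
proof -
  obtain \<rho> :: "nat \<Rightarrow> real" where \<rho>: "\<And>j. 0 \<le> \<rho> j" "\<And>j. \<rho> j < 1" "{0..1} \<subseteq> closure (range \<rho>)"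
    by (rule dense_radii) blast
  define tail where "tail N = (\<Sum>n. (cmod (a (n + N)))\<^sup>2)" for N
  have sT: "summable (\<lambda>n. (cmod (a (n + N)))\<^sup>2)" for N by (rule summable_ignore_initial_segment[OF a])
  have tail0: "tail \<longlonglongrightarrow> 0" unfolding tail_def by (rule suminf_exist_split2[OF a])
  have tail_ge: "(\<Sum>n=N..<N'. (cmod (a n))\<^sup>2) \<le> tail N" for N N'
  proof (cases "N \<le> N'")
    case True
    then have "(\<Sum>n=N..<N'. (cmod (a n))\<^sup>2) = (\<Sum>n<N' - N. (cmod (a (n + N)))\<^sup>2)"
      by (intro sum.reindex_bij_witness[of _ "\<lambda>n. n + N" "\<lambda>n. n - N"]) auto
    also have "\<dots> \<le> tail N" unfolding tail_def by (rule sum_le_suminf[OF sT]) auto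
    finally show ?thesis .
  qed (auto simp: tail_def intro!: suminf_nonneg sT)
  \<comment> \<open>The rate 1/16 leaves room: weighted by \<open>4^k\<close>, the squared suprema
    of the blocks still have summable integrals, and finiteness of the weighted sum bounds block
    \<open>k\<close> by a multiple of \<open>(1/2)^k\<close>.\<close>
  have "\<exists>N0. \<forall>N\<ge>N0. tail N \<le> (1/16) ^ k" for k
    using order_tendstoD(2)[OF tail0, of "(1/16) ^ k"] unfolding eventually_sequentially by (auto intro: less_imp_le)
  then obtain N0 where N0: "\<And>k N. N \<ge> N0 k \<Longrightarrow> tail N \<le> (1/16) ^ k" by metis
  \<comment> \<open>Cumulative sums make the cut points increasing while each is still at least
    \<open>N0 k\<close>. The added 1 forces \<open>k \<le> N k\<close>, so the blocks exhaust the
    series.\<close>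
  define N where "N k = (\<Sum>j\<le>k. N0 j + 1)" for k
  have N_ge: "N0 k \<le> N k" "k \<le> N k" "N k \<le> N (Suc k)" for k
    unfolding N_def by (induction k) auto
  define b where "b k n = (if n \<in> {N k..<N (Suc k)} then a n else 0)" for k n
  define G where "G k t = (SUP j. ennreal ((cmod (\<Sum>n<N (Suc k). b k n * (of_real (\<rho> j) * cis t) ^ n))\<^sup>2))" for k t
  have [measurable]: "G k \<in> borel_measurable circ" for k unfolding G_def by measurable
  have G: "(\<integral>\<^sup>+ t. G k t \<partial>circ) \<le> ennreal (128 * pi * (1/16) ^ k)" for k
  proof -
    have "(\<Sum>n<N (Suc k). (cmod (b k n))\<^sup>2) = (\<Sum>n=N k..<N (Suc k). (cmod (a n))\<^sup>2)"
      unfolding b_def by (intro sum.mono_neutral_cong_right) auto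
    also have "\<dots> \<le> (1/16) ^ k" using tail_ge[of "N k" "N (Suc k)"] N0[OF N_ge(1)[of k]] by linarith
    finally have "128 * pi * (\<Sum>n<N (Suc k). (cmod (b k n))\<^sup>2) \<le> 128 * pi * (1/16) ^ k" by simp
    then show ?thesis
      using nn_integral_sup_poly_le[OF \<rho>(1,2), where a = "b k" and N = "N (Suc k)"] unfolding G_def
      by (meson ennreal_leI order_trans)
  qed
  have "(\<integral>\<^sup>+ t. (\<Sum>k. ennreal (4 ^ k) * G k t) \<partial>circ) = (\<Sum>k. \<integral>\<^sup>+ t. ennreal (4 ^ k) * G k t \<partial>circ)"
    by (rule nn_integral_suminf) measurable
  also have "\<dots> \<le> (\<Sum>k. ennreal (128 * pi * (1/4) ^ k))"
  proof (rule suminf_le)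
    fix k
    have "(\<integral>\<^sup>+ t. ennreal (4 ^ k) * G k t \<partial>circ) = ennreal (4 ^ k) * (\<integral>\<^sup>+ t. G k t \<partial>circ)"
      by (rule nn_integral_cmult) measurable
    also have "\<dots> \<le> ennreal (4 ^ k) * ennreal (128 * pi * (1/16) ^ k)" by (intro mult_left_mono G) auto
    also have "\<dots> = ennreal (128 * pi * (4 ^ k * (1/16) ^ k))" by (subst ennreal_mult[symmetric]) (auto simp: mult_ac)
    also have "(4::real) ^ k * (1/16) ^ k = (1/4) ^ k" by (simp flip: power_mult_distrib)
    finally show "(\<integral>\<^sup>+ t. ennreal (4 ^ k) * G k t \<partial>circ) \<le> ennreal (128 * pi * (1/4) ^ k)" .
  qed auto
  also have "\<dots> = ennreal (\<Sum>k. 128 * pi * (1/4) ^ k)"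
    by (intro suminf_ennreal2 summable_mult summable_geometric) auto
  also have "\<dots> < \<infinity>" by simp
  finally have "AE t in circ. (\<Sum>k. ennreal (4 ^ k) * G k t) \<noteq> \<infinity>"
    by (intro nn_integral_PInf_AE) auto
  then show ?thesis
  proof (rule AE_mp, intro AE_I2 impI)
    fix t assume "(\<Sum>k. ennreal (4 ^ k) * G k t) \<noteq> \<infinity>"
    then obtain c where c: "0 \<le> c" "(\<Sum>k. ennreal (4 ^ k) * G k t) = ennreal c"
      by (cases "\<Sum>k. ennreal (4 ^ k) * G k t") auto
    define p where "p k r = (\<Sum>n<N (Suc k). b k n * (of_real r * cis t) ^ n)" for k and r :: real
    have pk: "cmod (p k r) \<le> sqrt c * (1/2) ^ k" if r: "r \<in> {0..1}" for k r
    proof -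
      have pj: "cmod (p k (\<rho> j)) \<le> sqrt c * (1/2) ^ k" for j
      proof -
        have "ennreal (4 ^ k * (cmod (p k (\<rho> j)))\<^sup>2) = ennreal (4 ^ k) * ennreal ((cmod (p k (\<rho> j)))\<^sup>2)"
          by (rule ennreal_mult) auto
        also have "\<dots> \<le> ennreal (4 ^ k) * G k t"
          unfolding G_def p_def by (intro mult_left_mono SUP_upper) auto
        also have "\<dots> \<le> ennreal c"
          unfolding c(2)[symmetric] using sum_le_suminf[of "\<lambda>k. ennreal (4 ^ k) * G k t" "{k}"] by simp
        finally have "4 ^ k * (cmod (p k (\<rho> j)))\<^sup>2 \<le> c" using c(1) by simp
        then have "(2 ^ k * cmod (p k (\<rho> j)))\<^sup>2 \<le> c"
          by (simp add: power_mult_distrib power2_eq_square[of "2 ^ k"] flip: power_mult_distrib[of 2 2 k])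
        then have "2 ^ k * cmod (p k (\<rho> j)) \<le> sqrt c" by (rule real_le_rsqrt)
        then show ?thesis by (simp add: field_simps power_divide)
      qed
      have "closed {r. cmod (p k r) \<le> sqrt c * (1/2) ^ k}"
        unfolding p_def by (intro closed_Collect_le continuous_intros)
      then have "closure (range \<rho>) \<subseteq> {r. cmod (p k r) \<le> sqrt c * (1/2) ^ k}"
        by (intro closure_minimal) (use pj in auto)
      then show ?thesis using \<rho>(3) r by auto
    qed
    \<comment> \<open>The candidate on the closed radius: the blocks converge uniformly up to
      \<open>r = 1\<close>, so \<open>F\<close> is continuous there and \<open>F 1\<close> is the
      radial limit.\<close>
    define F where "F r = (\<Sum>n<N 0. a n * (of_real r * cis t) ^ n) + (\<Sum>k. p k r)" for r :: real
    have "uniform_limit {0..1} (\<lambda>K r. \<Sum>k<K. p k r) (\<lambda>r. \<Sum>k. p k r) sequentially"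
      by (rule Weierstrass_m_test[of "{0..1}" p "\<lambda>k. sqrt c * (1/2) ^ k"]) (auto intro!: pk summable_mult)
    then have "continuous_on {0..1} (\<lambda>r. \<Sum>k. p k r)"
      by (rule uniform_limit_theorem[rotated])
        (auto simp: p_def[abs_def] intro!: always_eventually continuous_intros)
    then have contF: "continuous_on {0..1} F"
      unfolding F_def by (intro continuous_intros)
    have part: "(\<Sum>n<N 0. a n * (of_real r * cis t) ^ n) + (\<Sum>k<K. p k r) = (\<Sum>n<N K. a n * (of_real r * cis t) ^ n)" for K r
    proof (induction K)
      case (Suc K)
      have "p K r = (\<Sum>n=N K..<N (Suc K). a n * (of_real r * cis t) ^ n)"
        unfolding p_def b_def by (intro sum.mono_neutral_cong_right) auto
      then show ?case using Suc sum.atLeastLessThan_concat[of 0 "N K" "N (Suc K)" "\<lambda>n. a n * (of_real r * cis t) ^ n"] N_ge(3)[of K]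
        by (simp add: lessThan_atLeast0 add.assoc[symmetric])
    qed simp
    have eqF: "F r = (\<Sum>n. a n * (of_real r * cis t) ^ n)" if r: "0 \<le> r" "r < 1" for r
    proof -
      have "bounded (range a)"
      proof -
        have "a \<longlonglongrightarrow> 0" using summable_LIMSEQ_zero[OF a] by (simp add: tendsto_norm_zero_iff)
        then show ?thesis by (rule convergent_imp_bounded)
      qed
      then obtain B where B: "\<And>n. cmod (a n) \<le> B" unfolding bounded_iff by auto
      have "summable (\<lambda>n. a n * (of_real r * cis t) ^ n)"
      proof (rule summable_norm_cancel, rule summable_comparison_test'[of "\<lambda>n. B * r ^ n" 0])
        show "summable (\<lambda>n. B * r ^ n)" using r by (intro summable_mult summable_geometric) auto
        show "norm (norm (a n * (of_real r * cis t) ^ n)) \<le> B * r ^ n" for n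
          using B[of n] r by (simp add: norm_mult norm_power mult_right_mono)
      qed
      then have l1: "(\<lambda>M. \<Sum>n<M. a n * (of_real r * cis t) ^ n) \<longlonglongrightarrow> (\<Sum>n. a n * (of_real r * cis t) ^ n)"
        by (rule summable_LIMSEQ)
      have "filterlim N at_top sequentially"
        by (rule filterlim_at_top_mono[OF filterlim_ident]) (use N_ge in auto)
      then have l2: "(\<lambda>K. \<Sum>n<N K. a n * (of_real r * cis t) ^ n) \<longlonglongrightarrow> (\<Sum>n. a n * (of_real r * cis t) ^ n)"
        by (rule filterlim_compose[OF l1])
      have "summable (\<lambda>k. p k r)"
        by (rule summable_comparison_test'[of "\<lambda>k. sqrt c * (1/2) ^ k" 0]) (use pk r in \<open>auto intro!: summable_mult\<close>)
      then have "(\<lambda>K. (\<Sum>n<N 0. a n * (of_real r * cis t) ^ n) + (\<Sum>k<K. p k r)) \<longlonglongrightarrow> F r"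
        unfolding F_def by (intro tendsto_add tendsto_const summable_LIMSEQ)
      then show ?thesis unfolding part using l2 LIMSEQ_unique by blast
    qed
    have "(F \<longlongrightarrow> F 1) (at 1 within {0..1})" using contF by (auto simp: continuous_on_def)
    then have "(F \<longlongrightarrow> F 1) (at_left 1)"
      by (simp add: at_within_Icc_at_left)
    moreover have "eventually (\<lambda>r. F r = (\<Sum>n. a n * (of_real r * cis t) ^ n)) (at_left (1::real))"
      by (rule eventually_at_leftI[of 0]) (auto intro: eqF)
    ultimately have "((\<lambda>r. \<Sum>n. a n * (of_real r * cis t) ^ n) \<longlongrightarrow> F 1) (at_left 1)"
      by (rule Lim_transform_eventually)
    then show "\<exists>L. ((\<lambda>r. \<Sum>n. a n * (of_real r * cis t) ^ n) \<longlongrightarrow> L) (at_left 1)" by blast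
  qed
qed

section \<open>Boundary values of bounded functions\<close>

definition pser :: "(nat \<Rightarrow> complex) \<Rightarrow> complex \<Rightarrow> complex" where
  "pser a z = (\<Sum>n. a n * z ^ n)"

lemma summable_pser:
  assumes "bounded (range a)" "cmod z < 1"
  shows "summable (\<lambda>n. cmod (a n * z ^ n))"
proof -
  obtain B where B: "\<And>n. cmod (a n) \<le> B" using assms(1) unfolding bounded_iff by auto
  show ?thesis
  proof (rule summable_comparison_test'[of "\<lambda>n. B * cmod z ^ n" 0])
    show "summable (\<lambda>n. B * cmod z ^ n)" using assms(2) by (intro summable_mult summable_geometric) auto
    show "norm (cmod (a n * z ^ n)) \<le> B * cmod z ^ n" for n
      using B[of n] by (simp add: norm_mult norm_power mult_right_mono)
  qed
qed

lemma pser_sums: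
  assumes "bounded (range a)" "cmod z < 1"
  shows "(\<lambda>n. a n * z ^ n) sums pser a z"
  unfolding pser_def by (rule summable_sums[OF summable_norm_cancel[OF summable_pser[OF assms]]])

definition conv :: "(nat \<Rightarrow> complex) \<Rightarrow> (nat \<Rightarrow> complex) \<Rightarrow> nat \<Rightarrow> complex" where
  "conv a b n = (\<Sum>s\<le>n. a s * b (n - s))"

lemma conv_sums:
  assumes "bounded (range a)" "bounded (range b)" "cmod z < 1"
  shows "(\<lambda>n. conv a b n * z ^ n) sums (pser a z * pser b z)"
proof -
  have "(\<lambda>n. \<Sum>s\<le>n. (a s * z ^ s) * (b (n - s) * z ^ (n - s))) sums (pser a z * pser b z)"
    unfolding pser_def by (rule Cauchy_product_sums) (rule summable_pser[OF assms(1,3)], rule summable_pser[OF assms(2,3)])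
  moreover have "(\<Sum>s\<le>n. (a s * z ^ s) * (b (n - s) * z ^ (n - s))) = conv a b n * z ^ n" for n
    unfolding conv_def sum_distrib_right
  proof (intro sum.cong refl)
    fix s assume "s \<in> {..n}"
    then have "z ^ s * z ^ (n - s) = z ^ n" by (simp flip: power_add)
    then show "(a s * z ^ s) * (b (n - s) * z ^ (n - s)) = a s * b (n - s) * z ^ n"
      by (simp only: mult_ac flip: \<open>z ^ s * z ^ (n - s) = z ^ n\<close>)
  qed
  ultimately show ?thesis by (simp only:)
qed

lemma bounded_range_square_summable:
  fixes a :: "nat \<Rightarrow> complex"
  assumes "summable (\<lambda>n. (cmod (a n))\<^sup>2)"
  shows "bounded (range a)"
proof -
  have "a \<longlonglongrightarrow> 0" using summable_LIMSEQ_zero[OF assms] by (simp add: tendsto_norm_zero_iff)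
  then show ?thesis by (rule convergent_imp_bounded)
qed

lemma summable_mult_square_summable:
  fixes a b :: "nat \<Rightarrow> complex"
  assumes "summable (\<lambda>n. (cmod (a n))\<^sup>2)" "summable (\<lambda>n. (cmod (b n))\<^sup>2)"
  shows "summable (\<lambda>n. cmod (a n * cnj (b n)))"
proof (rule summable_comparison_test'[OF summable_add[OF assms], of 0])
  show "norm (cmod (a n * cnj (b n))) \<le> (cmod (a n))\<^sup>2 + (cmod (b n))\<^sup>2" for n
  proof -
    have "0 \<le> cmod (a n) * cmod (b n)" by simp
    then show ?thesis using sum_squares_bound[of "cmod (a n)" "cmod (b n)"]
      unfolding norm_mult real_norm_def complex_mod_cnj by linarith
  qed
qed

context
  fixes r :: real
  assumes r: "0 \<le> r" "r < 1"
begin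

lemma pser_fser:
  assumes "bounded (range a)"
  shows "summable (\<lambda>n. cmod (a n * of_real r ^ n))" "pser a (of_real r * cis t) = fser (\<lambda>n. a n * of_real r ^ n) t"
proof -
  show "summable (\<lambda>n. cmod (a n * of_real r ^ n))" by (rule summable_pser[OF assms]) (use r in auto)
  show "pser a (of_real r * cis t) = fser (\<lambda>n. a n * of_real r ^ n) t"
    unfolding pser_def fser_def by (simp add: power_mult_distrib Complex.DeMoivre mult.assoc)
qed

lemma measurable_pser_circle:
  assumes "bounded (range a)"
  shows "(\<lambda>t. pser a (of_real r * cis t)) \<in> borel_measurable borel"
  unfolding pser_fser(2)[OF assms] by measurable

lemma parseval_pser:
  assumes "bounded (range a)" "bounded (range b)"
  shows "(\<lambda>n. 2 * pi * (a n * cnj (b (n + k)) * of_real r ^ (2 * n + k))) sums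
    (LINT t|circ. cis (real k * t) * pser a (of_real r * cis t) * cnj (pser b (of_real r * cis t)))"
proof -
  have "(\<lambda>n. 2 * pi * (a n * of_real r ^ n * cnj (b (n + k) * of_real r ^ (n + k)))) sums
    (LINT t|circ. cis (real k * t) * pser a (of_real r * cis t) * cnj (pser b (of_real r * cis t)))"
    unfolding pser_fser(2)[OF assms(1)] pser_fser(2)[OF assms(2)]
    by (rule parseval_fser) (rule pser_fser(1)[OF assms(1)], rule pser_fser(1)[OF assms(2)])
  moreover have "2 * pi * (a n * of_real r ^ n * cnj (b (n + k) * of_real r ^ (n + k))) =
      2 * pi * (a n * cnj (b (n + k)) * of_real r ^ (2 * n + k))" for n
  proof -
    have "complex_of_real r ^ (2 * n + k) = of_real r ^ n * of_real r ^ (n + k)"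
      by (simp add: mult_2 power_add)
    then show ?thesis by (simp only: complex_cnj_mult complex_cnj_power complex_cnj_complex_of_real mult_ac)
  qed
  ultimately show ?thesis by (simp only:)
qed

end

text \<open>Multiplication by a function bounded by \<open>C\<close> has norm at most
  \<open>C\<close> on \<open>H^2\<close>. The first coefficients of a product depend only on the
  first coefficients of the factors, so \<open>\<gamma>\<close> can be truncated and may be
  arbitrary. Parseval is used on circles of radius \<open>r < 1\<close>, and \<open>r\<close> tends
  to 1 in the finite sum at the end.\<close>

lemma toeplitz_bound:
  assumes c: "bounded (range c)" "\<And>z. cmod z < 1 \<Longrightarrow> cmod (pser c z) \<le> C"
  shows "(\<Sum>n\<le>N. (cmod (\<Sum>s\<le>n. c s * \<gamma> (n - s)))\<^sup>2) \<le> C\<^sup>2 * (\<Sum>n\<le>N. (cmod (\<gamma> n))\<^sup>2)"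
proof -
  define g where "g n = (if n \<le> N then \<gamma> n else 0)" for n
  define p where "p n = (\<Sum>s\<le>n. c s * g (n - s))" for n
  have bg: "bounded (range g)"
    by (rule finite_imp_bounded, rule finite_subset[of _ "insert 0 (\<gamma> ` {..N})"]) (auto simp: g_def)
  have main: "(\<Sum>n\<le>N. (cmod (p n))\<^sup>2 * r ^ (2 * n)) \<le> C\<^sup>2 * (\<Sum>n\<le>N. (cmod (\<gamma> n))\<^sup>2)" if r: "0 \<le> r" "r < 1" for r :: real
  proof -
    let ?g = "\<lambda>n. g n * of_real r ^ n" and ?c = "\<lambda>n. c n * of_real r ^ n" and ?p = "\<lambda>n. p n * of_real r ^ n"
    have sg: "summable (\<lambda>n. cmod (?g n))" and sc: "summable (\<lambda>n. cmod (?c n))"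
      using pser_fser(1)[OF r bg] pser_fser(1)[OF r c(1)] by auto
    have conv: "(\<Sum>s\<le>n. ?c s * ?g (n - s)) = ?p n" for n
      unfolding p_def sum_distrib_right
      by (intro sum.cong refl) (auto simp: mult_ac simp flip: power_add)
    have sp: "summable (\<lambda>n. cmod (?p n))"
    proof -
      have "summable (\<lambda>n. \<Sum>s\<le>n. cmod (?c s) * cmod (?g (n - s)))"
        by (rule summable_Cauchy_product) (use sg sc in auto)
      then show ?thesis
      proof (rule summable_comparison_test'[of _ 0])
        show "norm (cmod (?p n)) \<le> (\<Sum>s\<le>n. cmod (?c s) * cmod (?g (n - s)))" for n
          unfolding conv[symmetric] real_norm_def abs_norm_cancel
          by (rule order_trans[OF norm_sum]) (simp add: norm_mult)
      qed
    qed
    have fp: "fser ?p t = fser ?c t * fser ?g t" for t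
    proof -
      have "fser ?c t * fser ?g t = (\<Sum>n. \<Sum>s\<le>n. (?c s * cis (real s * t)) * (?g (n - s) * cis (real (n - s) * t)))"
        unfolding fser_def by (rule Cauchy_product) (use sg sc in \<open>auto simp: norm_mult\<close>)
      also have "\<dots> = (\<Sum>n. (\<Sum>s\<le>n. ?c s * ?g (n - s)) * cis (real n * t))"
        unfolding sum_distrib_right
      proof (intro suminf_cong sum.cong refl)
        fix n s :: nat assume "s \<in> {..n}"
        then have "cis (real s * t) * cis (real (n - s) * t) = cis (real n * t)"
          by (simp add: cis_mult of_nat_diff algebra_simps)
        then show "(?c s * cis (real s * t)) * (?g (n - s) * cis (real (n - s) * t)) = ?c s * ?g (n - s) * cis (real n * t)"
          by (simp only: mult_ac flip: \<open>cis (real s * t) * cis (real (n - s) * t) = cis (real n * t)\<close>)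
      qed
      finally show ?thesis unfolding conv fser_def by simp
    qed
    have par: "(\<lambda>n. 2 * pi * (cmod (a n))\<^sup>2) sums (LINT t|circ. (cmod (fser a t))\<^sup>2)"
      if a: "summable (\<lambda>n. cmod (a n))" for a
    proof -
      have "(\<lambda>n. 2 * pi * (a n * cnj (a (n + 0)))) sums (LINT t|circ. cis (real 0 * t) * fser a t * cnj (fser a t))"
        by (rule parseval_fser[OF a a])
      then have "(\<lambda>n. of_real (2 * pi * (cmod (a n))\<^sup>2)) sums (of_real (LINT t|circ. (cmod (fser a t))\<^sup>2) :: complex)"
        by (simp add: complex_norm_square[symmetric] mult.assoc del: of_real_power)
      then show ?thesis by (simp only: sums_of_real_iff)
    qed
    have intg: "integrable circ (\<lambda>t. (cmod (fser a t))\<^sup>2)" if a: "summable (\<lambda>n. cmod (a n))" for a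
      by (rule integrable_circ_bounded[where C = "(\<Sum>n. norm (a n))\<^sup>2"])
        (auto intro!: power_mono fser_sums(2)[OF a])
    have "(LINT t|circ. (cmod (fser ?p t))\<^sup>2) \<le> (LINT t|circ. C\<^sup>2 * (cmod (fser ?g t))\<^sup>2)"
    proof (rule integral_mono)
      fix t
      have "cmod (fser ?c t) \<le> C"
        using c(2)[of "of_real r * cis t"] r unfolding pser_fser(2)[OF r c(1), symmetric] by (simp add: norm_mult)
      then have "(cmod (fser ?c t))\<^sup>2 \<le> C\<^sup>2" by (simp add: power_mono)
      then show "(cmod (fser ?p t))\<^sup>2 \<le> C\<^sup>2 * (cmod (fser ?g t))\<^sup>2"
        unfolding fp norm_mult power_mult_distrib by (rule mult_right_mono) simp
    qed (use intg[OF sp] intg[OF sg] in auto)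
    also have "\<dots> = C\<^sup>2 * (LINT t|circ. (cmod (fser ?g t))\<^sup>2)" by simp
    also have "(LINT t|circ. (cmod (fser ?g t))\<^sup>2) = (\<Sum>n\<le>N. 2 * pi * (cmod (?g n))\<^sup>2)"
      by (rule sums_unique2[OF par[OF sg] sums_finite]) (auto simp: g_def)
    also have "C\<^sup>2 * \<dots> \<le> C\<^sup>2 * (\<Sum>n\<le>N. 2 * pi * (cmod (\<gamma> n))\<^sup>2)"
    proof (intro mult_left_mono sum_mono)
      show "(cmod (?g n))\<^sup>2 \<le> (cmod (\<gamma> n))\<^sup>2" for n
        using r by (intro power_mono) (auto simp: g_def norm_mult norm_power intro!: mult_left_le power_le_one)
    qed auto
    finally have 1: "(LINT t|circ. (cmod (fser ?p t))\<^sup>2) \<le> 2 * pi * (C\<^sup>2 * (\<Sum>n\<le>N. (cmod (\<gamma> n))\<^sup>2))"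
      by (simp add: sum_distrib_left mult_ac)
    have "(\<Sum>n\<le>N. 2 * pi * (cmod (?p n))\<^sup>2) \<le> (LINT t|circ. (cmod (fser ?p t))\<^sup>2)"
      unfolding sums_unique[OF par[OF sp]] by (rule sum_le_suminf[OF sums_summable[OF par[OF sp]]]) auto
    with 1 have "2 * pi * (\<Sum>n\<le>N. (cmod (?p n))\<^sup>2) \<le> 2 * pi * (C\<^sup>2 * (\<Sum>n\<le>N. (cmod (\<gamma> n))\<^sup>2))"
      unfolding sum_distrib_left by linarith
    then have "(\<Sum>n\<le>N. (cmod (?p n))\<^sup>2) \<le> C\<^sup>2 * (\<Sum>n\<le>N. (cmod (\<gamma> n))\<^sup>2)" by simp
    then show ?thesis using r by (simp add: norm_mult norm_power power_mult_distrib power_mult mult.commute power_even_eq)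
  qed
  have "((\<lambda>r::real. \<Sum>n\<le>N. (cmod (p n))\<^sup>2 * r ^ (2 * n)) \<longlongrightarrow> (\<Sum>n\<le>N. (cmod (p n))\<^sup>2 * 1 ^ (2 * n))) (at_left 1)"
    by (intro tendsto_intros)
  moreover have "eventually (\<lambda>r::real. (\<Sum>n\<le>N. (cmod (p n))\<^sup>2 * r ^ (2 * n)) \<le> C\<^sup>2 * (\<Sum>n\<le>N. (cmod (\<gamma> n))\<^sup>2)) (at_left 1)"
    by (rule eventually_at_leftI[of 0]) (auto intro!: main)
  ultimately have "(\<Sum>n\<le>N. (cmod (p n))\<^sup>2 * 1 ^ (2 * n)) \<le> C\<^sup>2 * (\<Sum>n\<le>N. (cmod (\<gamma> n))\<^sup>2)"
    by (rule tendsto_upperbound) simp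
  moreover have "p n = (\<Sum>s\<le>n. c s * \<gamma> (n - s))" if "n \<le> N" for n
    unfolding p_def g_def using that by (intro sum.cong) auto
  ultimately show ?thesis by simp
qed

section \<open>Boundary values along a sequence of radii\<close>

definition radius :: "nat \<Rightarrow> real" where "radius j = 1 - inverse (of_nat (Suc j))"

lemma radius: "0 \<le> radius j" "radius j < 1" "radius \<longlonglongrightarrow> 1"
proof -
  show "0 \<le> radius j" "radius j < 1" by (auto simp: radius_def inverse_eq_divide divide_simps)
  show "radius \<longlonglongrightarrow> 1" unfolding radius_def using tendsto_diff[OF tendsto_const LIMSEQ_inverse_real_of_nat, of 1] by simp
qed

lemma radius_at_left: "filterlim radius (at_left 1) sequentially"
  unfolding filterlim_at using radius by (auto simp: less_imp_neq)

text \<open>The limit runs along one fixed sequence, so that \<open>bd a\<close> is measurable as a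
  limit of countably many measurable functions. Where the full radial limit exists, the two
  agree.\<close>

definition bd :: "(nat \<Rightarrow> complex) \<Rightarrow> real \<Rightarrow> complex" where
  "bd a t = lim (\<lambda>j. pser a (of_real (radius j) * cis t))"

lemma bd_eq:
  assumes "((\<lambda>r. pser a (of_real r * cis t)) \<longlongrightarrow> L) (at_left 1)"
  shows "bd a t = L"
  unfolding bd_def by (rule limI, rule filterlim_compose[OF assms radius_at_left])

lemma AE_radial_limit:
  assumes "summable (\<lambda>n. (cmod (a n))\<^sup>2)"
  shows "AE t in circ. ((\<lambda>r. pser a (of_real r * cis t)) \<longlongrightarrow> bd a t) (at_left 1)"
  using fatou_radial_limit[OF assms] unfolding pser_def[symmetric]
  by eventually_elim (use bd_eq in blast)

lemma AE_bd_limit: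
  assumes "summable (\<lambda>n. (cmod (a n))\<^sup>2)"
  shows "AE t in circ. (\<lambda>j. pser a (of_real (radius j) * cis t)) \<longlonglongrightarrow> bd a t"
  using AE_radial_limit[OF assms] by eventually_elim (rule filterlim_compose[OF _ radius_at_left])

lemma measurable_bd:
  assumes "bounded (range a)"
  shows "bd a \<in> borel_measurable circ"
proof -
  have [measurable]: "(\<lambda>t. pser a (of_real (radius j) * cis t)) \<in> borel_measurable circ" for j
    by (rule measurable_circ[OF measurable_pser_circle[OF radius(1,2) assms]])
  show ?thesis unfolding bd_def[abs_def] by measurable
qed

locale bounded_h2 =
  fixes a :: "nat \<Rightarrow> complex" and C :: real
  assumes square_summable: "summable (\<lambda>n. (cmod (a n))\<^sup>2)"
    and bounded: "\<And>z. cmod z < 1 \<Longrightarrow> cmod (pser a z) \<le> C"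
begin

lemma bounded_coeffs: "bounded (range a)"
  by (rule bounded_range_square_summable[OF square_summable])

lemma circle_le: "cmod (pser a (of_real (radius j) * cis t)) \<le> C"
  by (rule bounded) (use radius(1,2)[of j] in \<open>simp add: norm_mult\<close>)

lemma C_nonneg: "0 \<le> C"
  using circle_le[of 0 0] norm_ge_zero order_trans by blast

lemma measurable_circle: "(\<lambda>t. pser a (of_real (radius j) * cis t)) \<in> borel_measurable circ"
  by (rule measurable_circ[OF measurable_pser_circle[OF radius(1,2) bounded_coeffs]])

lemmas measurable = measurable_bd[OF bounded_coeffs]

lemma AE_bd_le: "AE t in circ. cmod (bd a t) \<le> C"
  using AE_bd_limit[OF square_summable]
  by eventually_elim (rule Lim_bounded[OF tendsto_norm], auto intro: circle_le)

end

text \<open>Parseval's identity holds on circles of radius \<open>radius j\<close>. Letting the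
  radius tend to 1 is justified by dominated convergence, with the constant \<open>C * D\<close>,
  for the integrals and by Tannery's theorem for the series.\<close>

lemma boundary_moment:
  assumes "bounded_h2 a C" "bounded_h2 b D"
  shows "(LINT t|circ. cis (real k * t) * bd a t * cnj (bd b t)) = 2 * pi * (\<Sum>n. a n * cnj (b (n + k)))"
    and "integrable circ (\<lambda>t. cis (x * t) * bd a t * cnj (bd b t))"
proof -
  interpret a: bounded_h2 a C by fact
  interpret b: bounded_h2 b D by fact
  note [measurable] = a.measurable b.measurable a.measurable_circle b.measurable_circle
  show "integrable circ (\<lambda>t. cis (x * t) * bd a t * cnj (bd b t))"
  proof (rule circ.integrable_const_bound[of _ "C * D"])
    show "AE t in circ. norm (cis (x * t) * bd a t * cnj (bd b t)) \<le> C * D"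
      using a.AE_bd_le b.AE_bd_le by eventually_elim (use a.C_nonneg in \<open>auto simp: norm_mult intro!: mult_mono\<close>)
  qed measurable
  define f where "f j t = cis (real k * t) * pser a (of_real (radius j) * cis t) * cnj (pser b (of_real (radius j) * cis t))" for j t
  have "(\<lambda>j. LINT t|circ. f j t) \<longlonglongrightarrow> (LINT t|circ. cis (real k * t) * bd a t * cnj (bd b t))"
  proof (rule integral_dominated_convergence[where w = "\<lambda>_. C * D"])
    show "AE t in circ. (\<lambda>j. f j t) \<longlonglongrightarrow> cis (real k * t) * bd a t * cnj (bd b t)"
      using AE_bd_limit[OF a.square_summable] AE_bd_limit[OF b.square_summable]
      unfolding f_def by eventually_elim (intro tendsto_intros)
    show "AE t in circ. norm (f j t) \<le> C * D" for j
      unfolding f_def using a.circle_le[of j] b.circle_le[of j] a.C_nonneg by (auto simp: norm_mult intro!: mult_mono)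
    show "(\<lambda>t. cis (real k * t) * bd a t * cnj (bd b t)) \<in> borel_measurable circ" by measurable
    show "f j \<in> borel_measurable circ" for j unfolding f_def by measurable
  qed simp
  moreover have "(LINT t|circ. f j t) = 2 * pi * (\<Sum>n. a n * cnj (b (n + k)) * of_real (radius j) ^ (2 * n + k))" for j
  proof -
    have s: "(\<lambda>n. 2 * pi * (a n * cnj (b (n + k)) * of_real (radius j) ^ (2 * n + k))) sums (LINT t|circ. f j t)"
      unfolding f_def by (rule parseval_pser[OF radius(1,2) a.bounded_coeffs b.bounded_coeffs])
    have "summable (\<lambda>n. a n * cnj (b (n + k)) * of_real (radius j) ^ (2 * n + k))"
      using sums_summable[OF s] by (subst (asm) summable_cmult_iff) auto
    then show ?thesis using sums_unique[OF s] by (simp add: suminf_mult)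
  qed
  moreover have "(\<lambda>j. \<Sum>n. a n * cnj (b (n + k)) * of_real (radius j) ^ (2 * n + k)) \<longlonglongrightarrow> (\<Sum>n. a n * cnj (b (n + k)))"
  proof (rule tannerys_theorem[where M = "\<lambda>n. cmod (a n * cnj (b (n + k)))", THEN conjunct2, THEN conjunct2])
    show "(\<lambda>j. a n * cnj (b (n + k)) * of_real (radius j) ^ (2 * n + k)) \<longlonglongrightarrow> a n * cnj (b (n + k))" for n
    proof -
      have "(\<lambda>j. a n * cnj (b (n + k)) * of_real (radius j) ^ (2 * n + k)) \<longlonglongrightarrow> a n * cnj (b (n + k)) * of_real 1 ^ (2 * n + k)"
        by (intro tendsto_intros radius(3))
      then show ?thesis by simp
    qed
    show "\<forall>\<^sub>F (n, j) in at_top \<times>\<^sub>F sequentially. norm (a n * cnj (b (n + k)) * of_real (radius j) ^ (2 * n + k)) \<le> cmod (a n * cnj (b (n + k)))"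
      by (rule always_eventually) (auto simp: norm_mult norm_power radius(1) intro!: mult_left_le power_le_one less_imp_le[OF radius(2)])
    show "summable (\<lambda>n. cmod (a n * cnj (b (n + k))))"
      by (rule summable_mult_square_summable[OF a.square_summable summable_ignore_initial_segment[OF b.square_summable]])
  qed auto
  ultimately show "(LINT t|circ. cis (real k * t) * bd a t * cnj (bd b t)) = 2 * pi * (\<Sum>n. a n * cnj (b (n + k)))"
    by (simp only:) (rule LIMSEQ_unique[OF _ tendsto_mult_left])
qed

text \<open>A bounded function with vanishing Fourier coefficients is orthogonal to the products
  \<open>\<phi> (r e\<^sup>i\<^sup>t) \<cdot> cnj (\<psi> (r e\<^sup>i\<^sup>t))\<close>, which approximate it when it is itself such a product on the boundary.\<close>
lemma AE_zero_of_moments: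
  fixes a b :: "nat \<Rightarrow> nat \<Rightarrow> complex" and n :: nat and c :: complex
  assumes h: "\<And>i. i < n \<Longrightarrow> bounded_h2 (a i) C" "\<And>i. i < n \<Longrightarrow> bounded_h2 (b i) C"
    and mom: "\<And>k::int. (LINT t|circ. cis (of_int k * t) * ((\<Sum>i<n. bd (a i) t * cnj (bd (b i) t)) - c)) = 0"
  shows "AE t in circ. (\<Sum>i<n. bd (a i) t * cnj (bd (b i) t)) = c"
proof -
  define u where "u t = (\<Sum>i<n. bd (a i) t * cnj (bd (b i) t)) - c" for t
  have [measurable]: "bd (a i) \<in> borel_measurable circ" "bd (b i) \<in> borel_measurable circ" if "i < n" for i
    using that h bounded_h2.measurable by blast+
  have um [measurable]: "u \<in> borel_measurable circ" unfolding u_def[abs_def]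
    by (intro borel_measurable_diff borel_measurable_sum borel_measurable_times borel_measurable_const) (auto intro: measurable_compose[OF _ measurable_cnj])
  have ubA: "AE t in circ. cmod (u t) \<le> real n * (C * C) + cmod c"
  proof -
    have "AE t in circ. \<forall>i\<in>{..<n}. cmod (bd (a i) t) \<le> C \<and> cmod (bd (b i) t) \<le> C"
      by (subst AE_ball_countable) (auto intro: AE_conjI bounded_h2.AE_bd_le h)
    then show ?thesis
    proof eventually_elim
      case (elim t)
      have "cmod (u t) \<le> cmod (\<Sum>i<n. bd (a i) t * cnj (bd (b i) t)) + cmod c" unfolding u_def by (rule norm_triangle_ineq4)
      also have "cmod (\<Sum>i<n. bd (a i) t * cnj (bd (b i) t)) \<le> (\<Sum>i<n. C * C)"
        by (rule order_trans[OF norm_sum], rule sum_mono)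
          (use elim bounded_h2.C_nonneg[OF h(1)] in \<open>auto simp: norm_mult intro!: mult_mono\<close>)
      finally show ?case by simp
    qed
  qed
  define K where "K = real n * (C * C) + cmod c"
  \<comment> \<open>\<open>v\<close> modifies \<open>u\<close> on a null set so as to be bounded everywhere.\<close>
  define v where "v t = (if cmod (u t) \<le> K then u t else 0)" for t
  have uv: "AE t in circ. u t = v t" using ubA by eventually_elim (simp add: v_def K_def)
  have K: "0 \<le> K" using bounded_h2.C_nonneg[OF h(1)] by (cases "n = 0") (auto simp: K_def)
  have vm [measurable]: "v \<in> borel_measurable circ" unfolding v_def[abs_def] by measurable
  have vb: "cmod (v t) \<le> K" for t using K by (simp add: v_def)
  have momv: "(LINT t|circ. cis (of_int k * t) * v t) = 0" for k :: int
  proof -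
    have "(LINT t|circ. cis (of_int k * t) * v t) = (LINT t|circ. cis (of_int k * t) * u t)"
      by (rule integral_cong_AE) (use uv in \<open>auto elim: eventually_mono\<close>)
    then show ?thesis using mom[of k] by (simp add: u_def)
  qed
  have prod0: "(LINT t|circ. v t * (pser (b i) (of_real (radius j) * cis t) * cnj (pser (a i) (of_real (radius j) * cis t)))) = 0"
    if i: "i < n" for i j
  proof -
    \<comment> \<open>The roles of \<open>a\<close> and \<open>b\<close> are exchanged on purpose:
      the products have to approximate \<open>cnj u\<close>, not \<open>u\<close>.\<close>
    interpret a: bounded_h2 "b i" C by (rule h(2)[OF i])
    interpret b: bounded_h2 "a i" C by (rule h(1)[OF i])
    let ?a = "\<lambda>n. b i n * of_real (radius j) ^ n" and ?b = "\<lambda>n. a i n * of_real (radius j) ^ n"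
    have sa: "summable (\<lambda>n. cmod (?a n))" and sb: "summable (\<lambda>n. cmod (?b n))"
      using pser_fser(1)[OF radius(1,2)] a.bounded_coeffs b.bounded_coeffs by auto
    \<comment> \<open>All integer frequencies are needed: conjugation in the next step turns
      \<open>cis (real n * t)\<close> into one of negative frequency.\<close>
    have 1: "(LINT t|circ. (cis (of_int k * t) * v t) * fser ?a t) = 0" for k :: int
    proof -
      have "(\<lambda>n. ?a n * (LINT t|circ. (cis (of_int k * t) * v t) * cis (real n * t))) sums (LINT t|circ. (cis (of_int k * t) * v t) * fser ?a t)"
        by (rule integral_mult_fser[OF _ _ sa, where K = K]) (use vb in \<open>auto simp: norm_mult\<close>)
      moreover have "(LINT t|circ. (cis (of_int k * t) * v t) * cis (real n * t)) = 0" for n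
      proof -
        have "(cis (of_int k * t) * v t) * cis (real n * t) = cis (of_int (k + int n) * t) * v t" for t
          by (simp add: cis_mult[symmetric] distrib_right mult.assoc mult.left_commute)
        then show ?thesis using momv[of "k + int n"] by (simp only:)
      qed
      ultimately show ?thesis by (simp add: sums_unique[symmetric] sums_unique2[OF _ sums_zero])
    qed
    have "(\<lambda>n. ?b n * (LINT t|circ. cnj (v t * fser ?a t) * cis (real n * t))) sums (LINT t|circ. cnj (v t * fser ?a t) * fser ?b t)"
      by (rule integral_mult_fser[OF _ _ sb, where K = "K * (\<Sum>n. norm (?a n))"])
        (use vb K fser_sums(2)[OF sa] in \<open>auto simp: norm_mult intro!: mult_mono\<close>)
    moreover have "(LINT t|circ. cnj (v t * fser ?a t) * cis (real n * t)) = 0" for n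
    proof -
      have "cnj (v t * fser ?a t) * cis (real n * t) = cnj ((cis (of_int (- int n) * t) * v t) * fser ?a t)" for t
        by (simp add: cis_cnj mult_ac)
      then have "(LINT t|circ. cnj (v t * fser ?a t) * cis (real n * t)) = cnj (LINT t|circ. (cis (of_int (- int n) * t) * v t) * fser ?a t)"
        by (simp only: Bochner_Integration.integral_cnj)
      then show ?thesis unfolding 1 by simp
    qed
    ultimately have "(LINT t|circ. cnj (v t * fser ?a t) * fser ?b t) = 0"
      by (simp add: sums_unique[symmetric] sums_unique2[OF _ sums_zero])
    then have "cnj (LINT t|circ. cnj (v t * fser ?a t) * fser ?b t) = 0" by simp
    moreover have "cnj (LINT t|circ. cnj (v t * fser ?a t) * fser ?b t) = (LINT t|circ. v t * (fser ?a t * cnj (fser ?b t)))"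
      by (subst Bochner_Integration.integral_cnj[symmetric]) (simp add: mult.assoc)
    ultimately show ?thesis
      unfolding pser_fser(2)[OF radius(1,2) a.bounded_coeffs] pser_fser(2)[OF radius(1,2) b.bounded_coeffs] by simp
  qed
  define w where "w j t = (\<Sum>i<n. pser (b i) (of_real (radius j) * cis t) * cnj (pser (a i) (of_real (radius j) * cis t))) - cnj c" for j t
  have pm [measurable]: "(\<lambda>t. pser (b i) (of_real (radius j) * cis t)) \<in> borel_measurable circ"
     "(\<lambda>t. pser (a i) (of_real (radius j) * cis t)) \<in> borel_measurable circ" if "i < n" for i j
    using that h bounded_h2.measurable_circle by blast+
  have wi: "integrable circ (\<lambda>t. v t * (pser (b i) (of_real (radius j) * cis t) * cnj (pser (a i) (of_real (radius j) * cis t))))" if "i < n" for i j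
  proof (rule integrable_circ_bounded[where C = "K * (C * C)"])
    show "(\<lambda>t. v t * (pser (b i) (of_real (radius j) * cis t) * cnj (pser (a i) (of_real (radius j) * cis t)))) \<in> borel_measurable circ"
      using pm[OF that, of j] by measurable
    show "norm (v t * (pser (b i) (of_real (radius j) * cis t) * cnj (pser (a i) (of_real (radius j) * cis t)))) \<le> K * (C * C)" for t
      using vb[of t] K bounded_h2.circle_le[OF h(2)[OF that], of j t] bounded_h2.circle_le[OF h(1)[OF that], of j t] bounded_h2.C_nonneg[OF h(1)[OF that]]
      by (auto simp: norm_mult intro!: mult_mono)
  qed
  have w0: "(LINT t|circ. v t * w j t) = 0" for j
  proof -
    have "v t * w j t = (\<Sum>i<n. v t * (pser (b i) (of_real (radius j) * cis t) * cnj (pser (a i) (of_real (radius j) * cis t)))) - v t * cnj c" for t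
      unfolding w_def right_diff_distrib sum_distrib_left ..
    moreover have "(LINT t|circ. (\<Sum>i<n. v t * (pser (b i) (of_real (radius j) * cis t) * cnj (pser (a i) (of_real (radius j) * cis t)))) - v t * cnj c) = 0"
    proof (subst Bochner_Integration.integral_diff)
      show "integrable circ (\<lambda>t. \<Sum>i<n. v t * (pser (b i) (of_real (radius j) * cis t) * cnj (pser (a i) (of_real (radius j) * cis t))))"
        by (intro Bochner_Integration.integrable_sum wi) auto
      show "integrable circ (\<lambda>t. v t * cnj c)"
        by (intro integrable_mult_left integrable_circ_bounded[OF vm vb])
      show "(LINT t|circ. (\<Sum>i<n. v t * (pser (b i) (of_real (radius j) * cis t) * cnj (pser (a i) (of_real (radius j) * cis t))))) - (LINT t|circ. v t * cnj c) = 0"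
        using momv[of 0] by (subst Bochner_Integration.integral_sum) (auto simp: prod0 intro: wi)
    qed
    ultimately show ?thesis by simp
  qed
  \<comment> \<open>At the boundary \<open>w j\<close> becomes \<open>cnj u\<close>, and
    \<open>u\<close> agrees with \<open>v\<close> almost everywhere, so \<open>v\<close> turns out
    to be orthogonal to itself.\<close>
  have "(\<lambda>j. LINT t|circ. v t * w j t) \<longlonglongrightarrow> (LINT t|circ. v t * cnj (u t))"
  proof (rule integral_dominated_convergence[where w = "\<lambda>_. K * K"])
    have "AE t in circ. \<forall>i\<in>{..<n}. (\<lambda>j. pser (b i) (of_real (radius j) * cis t)) \<longlonglongrightarrow> bd (b i) t \<and> (\<lambda>j. pser (a i) (of_real (radius j) * cis t)) \<longlonglongrightarrow> bd (a i) t"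
      by (subst AE_ball_countable) (auto intro: AE_conjI AE_bd_limit bounded_h2.square_summable h)
    then show "AE t in circ. (\<lambda>j. v t * w j t) \<longlonglongrightarrow> v t * cnj (u t)"
    proof eventually_elim
      case (elim t)
      have "cnj (u t) = (\<Sum>i<n. bd (b i) t * cnj (bd (a i) t)) - cnj c"
        by (simp add: u_def cnj_sum mult.commute)
      with elim show ?case unfolding w_def by (simp only:) (intro tendsto_intros tendsto_cnj, auto)
    qed
    show "AE t in circ. norm (v t * w j t) \<le> K * K" for j
    proof (rule AE_I2)
      fix t
      have "cmod (w j t) \<le> cmod (\<Sum>i<n. pser (b i) (of_real (radius j) * cis t) * cnj (pser (a i) (of_real (radius j) * cis t))) + cmod (cnj c)"
        unfolding w_def by (rule norm_triangle_ineq4)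
      also have "cmod (\<Sum>i<n. pser (b i) (of_real (radius j) * cis t) * cnj (pser (a i) (of_real (radius j) * cis t))) \<le> (\<Sum>i<n. C * C)"
        by (rule order_trans[OF norm_sum], rule sum_mono)
          (use bounded_h2.circle_le[OF h(1)] bounded_h2.circle_le[OF h(2)] bounded_h2.C_nonneg[OF h(1)] in \<open>auto simp: norm_mult intro!: mult_mono\<close>)
      finally have "cmod (w j t) \<le> K" by (simp add: K_def)
      then show "norm (v t * w j t) \<le> K * K" using vb[of t] K by (auto simp: norm_mult intro!: mult_mono)
    qed
    have "w j \<in> borel_measurable circ" for j unfolding w_def[abs_def]
      by (intro borel_measurable_diff borel_measurable_sum borel_measurable_times borel_measurable_const) (auto intro: measurable_compose[OF _ measurable_cnj] pm)
    then show "(\<lambda>t. v t * w j t) \<in> borel_measurable circ" for j by measurable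
  qed auto
  then have "(LINT t|circ. v t * cnj (u t)) = 0" by (simp add: w0 LIMSEQ_const_iff)
  moreover have "(LINT t|circ. v t * cnj (u t)) = (LINT t|circ. of_real ((cmod (v t))\<^sup>2))"
  proof (rule integral_cong_AE)
    show "AE t in circ. v t * cnj (u t) = of_real ((cmod (v t))\<^sup>2)"
      using uv by eventually_elim (simp only: complex_norm_square)
  qed (auto intro: measurable_compose[OF um measurable_cnj])
  ultimately have "(LINT t|circ. (cmod (v t))\<^sup>2) = 0"
    by (simp only: integral_complex_of_real of_real_eq_0_iff)
  moreover have "integrable circ (\<lambda>t. (cmod (v t))\<^sup>2)"
    by (rule integrable_circ_bounded[where C = "K\<^sup>2"]) (auto intro!: power_mono vb)
  ultimately have "AE t in circ. (cmod (v t))\<^sup>2 = 0"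
    by (simp add: integral_nonneg_eq_0_iff_AE)
  with uv show ?thesis by eventually_elim (simp add: u_def)
qed

section \<open>Complex Hilbert spaces\<close>

instance complex_hilbert \<subseteq> banach ..

lemma cinner_add_right: "cinner x (y + z) = cinner x y + cinner x z"
  by (metis cinner_add_left cinner_commute complex_cnj_add)

lemma cinner_scaleC_right: "cinner x (a *\<^sub>C y) = cnj a * cinner x y"
  by (metis cinner_scaleC_left cinner_commute complex_cnj_mult)

lemma cinner_zero_left [simp]: "cinner 0 y = 0"
  using cinner_add_left[of 0 0 y] by simp

lemma cinner_zero_right [simp]: "cinner x 0 = 0"
  using cinner_add_right[of x 0 0] by simp

lemma cinner_minus_left: "cinner (- x) y = - cinner x y"
  using cinner_add_left[of x "- x" y] by (simp add: eq_neg_iff_add_eq_0 add.commute)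

lemma cinner_minus_right: "cinner x (- y) = - cinner x y"
  using cinner_add_right[of x y "- y"] by (simp add: eq_neg_iff_add_eq_0 add.commute)

lemma cinner_diff_left: "cinner (x - y) z = cinner x z - cinner y z"
  using cinner_add_left[of x "- y" z] by (simp add: cinner_minus_left)

lemma cinner_diff_right: "cinner x (y - z) = cinner x y - cinner x z"
  using cinner_add_right[of x y "- z"] by (simp add: cinner_minus_right)

lemma cinner_sum_left: "cinner (\<Sum>i\<in>A. f i) y = (\<Sum>i\<in>A. cinner (f i) y)"
  by (induction A rule: infinite_finite_induct) (auto simp: cinner_add_left)

lemma cinner_sum_right: "cinner x (\<Sum>i\<in>A. f i) = (\<Sum>i\<in>A. cinner x (f i))"
  by (induction A rule: infinite_finite_induct) (auto simp: cinner_add_right)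

lemma scaleR_scaleC': "r *\<^sub>R x = complex_of_real r *\<^sub>C (x :: 'a::complex_hilbert)"
  by (simp add: scaleC_of_real)

lemma cinner_self: "cinner x x = of_real ((norm x)\<^sup>2)"
proof -
  have "Im (cinner x x) = 0" using cinner_commute[of x x] by (metis cnj.simps(2) equation_minus_iff minus_equation_iff neg_equal_zero)
  moreover have "Re (cinner x x) = (norm x)\<^sup>2" by (simp add: Re_cinner dot_square_norm)
  ultimately show ?thesis by (simp add: complex_eq_iff)
qed

lemma norm_scaleC: "norm (a *\<^sub>C x) = cmod a * norm (x :: 'a::complex_hilbert)"
proof -
  have "cinner (a *\<^sub>C x) (a *\<^sub>C x) = (a * cnj a) * cinner x x"
    by (simp add: cinner_scaleC_left cinner_scaleC_right)
  also have "\<dots> = of_real ((cmod a * norm x)\<^sup>2)"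
    by (simp only: cinner_self power_mult_distrib of_real_mult complex_norm_square)
  finally have "complex_of_real ((norm (a *\<^sub>C x))\<^sup>2) = of_real ((cmod a * norm x)\<^sup>2)"
    by (simp only: cinner_self)
  then show ?thesis by (simp only: of_real_eq_iff) (simp add: power2_eq_iff_nonneg)
qed

lemma norm_cinner_le: "cmod (cinner x y) \<le> norm x * norm y"
proof (cases "cinner x y = 0")
  case False
  define a where "a = cnj (cinner x y) / cmod (cinner x y)"
  have a: "cmod a = 1" using False by (simp add: a_def norm_divide)
  have "cinner (a *\<^sub>C x) y = of_real (cmod (cinner x y))"
    using False complex_norm_square[of "cinner x y"]
    by (simp add: cinner_scaleC_left a_def power2_eq_square field_simps)
  then have "cmod (cinner x y) = Re (cinner (a *\<^sub>C x) y)" by simp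
  also have "\<dots> \<le> norm (a *\<^sub>C x) * norm y" unfolding Re_cinner by (rule norm_cauchy_schwarz)
  finally show ?thesis by (simp add: norm_scaleC a)
qed simp

lemma bounded_linear_cinner_left: "bounded_linear (\<lambda>x. cinner x y)"
  by (rule bounded_linear_intro[of _ "norm y"])
    (auto simp: cinner_add_left scaleR_scaleC' cinner_scaleC_left scaleR_conv_of_real norm_cinner_le)

lemmas tendsto_cinner_left = bounded_linear.tendsto[OF bounded_linear_cinner_left]

lemma cinner_eq_zero_commute: "cinner x y = 0 \<longleftrightarrow> cinner y x = 0"
  using cinner_commute[of x y] by auto

lemma cinner_ext: "(\<And>y. cinner x y = cinner x' y) \<Longrightarrow> x = x'"
proof -
  assume "\<And>y. cinner x y = cinner x' y"
  then have "cinner (x - x') (x - x') = 0" by (simp add: cinner_diff_left)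
  then show ?thesis by (simp add: cinner_self)
qed

lemma norm_add_orthogonal:
  assumes "cinner x y = 0"
  shows "(norm (x + y))\<^sup>2 = (norm x)\<^sup>2 + (norm y)\<^sup>2"
proof -
  have "cinner y x = 0" using assms cinner_eq_zero_commute by blast
  then have "cinner (x + y) (x + y) = cinner x x + cinner y y"
    using assms by (simp add: cinner_add_left cinner_add_right)
  then show ?thesis unfolding cinner_self by (simp only: of_real_eq_iff flip: of_real_add)
qed

lemma norm_sum_orthonormal:
  fixes b :: "nat \<Rightarrow> 'a::complex_hilbert" and n :: nat
  assumes "\<And>i j. i < n \<Longrightarrow> j < n \<Longrightarrow> cinner (b i) (b j) = (if i = j then 1 else 0)"
  shows "(norm (\<Sum>i<n. a i *\<^sub>C b i))\<^sup>2 = (\<Sum>i<n. (cmod (a i))\<^sup>2)"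
proof -
  have "cinner (b i) (\<Sum>j<n. a j *\<^sub>C b j) = cnj (a i)" if "i < n" for i
  proof -
    have "cinner (b i) (\<Sum>j<n. a j *\<^sub>C b j) = (\<Sum>j<n. if j = i then cnj (a j) else 0)"
      unfolding cinner_sum_right cinner_scaleC_right by (intro sum.cong refl) (use assms that in auto)
    also have "\<dots> = cnj (a i)" using that by simp
    finally show ?thesis .
  qed
  then have "cinner (\<Sum>i<n. a i *\<^sub>C b i) (\<Sum>i<n. a i *\<^sub>C b i) = (\<Sum>i<n. a i * cnj (a i))"
    by (subst cinner_sum_left) (simp add: cinner_scaleC_left)
  also have "\<dots> = of_real (\<Sum>i<n. (cmod (a i))\<^sup>2)" unfolding of_real_sum complex_norm_square ..
  finally show ?thesis unfolding cinner_self by (simp only: of_real_eq_iff)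
qed

lemma csubspace_scaleR: "csubspace N \<Longrightarrow> x \<in> N \<Longrightarrow> r *\<^sub>R x \<in> N"
  unfolding scaleR_scaleC' by (rule complex_vector.subspace_scale)

text \<open>A minimising sequence for the distance is Cauchy by the parallelogram law, and
  minimality makes the residual orthogonal.\<close>

lemma projection_exists:
  fixes N :: "'a::complex_hilbert set"
  assumes N: "csubspace N" "closed N"
  obtains y where "y \<in> N" "\<And>u. u \<in> N \<Longrightarrow> cinner (x - y) u = 0"
proof -
  define d where "d = (INF y\<in>N. norm (x - y))"
  have ne: "N \<noteq> {}" using complex_vector.subspace_0[OF N(1)] by auto
  have bdd: "bdd_below ((\<lambda>y. norm (x - y)) ` N)" by (rule bdd_belowI[of _ 0]) auto
  have d_le: "d \<le> norm (x - y)" if "y \<in> N" for y unfolding d_def by (rule cINF_lower[OF bdd that])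
  have d0: "0 \<le> d" unfolding d_def using ne by (intro cINF_greatest) auto
  have "\<exists>y\<in>N. norm (x - y) < d + 1 / real (Suc n)" for n
    using cINF_less_iff[OF ne bdd, of "d + 1 / real (Suc n)"] unfolding d_def[symmetric] by simp
  then obtain y where y: "\<And>n. y n \<in> N" "\<And>n. norm (x - y n) < d + 1 / real (Suc n)" by metis
  have lim: "(\<lambda>n. norm (x - y n)) \<longlonglongrightarrow> d"
  proof (rule tendsto_sandwich[of "\<lambda>_. d" _ _ "\<lambda>n. d + 1 / real (Suc n)"])
    show "(\<lambda>n. d + 1 / real (Suc n)) \<longlonglongrightarrow> d"
      using tendsto_add[OF tendsto_const LIMSEQ_inverse_real_of_nat, of d] by (simp add: inverse_eq_divide)
  qed (use y d_le in \<open>auto intro!: always_eventually less_imp_le\<close>)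
  have par: "(norm (u + v))\<^sup>2 + (norm (u - v))\<^sup>2 = 2 * (norm u)\<^sup>2 + 2 * (norm v)\<^sup>2" for u v :: 'a
    by (simp add: power2_norm_eq_inner inner_add_left inner_add_right inner_diff_left inner_diff_right)
  have diff_sq: "(norm (u - v))\<^sup>2 = (norm u)\<^sup>2 - 2 * inner u v + (norm v)\<^sup>2" for u v :: 'a
    by (simp add: power2_norm_eq_inner inner_diff_left inner_diff_right inner_commute)
  have dist: "(norm (y i - y j))\<^sup>2 \<le> 2 * (norm (x - y i))\<^sup>2 + 2 * (norm (x - y j))\<^sup>2 - 4 * d\<^sup>2" for i j
  proof -
    have "(1/2) *\<^sub>R (y i + y j) \<in> N" by (intro csubspace_scaleR complex_vector.subspace_add N y)
    then have "d \<le> norm (x - (1/2) *\<^sub>R (y i + y j))" by (rule d_le)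
    also have "x - (1/2) *\<^sub>R (y i + y j) = (1/2) *\<^sub>R ((x - y i) + (x - y j))"
      by (simp add: algebra_simps flip: scaleR_left.add)
    finally have "2 * d \<le> norm ((x - y i) + (x - y j))" by simp
    then have "(2 * d)\<^sup>2 \<le> (norm ((x - y i) + (x - y j)))\<^sup>2" using d0 by (intro power_mono) auto
    then show ?thesis using par[of "x - y i" "x - y j"] by (simp add: norm_minus_commute power_mult_distrib)
  qed
  have "Cauchy y"
  proof (rule metric_CauchyI)
    fix e :: real assume e: "0 < e"
    have "(\<lambda>n. 2 * (norm (x - y n))\<^sup>2 - 2 * d\<^sup>2) \<longlonglongrightarrow> 2 * d\<^sup>2 - 2 * d\<^sup>2" by (intro tendsto_intros lim)
    then have "\<forall>\<^sub>F n in sequentially. 2 * (norm (x - y n))\<^sup>2 - 2 * d\<^sup>2 < e\<^sup>2 / 2"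
      using e by (intro order_tendstoD(2)) auto
    then obtain M where M: "\<And>n. n \<ge> M \<Longrightarrow> 2 * (norm (x - y n))\<^sup>2 - 2 * d\<^sup>2 < e\<^sup>2 / 2"
      unfolding eventually_sequentially by blast
    have "dist (y i) (y j) < e" if "i \<ge> M" "j \<ge> M" for i j
    proof -
      have "(norm (y i - y j))\<^sup>2 < e\<^sup>2" using dist[of i j] M[OF that(1)] M[OF that(2)] by linarith
      then show ?thesis unfolding dist_norm using e by (simp add: power2_less_imp_less)
    qed
    then show "\<exists>M. \<forall>m\<ge>M. \<forall>n\<ge>M. dist (y m) (y n) < e" by blast
  qed
  then obtain z where z: "y \<longlonglongrightarrow> z" using Cauchy_convergent convergent_def by blast
  have zN: "z \<in> N" by (rule closed_sequentially[OF N(2) y(1) z])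
  have "(\<lambda>n. norm (x - y n)) \<longlonglongrightarrow> norm (x - z)" by (intro tendsto_intros z)
  then have zd: "norm (x - z) = d" using lim LIMSEQ_unique by blast
  have Re0: "inner (x - z) u = 0" if u: "u \<in> N" for u
  proof (cases "u = 0")
    case False
    \<comment> \<open>The minimiser of the quadratic
      \<open>t \<mapsto> norm ((x - z) - t *\<^sub>R u)^2\<close>; a strict decrease would
      contradict the choice of \<open>z\<close>.\<close>
    define t where "t = inner (x - z) u / (norm u)\<^sup>2"
    have "z + t *\<^sub>R u \<in> N" by (intro complex_vector.subspace_add csubspace_scaleR N zN u)
    then have "d\<^sup>2 \<le> (norm (x - (z + t *\<^sub>R u)))\<^sup>2" using d_le d0 by (intro power_mono) auto
    also have "\<dots> = d\<^sup>2 - (inner (x - z) u)\<^sup>2 / (norm u)\<^sup>2"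
    proof -
      have e: "x - (z + t *\<^sub>R u) = (x - z) - t *\<^sub>R u" by simp
      have "(norm (x - (z + t *\<^sub>R u)))\<^sup>2 = (norm (x - z))\<^sup>2 - 2 * t * inner (x - z) u + t\<^sup>2 * (norm u)\<^sup>2"
        unfolding e diff_sq[of "x - z" "t *\<^sub>R u"] by (simp add: power_mult_distrib)
      also have "2 * t * inner (x - z) u = 2 * (inner (x - z) u)\<^sup>2 / (norm u)\<^sup>2" by (simp add: t_def power2_eq_square)
      also have "t\<^sup>2 * (norm u)\<^sup>2 = (inner (x - z) u)\<^sup>2 / (norm u)\<^sup>2" using False by (simp add: t_def power2_eq_square)
      finally show ?thesis unfolding zd by simp
    qed
    finally have "(inner (x - z) u)\<^sup>2 / (norm u)\<^sup>2 \<le> 0" by simp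
    then show ?thesis using False by (simp add: divide_le_0_iff)
  qed simp
  \<comment> \<open>Real multiples of \<open>u\<close> give the real part only;
    \<open>\<i> *\<^sub>C u\<close> supplies the imaginary part.\<close>
  have "cinner (x - z) u = 0" if u: "u \<in> N" for u
  proof -
    have "Re (cinner (x - z) (\<i> *\<^sub>C u)) = 0"
      unfolding Re_cinner by (rule Re0, rule complex_vector.subspace_scale[OF N(1) u])
    then show ?thesis using Re0[OF u] by (simp add: cinner_scaleC_right complex_eq_iff Re_cinner)
  qed
  then show thesis using zN that by blast
qed

lemma onb_projection:
  fixes b :: "nat \<Rightarrow> 'a::complex_hilbert"
  assumes b: "onb_of n b S"
  shows "(\<Sum>i<n. a i *\<^sub>C b i) \<in> S"
    and "u \<in> S \<Longrightarrow> cinner (x - (\<Sum>i<n. cinner x (b i) *\<^sub>C b i)) u = 0"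
    and "x \<in> S \<Longrightarrow> (\<Sum>i<n. cinner x (b i) *\<^sub>C b i) = x"
proof -
  have ortho: "\<And>i j. i < n \<Longrightarrow> j < n \<Longrightarrow> cinner (b i) (b j) = (if i = j then 1 else 0)" and S: "S = cspan (b ` {..<n})"
    using b unfolding onb_of_def by auto
  have sub: "csubspace S" unfolding S by (rule complex_vector.subspace_span)
  have bS: "b i \<in> S" if "i < n" for i unfolding S using that by (intro complex_vector.span_base) auto
  show mem: "(\<Sum>i<n. a i *\<^sub>C b i) \<in> S" for a
    by (intro complex_vector.subspace_sum complex_vector.subspace_scale sub bS) auto
  show orth: "cinner (x - (\<Sum>i<n. cinner x (b i) *\<^sub>C b i)) u = 0" if "u \<in> S" for u x
    using that unfolding S
  proof (induction rule: complex_vector.span_induct_alt)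
    case (step c v y)
    then obtain j where j: "j < n" "v = b j" by auto
    have "cinner (\<Sum>i<n. cinner x (b i) *\<^sub>C b i) (b j) = (\<Sum>i<n. if i = j then cinner x (b i) else 0)"
      unfolding cinner_sum_left cinner_scaleC_left by (intro sum.cong refl) (use ortho j in auto)
    also have "\<dots> = cinner x (b j)" using j by simp
    finally show ?case using step j by (simp add: cinner_add_right cinner_scaleC_right cinner_diff_left)
  qed simp
  show "(\<Sum>i<n. cinner x (b i) *\<^sub>C b i) = x" if "x \<in> S"
  proof -
    have "x - (\<Sum>i<n. cinner x (b i) *\<^sub>C b i) \<in> S" by (intro complex_vector.subspace_diff sub that mem)
    from orth[OF this, of x] show ?thesis by (simp add: cinner_self)
  qed
qed

lemma cesaro_tendsto_zero:
  fixes a :: "nat \<Rightarrow> real"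
  assumes "a \<longlonglongrightarrow> 0" "\<And>n. 0 \<le> a n"
  shows "(\<lambda>N. (\<Sum>n\<le>N. a n) / real (Suc N)) \<longlonglongrightarrow> 0"
proof (rule LIMSEQ_I)
  fix e :: real assume e: "0 < e"
  obtain M where M: "\<And>n. n \<ge> M \<Longrightarrow> a n < e / 2"
    using order_tendstoD(2)[OF assms(1), of "e/2"] e unfolding eventually_sequentially by auto
  define s where "s = (\<Sum>n<M. a n)"
  obtain N0 :: nat where N0: "2 * s / e < real N0" using reals_Archimedean2 by blast
  show "\<exists>no. \<forall>N\<ge>no. norm ((\<Sum>n\<le>N. a n) / real (Suc N) - 0) < e"
  proof (intro exI allI impI)
    fix N assume N: "max M N0 \<le> N"
    have "(\<Sum>n\<le>N. a n) = s + (\<Sum>n=M..N. a n)"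
    proof -
      have "{..N} = {..<M} \<union> {M..N}" using N by auto
      show ?thesis unfolding s_def \<open>{..N} = {..<M} \<union> {M..N}\<close> by (rule sum.union_disjoint) auto
    qed
    also have "(\<Sum>n=M..N. a n) \<le> (\<Sum>n=M..N. e / 2)" by (intro sum_mono less_imp_le[OF M]) auto
    also have "\<dots> \<le> real (Suc N) * (e / 2)" using e by (simp add: mult_right_mono)
    also have "s < real (Suc N) * (e / 2)"
    proof -
      have "s < real N0 * (e / 2)" using N0 e by (simp add: field_simps)
      also have "\<dots> \<le> real (Suc N) * (e / 2)" using N e by (intro mult_right_mono) auto
      finally show ?thesis .
    qed
    finally have "(\<Sum>n\<le>N. a n) < real (Suc N) * e" by (simp add: field_simps)
    then have "(\<Sum>n\<le>N. a n) / real (Suc N) < e" by (simp add: field_simps)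
    moreover have "0 \<le> (\<Sum>n\<le>N. a n) / real (Suc N)" by (intro divide_nonneg_pos sum_nonneg assms) auto
    ultimately show "norm ((\<Sum>n\<le>N. a n) / real (Suc N) - 0) < e" by simp
  qed
qed

section \<open>Pure shifts: the adjoint and the coefficients of the Wold decomposition\<close>

locale pure_shift =
  fixes T :: "'a::complex_hilbert \<Rightarrow> 'a" and m :: nat and e :: "nat \<Rightarrow> 'a"
  assumes shift: "shift_operator T"
    and e: "onb_of m e (ortho_diff UNIV (range T))"
begin

lemma T_linear: "Vector_Spaces.linear scaleC scaleC T" and T_norm: "norm (T x) = norm x"
  using shift unfolding shift_operator_def by auto

interpretation T: Vector_Spaces.linear scaleC scaleC T by (rule T_linear)

lemmas T_simps = T.add T.diff T.scale T.zero T.sum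

lemma T_cinner: "cinner (T x) (T y) = cinner x y"
proof -
  have Re: "inner (T x) (T y) = inner x y" for x y
  proof -
    have "(norm (T x + T y))\<^sup>2 = (norm (x + y))\<^sup>2" unfolding T.add[symmetric] T_norm ..
    then show ?thesis
      by (simp add: power2_norm_eq_inner inner_add_left inner_add_right inner_commute T_norm flip: dot_square_norm)
        (simp add: dot_square_norm T_norm)
  qed
  have "Im (cinner (T x) (T y)) = Im (cinner x y)"
    using Re[of x "\<i> *\<^sub>C y"] unfolding T.scale Re_cinner[symmetric] cinner_scaleC_right by simp
  with Re[of x y] show ?thesis by (simp add: complex_eq_iff Re_cinner)
qed

lemma T_subspace: "csubspace N \<Longrightarrow> csubspace (T ` N)"
proof -
  assume N: "csubspace N"
  have "0 \<in> T ` N" using complex_vector.subspace_0[OF N] T.zero by (metis imageI)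
  moreover have "T x + T y \<in> T ` N" if "x \<in> N" "y \<in> N" for x y
    using complex_vector.subspace_add[OF N that] unfolding T.add[symmetric] by (rule imageI)
  moreover have "c *\<^sub>C T x \<in> T ` N" if "x \<in> N" for c x
    using complex_vector.subspace_scale[OF N that] unfolding T.scale[symmetric] by (rule imageI)
  ultimately show ?thesis unfolding complex_vector.subspace_def by blast
qed

lemma T_closed: "closed N \<Longrightarrow> closed (T ` N)"
proof -
  assume N: "closed N"
  show ?thesis
  proof (rule closed_sequential_limits[THEN iffD2], intro allI impI, elim conjE)
    fix x l assume x: "\<forall>n. x n \<in> T ` N" and l: "x \<longlonglongrightarrow> l"
    from x have "\<forall>n. \<exists>z. x n = T z \<and> z \<in> N" by blast
    then obtain y where y: "\<And>n. x n = T (y n)" "\<And>n. y n \<in> N" by (auto dest: choice)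
    have "Cauchy x" using l by (rule LIMSEQ_imp_Cauchy)
    then have "Cauchy y" unfolding Cauchy_def dist_norm y T.diff[symmetric] T_norm .
    then obtain z where z: "y \<longlonglongrightarrow> z" using Cauchy_convergent convergent_def by blast
    then have "(\<lambda>n. norm (T (y n - z))) \<longlonglongrightarrow> 0" unfolding T_norm by (simp add: LIM_zero tendsto_norm_zero_iff)
    then have "x \<longlonglongrightarrow> T z" unfolding y T.diff by (simp add: tendsto_norm_zero_iff LIM_zero_iff)
    then have "l = T z" using l LIMSEQ_unique by blast
    moreover have "z \<in> N" by (rule closed_sequentially[OF N y(2) z])
    ultimately show "l \<in> T ` N" by blast
  qed
qed

lemma e_ortho: "i < m \<Longrightarrow> j < m \<Longrightarrow> cinner (e i) (e j) = (if i = j then 1 else 0)"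
  using e unfolding onb_of_def by auto

lemma e_T: "j < m \<Longrightarrow> cinner (e j) (T x) = 0"
proof -
  assume j: "j < m"
  have "e j \<in> cspan (e ` {..<m})" using j by (intro complex_vector.span_base) auto
  then have "e j \<in> ortho_diff UNIV (range T)" using e unfolding onb_of_def by simp
  then show ?thesis unfolding ortho_diff_def by auto
qed

definition PK :: "'a \<Rightarrow> 'a" where "PK x = (\<Sum>j<m. cinner x (e j) *\<^sub>C e j)"

text \<open>\<open>range T\<close> is closed because \<open>T\<close> is isometric, so
  \<open>x\<close> has a projection onto it. The residual lies in the span of the \<open>e j\<close>
  and has the same inner products with them as \<open>x\<close>, hence it is
  \<open>PK x\<close>.\<close>

lemma diff_PK_range: "x - PK x \<in> range T"
proof -
  have "closed (range T)" by (rule T_closed) simp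
  then obtain y where y: "y \<in> range T" "\<And>u. u \<in> range T \<Longrightarrow> cinner (x - y) u = 0"
    using projection_exists[OF T_subspace[OF complex_vector.subspace_UNIV], of x] by blast
  then have K: "x - y \<in> ortho_diff UNIV (range T)" unfolding ortho_diff_def by simp
  have "cinner (x - y) (e j) = cinner x (e j)" if "j < m" for j
  proof -
    have "cinner y (e j) = 0" using e_T[OF that] y(1) cinner_eq_zero_commute by blast
    then show ?thesis by (simp add: cinner_diff_left)
  qed
  then have "PK x = (\<Sum>j<m. cinner (x - y) (e j) *\<^sub>C e j)" unfolding PK_def by simp
  also have "\<dots> = x - y" by (rule onb_projection(3)[OF e K])
  finally show ?thesis using y(1) by simp
qed

text \<open>The adjoint of \<open>T\<close>, built explicitly because \<open>cadjoint\<close> is a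
  choice whose defining property first has to be realised by some map.\<close>

definition B :: "'a \<Rightarrow> 'a" where "B x = (SOME y. T y = x - PK x)"

lemma T_B: "T (B x) = x - PK x"
proof -
  obtain y where "T y = x - PK x" using diff_PK_range[of x] by auto
  then show ?thesis unfolding B_def by (rule someI)
qed

lemma B_adjoint: "cinner (T x) y = cinner x (B y)"
proof -
  have "cinner (T x) (PK y) = 0"
    unfolding PK_def cinner_sum_right cinner_scaleC_right
    by (intro sum.neutral) (use e_T cinner_eq_zero_commute in auto)
  then have "cinner (T x) y = cinner (T x) (T (B y))" unfolding T_B cinner_diff_right by simp
  then show ?thesis by (simp add: T_cinner)
qed

lemma B_adjoint': "cinner (B x) y = cinner x (T y)"
  using B_adjoint[of y x] by (metis cinner_commute)

lemma cadjoint_eq: "cadjoint T = B"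
proof
  fix y
  have "\<forall>x y. cinner (T x) y = cinner x (cadjoint T y)"
    unfolding cadjoint_def by (rule someI[of _ B]) (simp add: B_adjoint)
  then have "cinner x (cadjoint T y) = cinner x (B y)" for x by (simp add: B_adjoint)
  then show "cadjoint T y = B y" by (metis cinner_commute cinner_ext)
qed

lemma B_pow_tendsto: "(\<lambda>n. norm ((B ^^ n) x)) \<longlonglongrightarrow> 0"
  using shift unfolding shift_operator_def cadjoint_eq by blast

lemma B_add: "B (x + y) = B x + B y" and B_diff: "B (x - y) = B x - B y" and B_scale: "B (c *\<^sub>C x) = c *\<^sub>C B x"
  by (rule cinner_ext, simp add: B_adjoint' cinner_add_left cinner_diff_left cinner_scaleC_left)+

lemma B_linear: "Vector_Spaces.linear scaleC scaleC B"
  by unfold_locales (auto simp: B_add B_scale)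

interpretation B: Vector_Spaces.linear scaleC scaleC B by (rule B_linear)

lemma B_T: "B (T x) = x"
  by (rule cinner_ext) (simp add: B_adjoint' T_cinner)

lemma B_e: "j < m \<Longrightarrow> B (e j) = 0"
  by (rule cinner_ext) (simp add: B_adjoint' e_T)

lemma norm_sq_PK_B: "(norm x)\<^sup>2 = (\<Sum>j<m. (cmod (cinner x (e j)))\<^sup>2) + (norm (B x))\<^sup>2"
proof -
  have "cinner (PK x) (T (B x)) = 0"
    unfolding PK_def cinner_sum_left cinner_scaleC_left by (intro sum.neutral) (use e_T in auto)
  from norm_add_orthogonal[OF this] have "(norm x)\<^sup>2 = (norm (PK x))\<^sup>2 + (norm (T (B x)))\<^sup>2"
    unfolding T_B by simp
  then show ?thesis unfolding PK_def T_norm using norm_sum_orthonormal[of m e, OF e_ortho] by simp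
qed

lemma B_norm_le: "norm (B x) \<le> norm x"
proof (rule power2_le_imp_le)
  show "(norm (B x))\<^sup>2 \<le> (norm x)\<^sup>2" unfolding norm_sq_PK_B[of x] by (simp add: sum_nonneg)
qed simp

lemma T_pow_norm: "norm ((T ^^ n) x) = norm x"
  by (induction n) (auto simp: T_norm)

lemma B_pow_norm_le: "norm ((B ^^ n) x) \<le> norm x"
  by (induction n) (auto intro: order_trans[OF B_norm_le])

lemma T_pow_simps: "(T ^^ n) (x + y) = (T ^^ n) x + (T ^^ n) y" "(T ^^ n) (x - y) = (T ^^ n) x - (T ^^ n) y"
   "(T ^^ n) (c *\<^sub>C x) = c *\<^sub>C (T ^^ n) x" "(T ^^ n) 0 = 0"
  by (induction n) (auto simp: T_simps)

lemma B_pow_simps: "(B ^^ n) (x + y) = (B ^^ n) x + (B ^^ n) y" "(B ^^ n) (x - y) = (B ^^ n) x - (B ^^ n) y"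
   "(B ^^ n) (c *\<^sub>C x) = c *\<^sub>C (B ^^ n) x" "(B ^^ n) 0 = 0"
  by (induction n) (auto simp: B_add B_diff B_scale B.zero)

lemma T_pow_sum: "(T ^^ n) (\<Sum>i\<in>A. f i) = (\<Sum>i\<in>A. (T ^^ n) (f i))"
  by (induction A rule: infinite_finite_induct) (auto simp: T_pow_simps)

lemma B_pow_sum: "(B ^^ n) (\<Sum>i\<in>A. f i) = (\<Sum>i\<in>A. (B ^^ n) (f i))"
  by (induction A rule: infinite_finite_induct) (auto simp: B_pow_simps)

lemma T_pow_adjoint: "cinner ((T ^^ n) x) y = cinner x ((B ^^ n) y)"
  by (induction n arbitrary: y) (simp_all add: B_adjoint funpow_swap1[of B])

lemma B_pow_adjoint: "cinner ((B ^^ n) x) y = cinner x ((T ^^ n) y)"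
  using T_pow_adjoint[of n y x] by (metis cinner_commute)

lemma B_T_pow: "(B ^^ n) ((T ^^ n) x) = x"
  by (induction n) (simp_all add: funpow_swap1[of B] B_T)

text \<open>The Taylor coefficient of index \<open>k\<close> of component \<open>j\<close> of
  \<open>U x\<close>. In this form \<open>B\<close> visibly acts as the backward shift on
  coefficients.\<close>

definition cf :: "'a \<Rightarrow> nat \<Rightarrow> nat \<Rightarrow> complex" where
  "cf x k j = cinner ((B ^^ k) x) (e j)"

end

section \<open>Expansion along a pure shift, and stability of finite rank perturbations\<close>

context pure_shift
begin

lemma B_sum: "B (\<Sum>i\<in>A. f i) = (\<Sum>i\<in>A. B (f i))"
  using B_pow_sum[of 1 f A] by simp

lemma cf_alt: "cf x k j = cinner x ((T ^^ k) (e j))"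
  unfolding cf_def by (rule B_pow_adjoint)

lemma cf_add: "cf (x + y) k j = cf x k j + cf y k j"
  and cf_diff: "cf (x - y) k j = cf x k j - cf y k j"
  and cf_scale: "cf (c *\<^sub>C x) k j = c * cf x k j"
  and cf_sum: "cf (\<Sum>i\<in>A. f i) k j = (\<Sum>i\<in>A. cf (f i) k j)"
  and cf_zero: "cf 0 k j = 0"
  by (simp_all add: cf_alt cinner_add_left cinner_diff_left cinner_scaleC_left cinner_sum_left)

lemma cf_B: "cf (B x) k j = cf x (Suc k) j"
  unfolding cf_def by (simp add: funpow_swap1[of B])

lemma cf_B_pow: "cf ((B ^^ n) x) k j = cf x (n + k) j"
  unfolding cf_def by (simp add: funpow_add[of k n] add.commute)

lemma cf_T_pow: "j < m \<Longrightarrow> cf ((T ^^ n) x) k j = (if k < n then 0 else cf x (k - n) j)"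
proof (cases "k < n")
  case True
  assume j: "j < m"
  from True obtain i where i: "n = k + Suc i" using less_imp_Suc_add by auto
  have "(B ^^ k) ((T ^^ n) x) = T ((T ^^ i) x)"
    unfolding i funpow_add o_apply B_T_pow by simp
  moreover have "cinner (T y) (e j) = 0" for y using e_T[OF j] cinner_eq_zero_commute by blast
  ultimately show ?thesis using True unfolding cf_def by simp
next
  case False
  then obtain i where i: "k = i + n" by (metis add.commute le_Suc_ex linorder_not_less)
  have "(B ^^ k) ((T ^^ n) x) = (B ^^ i) x" unfolding i funpow_add o_apply B_T_pow ..
  then show ?thesis using False i unfolding cf_def by simp
qed

lemma cf_T: "j < m \<Longrightarrow> cf (T x) k j = (if k = 0 then 0 else cf x (k - 1) j)"
  using cf_T_pow[of j 1 x k] by simp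

lemma cf_basis: "i < m \<Longrightarrow> j < m \<Longrightarrow> cf ((T ^^ n) (e i)) k j = (if k = n \<and> i = j then 1 else 0)"
proof -
  assume ij: "i < m" "j < m"
  have "(B ^^ q) (e i) = 0" if "0 < q" for q
    using that B_e[OF ij(1)] B_pow_simps(4) by (cases q) (auto simp: funpow_swap1[of B])
  then have "cf (e i) q j = (if q = 0 \<and> i = j then 1 else 0)" for q
    unfolding cf_def using e_ortho[OF ij] by (cases "q = 0") auto
  then show ?thesis using cf_T_pow[OF ij(2), of n "e i" k] by auto
qed

text \<open>The Wold decomposition cut off after \<open>n\<close> steps, with exact remainder. The
  remainder has the norm of \<open>(B ^^ n) x\<close> and so tends to 0.\<close>

lemma expansion: "x = (\<Sum>k<n. \<Sum>j<m. cf x k j *\<^sub>C (T ^^ k) (e j)) + (T ^^ n) ((B ^^ n) x)"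
proof (induction n)
  case (Suc n)
  have "(B ^^ n) x = PK ((B ^^ n) x) + T (B ((B ^^ n) x))" unfolding T_B by simp
  then have "(T ^^ n) ((B ^^ n) x) = (T ^^ n) (PK ((B ^^ n) x)) + (T ^^ n) (T (B ((B ^^ n) x)))"
    by (metis T_pow_simps(1))
  also have "(T ^^ n) (PK ((B ^^ n) x)) = (\<Sum>j<m. cf x n j *\<^sub>C (T ^^ n) (e j))"
    unfolding PK_def T_pow_sum T_pow_simps cf_def ..
  finally show ?case using Suc by (simp add: funpow_swap1[of T] add.assoc)
qed simp

lemma norm_sq_expansion: "(norm x)\<^sup>2 = (\<Sum>k<n. \<Sum>j<m. (cmod (cf x k j))\<^sup>2) + (norm ((B ^^ n) x))\<^sup>2"
proof (induction n)
  case (Suc n)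
  then show ?case using norm_sq_PK_B[of "(B ^^ n) x"] unfolding cf_def by simp
qed simp

lemma parseval: "(\<lambda>k. \<Sum>j<m. (cmod (cf x k j))\<^sup>2) sums (norm x)\<^sup>2"
proof -
  have "(\<lambda>n. (norm x)\<^sup>2 - (norm ((B ^^ n) x))\<^sup>2) \<longlonglongrightarrow> (norm x)\<^sup>2 - 0\<^sup>2"
    by (intro tendsto_intros B_pow_tendsto)
  moreover have "(norm x)\<^sup>2 - (norm ((B ^^ n) x))\<^sup>2 = (\<Sum>k<n. \<Sum>j<m. (cmod (cf x k j))\<^sup>2)" for n
    using norm_sq_expansion[of x n] by simp
  ultimately show ?thesis unfolding sums_def by simp
qed

lemma cf_square_summable: "j < m \<Longrightarrow> summable (\<lambda>k. (cmod (cf x k j))\<^sup>2)"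
proof -
  assume j: "j < m"
  show ?thesis
  proof (rule summable_comparison_test'[OF sums_summable[OF parseval[of x]], of 0])
    show "norm ((cmod (cf x k j))\<^sup>2) \<le> (\<Sum>j<m. (cmod (cf x k j))\<^sup>2)" for k
      using member_le_sum[of j "{..<m}" "\<lambda>j. (cmod (cf x k j))\<^sup>2"] j by simp
  qed
qed

lemma cf_eqI: "(\<And>k j. j < m \<Longrightarrow> cf x k j = cf y k j) \<Longrightarrow> x = y"
proof -
  assume "\<And>k j. j < m \<Longrightarrow> cf x k j = cf y k j"
  then have "(\<Sum>j<m. (cmod (cf (x - y) k j))\<^sup>2) = 0" for k by (simp add: cf_diff)
  then have "(\<lambda>k. 0) sums (norm (x - y))\<^sup>2" using parseval[of "x - y"] by (simp only:)
  from sums_unique2[OF sums_zero this] show ?thesis by simp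
qed

lemma cinner_sums: "(\<lambda>k. \<Sum>j<m. cf x k j * cnj (cf y k j)) sums cinner x y"
proof -
  have e: "cinner x y = (\<Sum>k<n. \<Sum>j<m. cf x k j * cnj (cf y k j)) + cinner ((B ^^ n) x) ((B ^^ n) y)" for n
  proof -
    have "cinner x y = (\<Sum>k<n. \<Sum>j<m. cf x k j * cinner ((T ^^ k) (e j)) y) + cinner ((T ^^ n) ((B ^^ n) x)) y"
      by (subst expansion[of x n]) (simp add: cinner_add_left cinner_sum_left cinner_scaleC_left)
    moreover have "cinner ((T ^^ k) (e j)) y = cnj (cf y k j)" for k j
      unfolding cf_alt by (rule cinner_commute)
    ultimately show ?thesis by (simp add: T_pow_adjoint)
  qed
  have "(\<lambda>n. norm (cinner ((B ^^ n) x) ((B ^^ n) y))) \<longlonglongrightarrow> 0"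
  proof (rule tendsto_sandwich[of "\<lambda>_. 0"])
    show "(\<lambda>n. norm ((B ^^ n) x) * norm ((B ^^ n) y)) \<longlonglongrightarrow> 0"
      using tendsto_mult[OF B_pow_tendsto B_pow_tendsto] by simp
  qed (auto intro!: always_eventually norm_cinner_le)
  then have "(\<lambda>n. cinner x y - cinner ((B ^^ n) x) ((B ^^ n) y)) \<longlonglongrightarrow> cinner x y - 0"
    by (intro tendsto_diff tendsto_const) (simp add: tendsto_norm_zero_iff)
  moreover have "cinner x y - cinner ((B ^^ n) x) ((B ^^ n) y) = (\<Sum>k<n. \<Sum>j<m. cf x k j * cnj (cf y k j))" for n
    using e[of n] by simp
  ultimately show ?thesis unfolding sums_def by simp
qed

text \<open>The partial sums are Cauchy because their differences are tails of a convergent sum of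
  squares. By this lemma functions given by coefficients become vectors of the given space.\<close>

lemma riesz_fischer:
  assumes a: "\<And>j. j < m \<Longrightarrow> summable (\<lambda>k. (cmod (a k j))\<^sup>2)"
  obtains x where "\<And>k j. j < m \<Longrightarrow> cf x k j = a k j"
proof -
  define q where "q k = (\<Sum>j<m. a k j *\<^sub>C e j)" for k
  have nq: "(norm (q k))\<^sup>2 = (\<Sum>j<m. (cmod (a k j))\<^sup>2)" for k
    unfolding q_def by (rule norm_sum_orthonormal[OF e_ortho])
  have sq: "summable (\<lambda>k. (norm (q k))\<^sup>2)" unfolding nq by (rule summable_sum) (use a in auto)
  define s where "s n = (\<Sum>k<n. (T ^^ k) (q k))" for n
  have cfs: "cf (s n) k j = (if k < n then a k j else 0)" if j: "j < m" for n k j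
  proof -
    have "cf (s n) k j = (\<Sum>k'<n. \<Sum>i<m. a k' i * (if k = k' \<and> i = j then 1 else 0))"
      unfolding s_def q_def T_pow_sum T_pow_simps cf_sum cf_scale
      by (intro sum.cong refl) (use cf_basis j in auto)
    also have "\<dots> = (\<Sum>k'<n. if k' = k then a k j else 0)"
    proof (intro sum.cong refl)
      fix k'
      show "(\<Sum>i<m. a k' i * (if k = k' \<and> i = j then 1 else 0)) = (if k' = k then a k j else 0)"
      proof (cases "k' = k")
        case True
        then have "(\<Sum>i<m. a k' i * (if k = k' \<and> i = j then 1 else 0)) = (\<Sum>i<m. if i = j then a k i else 0)"
          by (intro sum.cong) auto
        then show ?thesis using True j by simp
      qed auto
    qed
    finally show ?thesis by simp
  qed
  have nd: "(norm (s n - s n'))\<^sup>2 = (\<Sum>k=n'..<n. (norm (q k))\<^sup>2)" if "n' \<le> n" for n n'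
  proof -
    have "(norm (s n - s n'))\<^sup>2 = (\<Sum>k. \<Sum>j<m. (cmod (cf (s n - s n') k j))\<^sup>2)"
      using sums_unique[OF parseval] by simp
    also have "\<dots> = (\<Sum>k. if k \<in> {n'..<n} then (norm (q k))\<^sup>2 else 0)"
      unfolding nq cf_diff using that by (intro suminf_cong) (auto simp: cfs)
    also have "\<dots> = (\<Sum>k\<in>{n'..<n}. (norm (q k))\<^sup>2)" by (subst suminf_finite[of "{n'..<n}"]) auto
    finally show ?thesis .
  qed
  have "Cauchy s"
  proof (rule metric_CauchyI)
    fix r :: real assume r: "0 < r"
    obtain N where N: "\<And>n n'. n \<ge> N \<Longrightarrow> norm (\<Sum>k=n..<n'. (norm (q k))\<^sup>2) < r\<^sup>2"
      using sq r unfolding summable_Cauchy by (meson zero_less_power)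
    have "dist (s n) (s n') < r" if "n \<ge> N" "n' \<ge> N" "n' \<le> n" for n n'
    proof -
      have "(norm (s n - s n'))\<^sup>2 < r\<^sup>2" unfolding nd[OF that(3)] using N[OF that(2), of n] by simp
      then show ?thesis unfolding dist_norm using r by (simp add: power2_less_imp_less)
    qed
    then have "dist (s n) (s n') < r" if "n \<ge> N" "n' \<ge> N" for n n'
      using that by (metis dist_commute nle_le)
    then show "\<exists>M. \<forall>n\<ge>M. \<forall>n'\<ge>M. dist (s n) (s n') < r" by blast
  qed
  then obtain x where x: "s \<longlonglongrightarrow> x" using Cauchy_convergent convergent_def by blast
  show thesis
  proof (rule that[of x])
    fix k j assume j: "j < m"
    have "(\<lambda>n. cf (s n) k j) \<longlonglongrightarrow> cf x k j" unfolding cf_alt by (rule tendsto_cinner_left[OF x])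
    moreover have "(\<lambda>n. cf (s n) k j) \<longlonglongrightarrow> a k j"
      by (rule tendsto_eventually) (use cfs[OF j] in \<open>auto simp: eventually_sequentially intro!: exI[of _ "Suc k"]\<close>)
    ultimately show "cf x k j = a k j" by (rule LIMSEQ_unique)
  qed
qed

text \<open>Strong stability of \<open>X = B (1 - P)\<close>. If \<open>f\<close> is killed by a power of \<open>B\<close>, the generating functions
  \<open>h\<^sub>i(w)\<close> of the coefficients \<open>\<langle>X\<^sup>n f, g\<^sub>i\<rangle>\<close> solve \<open>\<Gamma>(w) h(w) = \<alpha>(w)\<close>, where \<open>\<alpha>\<close> is a polynomial and
  \<open>Re \<Gamma>(w) \<ge> 1/2\<close>, so they are bounded. As \<open>X\<^sup>n f - B\<^sup>n f\<close> is a convolution of these coefficients with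
  \<open>B\<^sup>t g\<^sub>i \<rightarrow> 0\<close>, the Cesaro means of \<open>\<parallel>X\<^sup>n f\<parallel>\<^sup>2\<close> tend to 0, and \<open>X\<close> is a contraction.\<close>

context
  fixes l :: nat and g :: "nat \<Rightarrow> 'a"
  assumes g: "\<And>i j. i < l \<Longrightarrow> j < l \<Longrightarrow> cinner (g i) (g j) = (if i = j then 1 else 0)"
begin

definition X :: "'a \<Rightarrow> 'a" where "X f = B (f - (\<Sum>i<l. cinner f (g i) *\<^sub>C g i))"

lemma X_diff: "X (x - y) = X x - X y"
proof -
  have e: "x - y - (\<Sum>i<l. cinner (x - y) (g i) *\<^sub>C g i) =
     (x - (\<Sum>i<l. cinner x (g i) *\<^sub>C g i)) - (y - (\<Sum>i<l. cinner y (g i) *\<^sub>C g i))"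
    by (simp add: cinner_diff_left complex_vector.scale_left_diff_distrib sum_subtractf)
  show ?thesis unfolding X_def B_diff[symmetric] by (simp only: e)
qed

lemma norm_sq_split_g:
  "(norm f)\<^sup>2 = (\<Sum>i<l. (cmod (cinner f (g i)))\<^sup>2) + (norm (f - (\<Sum>i<l. cinner f (g i) *\<^sub>C g i)))\<^sup>2"
proof -
  let ?p = "\<Sum>i<l. cinner f (g i) *\<^sub>C g i"
  have on: "onb_of l g (cspan (g ` {..<l}))" using g unfolding onb_of_def by auto
  have "cinner (f - ?p) ?p = 0"
    by (rule onb_projection(2)[OF on]) (rule onb_projection(1)[OF on])
  then have "cinner ?p (f - ?p) = 0" using cinner_eq_zero_commute by blast
  from norm_add_orthogonal[OF this] show ?thesis using norm_sum_orthonormal[of l g, OF g] by simp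
qed

lemma X_norm_le: "norm (X f) \<le> norm f"
proof -
  have "(norm (f - (\<Sum>i<l. cinner f (g i) *\<^sub>C g i)))\<^sup>2 \<le> (norm f)\<^sup>2"
    unfolding norm_sq_split_g[of f] by (simp add: sum_nonneg)
  then have "norm (f - (\<Sum>i<l. cinner f (g i) *\<^sub>C g i)) \<le> norm f" by (rule power2_le_imp_le) simp
  then show ?thesis unfolding X_def using B_norm_le order_trans by blast
qed

lemma X_pow_norm_le: "norm ((X ^^ n) f) \<le> norm f"
  by (induction n) (auto intro: order_trans[OF X_norm_le])

lemma X_pow_norm_antimono: "n \<le> n' \<Longrightarrow> norm ((X ^^ n') f) \<le> norm ((X ^^ n) f)"
  by (rule lift_Suc_antimono_le[of "\<lambda>n. norm ((X ^^ n) f)"]) (simp_all add: X_norm_le)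

lemma X_pow_diff: "(X ^^ n) (x - y) = (X ^^ n) x - (X ^^ n) y"
  by (induction n) (auto simp: X_diff)

text \<open>A discrete Duhamel formula, from iterating
  \<open>X f = B f - (\<Sum>i<l. cinner f (g i) *\<^sub>C B (g i))\<close>. The exponent
  \<open>n - s\<close> is at least 1: every \<open>g i\<close> has passed through
  \<open>B\<close>.\<close>

lemma X_pow_eq:
  "(X ^^ n) f = (B ^^ n) f - (\<Sum>i<l. \<Sum>s<n. cinner ((X ^^ s) f) (g i) *\<^sub>C (B ^^ (n - s)) (g i))"
proof (induction n)
  case (Suc n)
  have "(X ^^ Suc n) f = B ((X ^^ n) f) - (\<Sum>i<l. cinner ((X ^^ n) f) (g i) *\<^sub>C B (g i))"
  proof -
    have "B (\<Sum>i<l. c i *\<^sub>C g i) = (\<Sum>i<l. c i *\<^sub>C B (g i))" for c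
      by (simp only: B_sum B_scale)
    then show ?thesis by (simp add: X_def B_diff)
  qed
  also have "B ((X ^^ n) f) = (B ^^ Suc n) f - (\<Sum>i<l. \<Sum>s<n. cinner ((X ^^ s) f) (g i) *\<^sub>C (B ^^ (Suc n - s)) (g i))"
  proof -
    have "B (\<Sum>i<l. \<Sum>s<n. cinner ((X ^^ s) f) (g i) *\<^sub>C (B ^^ (n - s)) (g i)) =
       (\<Sum>i<l. \<Sum>s<n. cinner ((X ^^ s) f) (g i) *\<^sub>C (B ^^ (Suc n - s)) (g i))"
      by (simp only: B_sum B_scale) (intro sum.cong refl, simp add: Suc_diff_le)
    then show ?thesis by (subst Suc.IH) (simp add: B_diff)
  qed
  finally show ?case by (simp add: sum.distrib diff_diff_eq)
qed simp

lemma bounded_cinner_range: "(\<And>n. norm (y n) \<le> K) \<Longrightarrow> bounded (range (\<lambda>n. cinner (y n) z))"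
proof -
  assume "\<And>n. norm (y n) \<le> K"
  then have "cmod (cinner (y n) z) \<le> K * norm z" for n
    by (meson norm_cinner_le mult_right_mono norm_ge_zero order_trans)
  then show ?thesis unfolding bounded_iff by auto
qed

text \<open>Let \<open>y\<close> be the combination of the \<open>g i\<close> with coefficients
  \<open>h i\<close>. Pairing the equations with the \<open>h i\<close> gives the form of the
  resolvent \<open>(1 - w B)^-1\<close> at \<open>y\<close>, whose real part is at least half of
  \<open>(norm y)^2\<close>. It is also at most \<open>l * norm y * N * norm f\<close>, since only
  the first \<open>N\<close> coefficients of \<open>\<alpha>\<close> can be nonzero. Comparison
  yields the constant.\<close>

lemma coefficient_bounded:
  assumes f: "(B ^^ N) f = 0" and w: "cmod w < 1" and i: "i < l"
  shows "cmod (pser (\<lambda>s. cinner ((X ^^ s) f) (g i)) w) \<le> 2 * (real l * (real N * norm f))"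
proof -
  define h where "h i = pser (\<lambda>s. cinner ((X ^^ s) f) (g i)) w" for i
  define \<alpha> where "\<alpha> i n = cinner ((B ^^ n) f) (g i)" for i n
  define \<gamma> where "\<gamma> i' i n = cinner ((B ^^ n) (g i')) (g i)" for i' i n
  have g1: "norm (g i) = 1" if "i < l" for i
  proof -
    have "complex_of_real ((norm (g i))\<^sup>2) = of_real 1" using g[OF that that] by (simp only: cinner_self) simp
    then have "(norm (g i))\<^sup>2 = 1" by (simp only: of_real_eq_iff)
    then have "sqrt ((norm (g i))\<^sup>2) = 1" by simp
    then show ?thesis by simp
  qed
  have bc: "bounded (range (\<lambda>s. cinner ((X ^^ s) f) (g i)))" for i
    by (rule bounded_cinner_range[OF X_pow_norm_le])
  have bg: "bounded (range (\<gamma> i' i))" for i' i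
    unfolding \<gamma>_def by (rule bounded_cinner_range[OF B_pow_norm_le])
  have \<alpha>_eq: "\<alpha> i n = (\<Sum>i'<l. \<Sum>s\<le>n. cinner ((X ^^ s) f) (g i') * \<gamma> i' i (n - s))" if i: "i < l" for i n
  proof -
    have "\<alpha> i n = cinner ((X ^^ n) f) (g i) + (\<Sum>i'<l. \<Sum>s<n. cinner ((X ^^ s) f) (g i') * \<gamma> i' i (n - s))"
      unfolding \<alpha>_def \<gamma>_def using X_pow_eq[of n f]
      by (simp add: cinner_diff_left cinner_sum_left cinner_scaleC_left)
    \<comment> \<open>By orthonormality \<open>\<gamma> i' i 0\<close> is the identity matrix, so
      the isolated term is the missing index \<open>s = n\<close> of the convolution.\<close>
    also have "cinner ((X ^^ n) f) (g i) = (\<Sum>i'<l. cinner ((X ^^ n) f) (g i') * \<gamma> i' i 0)"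
    proof -
      have "(\<Sum>i'<l. cinner ((X ^^ n) f) (g i') * \<gamma> i' i 0) = (\<Sum>i'<l. if i' = i then cinner ((X ^^ n) f) (g i) else 0)"
        unfolding \<gamma>_def by (intro sum.cong refl) (use g i in auto)
      then show ?thesis using i by simp
    qed
    also have "(\<Sum>i'<l. cinner ((X ^^ n) f) (g i') * \<gamma> i' i 0) + (\<Sum>i'<l. \<Sum>s<n. cinner ((X ^^ s) f) (g i') * \<gamma> i' i (n - s)) =
      (\<Sum>i'<l. (\<Sum>s<n. cinner ((X ^^ s) f) (g i') * \<gamma> i' i (n - s)) + cinner ((X ^^ n) f) (g i') * \<gamma> i' i 0)"
      by (subst sum.distrib) (rule add.commute)
    also have "\<dots> = (\<Sum>i'<l. \<Sum>s\<le>n. cinner ((X ^^ s) f) (g i') * \<gamma> i' i (n - s))"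
      by (intro sum.cong refl) (simp flip: lessThan_Suc_atMost)
    finally show ?thesis .
  qed
  have \<alpha>_h: "pser (\<alpha> i) w = (\<Sum>i'<l. h i' * pser (\<gamma> i' i) w)" if i: "i < l" for i
  proof -
    have "(\<lambda>n. \<Sum>i'<l. conv (\<lambda>s. cinner ((X ^^ s) f) (g i')) (\<gamma> i' i) n * w ^ n) sums (\<Sum>i'<l. h i' * pser (\<gamma> i' i) w)"
      unfolding h_def by (intro sums_sum conv_sums bc bg w)
    then have "(\<lambda>n. \<alpha> i n * w ^ n) sums (\<Sum>i'<l. h i' * pser (\<gamma> i' i) w)"
      unfolding \<alpha>_eq[OF i] conv_def sum_distrib_right .
    then show ?thesis unfolding pser_def by (rule sums_unique[symmetric])
  qed
  have \<alpha>_le: "cmod (pser (\<alpha> i) w) \<le> real N * norm f" if i: "i < l" for i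
  proof -
    have "\<alpha> i n = 0" if "n \<ge> N" for n
    proof -
      obtain q where "n = q + N" using \<open>n \<ge> N\<close> by (metis add.commute le_Suc_ex)
      then show ?thesis unfolding \<alpha>_def by (simp add: funpow_add f B_pow_simps)
    qed
    then have "pser (\<alpha> i) w = (\<Sum>n<N. \<alpha> i n * w ^ n)"
      unfolding pser_def by (intro suminf_finite) auto
    also have "cmod \<dots> \<le> (\<Sum>n<N. norm f)"
    proof (rule order_trans[OF norm_sum], rule sum_mono)
      fix n
      have "cmod (\<alpha> i n) \<le> norm ((B ^^ n) f) * norm (g i)" unfolding \<alpha>_def by (rule norm_cinner_le)
      also have "\<dots> \<le> norm f" using B_pow_norm_le g1[OF i] by simp
      finally have "cmod (\<alpha> i n) * cmod w ^ n \<le> norm f * 1"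
        using w by (intro mult_mono power_le_one) auto
      then show "cmod (\<alpha> i n * w ^ n) \<le> norm f" by (simp add: norm_mult norm_power)
    qed
    finally show ?thesis by simp
  qed
  define y where "y = (\<Sum>i<l. h i *\<^sub>C g i)"
  \<comment> \<open>The Neumann series for \<open>(1 - w B) u = y\<close>; it converges because
    \<open>B\<close> is a contraction and \<open>cmod w < 1\<close>.\<close>
  define u where "u = (\<Sum>t. w ^ t *\<^sub>C (B ^^ t) y)"
  have su: "summable (\<lambda>t. w ^ t *\<^sub>C (B ^^ t) y)"
  proof (rule summable_norm_cancel, rule summable_comparison_test'[of "\<lambda>t. norm y * cmod w ^ t" 0])
    show "summable (\<lambda>t. norm y * cmod w ^ t)" using w by (intro summable_mult summable_geometric) auto
    show "norm (norm (w ^ t *\<^sub>C (B ^^ t) y)) \<le> norm y * cmod w ^ t" for t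
      using B_pow_norm_le[of t y] by (simp add: norm_scaleC norm_power mult.commute[of "norm y"] mult_left_mono)
  qed
  have u_ge: "(norm y)\<^sup>2 / 2 \<le> Re (cinner u y)"
  proof -
    have "u = y + (\<Sum>t. w ^ Suc t *\<^sub>C (B ^^ Suc t) y)"
      unfolding u_def using suminf_split_head[OF su] by (simp add: add.commute complex_vector.scale_one)
    moreover have "(\<Sum>t. w ^ Suc t *\<^sub>C (B ^^ Suc t) y) = w *\<^sub>C B u"
    proof -
      have bl: "bounded_linear (\<lambda>x. w *\<^sub>C B x)"
        by (rule bounded_linear_intro[of _ "cmod w"])
          (auto simp: B_add B_scale scaleR_scaleC' complex_vector.scale_right_distrib norm_scaleC mult.commute[of _ "cmod w"]
            intro!: mult_left_mono B_norm_le)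
      have "w *\<^sub>C B u = (\<Sum>t. w *\<^sub>C B (w ^ t *\<^sub>C (B ^^ t) y))"
        unfolding u_def by (rule bounded_linear.suminf[OF bl su])
      then show ?thesis by (simp add: B_scale)
    qed
    \<comment> \<open>Thus \<open>u - y\<close> is not longer than \<open>u\<close>, which is the
      half space condition \<open>(norm y)^2 \<le> 2 * Re (cinner u y)\<close>.\<close>
    ultimately have "u - y = w *\<^sub>C B u" by simp
    then have "norm (u - y) \<le> norm u"
      using mult_mono[of "cmod w" 1 "norm (B u)" "norm u"] B_norm_le[of u] w by (simp add: norm_scaleC)
    then have "(norm (u - y))\<^sup>2 \<le> (norm u)\<^sup>2" by (simp add: power_mono)
    moreover have "(norm (u - y))\<^sup>2 = (norm u)\<^sup>2 - 2 * inner u y + (norm y)\<^sup>2"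
      by (simp add: power2_norm_eq_inner inner_diff_left inner_diff_right inner_commute)
    ultimately show ?thesis by (simp add: Re_cinner)
  qed
  have "cinner u y = (\<Sum>i<l. cnj (h i) * pser (\<alpha> i) w)"
  proof -
    have "(\<lambda>t. cinner (w ^ t *\<^sub>C (B ^^ t) y) y) sums cinner u y"
      unfolding u_def by (rule bounded_linear.sums[OF bounded_linear_cinner_left summable_sums[OF su]])
    moreover have "cinner (w ^ t *\<^sub>C (B ^^ t) y) y = (\<Sum>i<l. \<Sum>i'<l. cnj (h i) * (h i' * (\<gamma> i' i t * w ^ t)))" for t
      unfolding y_def B_pow_sum B_pow_simps cinner_scaleC_left cinner_sum_left cinner_sum_right cinner_scaleC_right \<gamma>_def
      by (simp add: sum_distrib_left mult_ac)
    moreover have "(\<lambda>t. \<Sum>i<l. \<Sum>i'<l. cnj (h i) * (h i' * (\<gamma> i' i t * w ^ t))) sums (\<Sum>i<l. \<Sum>i'<l. cnj (h i) * (h i' * pser (\<gamma> i' i) w))"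
      by (intro sums_sum sums_mult pser_sums bg w)
    ultimately have "cinner u y = (\<Sum>i<l. \<Sum>i'<l. cnj (h i) * (h i' * pser (\<gamma> i' i) w))"
      by (simp only:) (rule sums_unique2)
    also have "\<dots> = (\<Sum>i<l. cnj (h i) * pser (\<alpha> i) w)"
      by (intro sum.cong refl) (simp add: \<alpha>_h sum_distrib_left)
    finally show ?thesis .
  qed
  then have "Re (cinner u y) \<le> cmod (\<Sum>i<l. cnj (h i) * pser (\<alpha> i) w)" by (simp only: complex_Re_le_cmod)
  also have "\<dots> \<le> (\<Sum>i<l. cmod (h i) * (real N * norm f))"
    by (rule order_trans[OF norm_sum], rule sum_mono) (use \<alpha>_le in \<open>auto simp: norm_mult intro: mult_left_mono\<close>)
  finally have "Re (cinner u y) \<le> (\<Sum>i<l. cmod (h i) * (real N * norm f))" .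
  moreover have hy: "cmod (h i) \<le> norm y" if i: "i < l" for i
  proof -
    have "(cmod (h i))\<^sup>2 \<le> (norm y)\<^sup>2"
      unfolding y_def using norm_sum_orthonormal[of l g h, OF g] member_le_sum[of i "{..<l}" "\<lambda>i. (cmod (h i))\<^sup>2"] i by simp
    then show ?thesis by (rule power2_le_imp_le) simp
  qed
  then have "(\<Sum>i<l. cmod (h i) * (real N * norm f)) \<le> (\<Sum>i<l. norm y * (real N * norm f))"
    by (intro sum_mono mult_right_mono) auto
  ultimately have "(norm y)\<^sup>2 / 2 \<le> real l * (norm y * (real N * norm f))" using u_ge by simp
  then have "norm y * norm y \<le> norm y * (2 * (real l * (real N * norm f)))" by (simp add: power2_eq_square mult_ac)
  then have "norm y \<le> 2 * (real l * (real N * norm f))"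
    by (cases "norm y = 0") (auto simp: mult_le_cancel_left)
  then show ?thesis using hy[OF i] unfolding h_def by simp
qed

text \<open>The scalar Toeplitz estimate is applied to each coefficient of the vectors, always with
  the same bounded symbol, and the results are summed by Parseval.\<close>

lemma convolution_norm_le:
  assumes f: "(B ^^ N) f = 0" and i: "i < l"
  defines "C \<equiv> 2 * (real l * (real N * norm f))"
  shows "(\<Sum>n\<le>M. (norm (\<Sum>s<n. cinner ((X ^^ s) f) (g i) *\<^sub>C (B ^^ (n - s)) (g i)))\<^sup>2)
     \<le> C\<^sup>2 * (\<Sum>n\<le>M. (norm ((B ^^ n) (g i)))\<^sup>2)"
proof -
  define c where "c s = cinner ((X ^^ s) f) (g i)" for s
  define Y where "Y n = (\<Sum>s<n. c s *\<^sub>C (B ^^ (n - s)) (g i))" for n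
  have coeff: "(\<Sum>n\<le>M. (cmod (cf (Y n) k j))\<^sup>2) \<le> C\<^sup>2 * (\<Sum>n\<le>M. (cmod (cf ((B ^^ n) (g i)) k j))\<^sup>2)" for k j
  proof -
    \<comment> \<open>The value at 0 is set to 0 because the convolution omits
      \<open>s = n\<close>.\<close>
    define q where "q n = (if n = 0 then 0 else cf ((B ^^ n) (g i)) k j)" for n
    have "cf (Y n) k j = (\<Sum>s\<le>n. c s * q (n - s))" for n
    proof -
      have "(\<Sum>s\<le>n. c s * q (n - s)) = (\<Sum>s<n. c s * q (n - s))"
        by (rule sum.mono_neutral_right) (auto simp: q_def)
      then show ?thesis unfolding Y_def cf_sum cf_scale q_def by simp
    qed
    then have "(\<Sum>n\<le>M. (cmod (cf (Y n) k j))\<^sup>2) \<le> C\<^sup>2 * (\<Sum>n\<le>M. (cmod (q n))\<^sup>2)"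
    proof (simp only:, intro toeplitz_bound)
      show "bounded (range c)" unfolding c_def by (rule bounded_cinner_range[OF X_pow_norm_le])
      show "cmod (pser c w) \<le> C" if "cmod w < 1" for w
        unfolding c_def C_def by (rule coefficient_bounded[OF f that i])
    qed
    also have "\<dots> \<le> C\<^sup>2 * (\<Sum>n\<le>M. (cmod (cf ((B ^^ n) (g i)) k j))\<^sup>2)"
      by (intro mult_left_mono sum_mono) (auto simp: q_def)
    finally show ?thesis .
  qed
  have s1: "(\<lambda>k. \<Sum>n\<le>M. \<Sum>j<m. (cmod (cf (Y n) k j))\<^sup>2) sums (\<Sum>n\<le>M. (norm (Y n))\<^sup>2)"
    by (intro sums_sum parseval)
  have s2: "(\<lambda>k. C\<^sup>2 * (\<Sum>n\<le>M. \<Sum>j<m. (cmod (cf ((B ^^ n) (g i)) k j))\<^sup>2)) sums (C\<^sup>2 * (\<Sum>n\<le>M. (norm ((B ^^ n) (g i)))\<^sup>2))"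
    by (intro sums_mult sums_sum parseval)
  have s3: "(\<Sum>n\<le>M. \<Sum>j<m. (cmod (cf (Y n) k j))\<^sup>2) \<le> C\<^sup>2 * (\<Sum>n\<le>M. \<Sum>j<m. (cmod (cf ((B ^^ n) (g i)) k j))\<^sup>2)" for k
  proof -
    have "(\<Sum>j<m. \<Sum>n\<le>M. (cmod (cf (Y n) k j))\<^sup>2) \<le> (\<Sum>j<m. C\<^sup>2 * (\<Sum>n\<le>M. (cmod (cf ((B ^^ n) (g i)) k j))\<^sup>2))"
      by (rule sum_mono) (rule coeff)
    also have "\<dots> = C\<^sup>2 * (\<Sum>n\<le>M. \<Sum>j<m. (cmod (cf ((B ^^ n) (g i)) k j))\<^sup>2)"
      by (subst sum.swap) (simp only: sum_distrib_left)
    finally show ?thesis by (subst sum.swap)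
  qed
  have "(\<Sum>n\<le>M. (norm (Y n))\<^sup>2) \<le> C\<^sup>2 * (\<Sum>n\<le>M. (norm ((B ^^ n) (g i)))\<^sup>2)"
    by (rule sums_le[OF s3 s1 s2])
  then show ?thesis unfolding Y_def c_def .
qed

lemma X_pow_tendsto_nilpotent:
  assumes f: "(B ^^ N) f = 0"
  shows "(\<lambda>n. norm ((X ^^ n) f)) \<longlonglongrightarrow> 0"
proof -
  define C where "C = 2 * (real l * (real N * norm f))"
  define Y where "Y i n = (\<Sum>s<n. cinner ((X ^^ s) f) (g i) *\<^sub>C (B ^^ (n - s)) (g i))" for i n
  \<comment> \<open>The factor \<open>Suc l\<close> comes from Cauchy-Schwarz over the
    \<open>l + 1\<close> summands of \<open>(X ^^ n) f\<close>, and \<open>C\<^sup>2\<close> from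
    replacing the convolutions by the powers of \<open>B\<close> on the \<open>g i\<close>. The
    replacement is legitimate only after summing over \<open>n\<close>.\<close>
  define D where "D n = real (Suc l) * ((norm ((B ^^ n) f))\<^sup>2 + C\<^sup>2 * (\<Sum>i<l. (norm ((B ^^ n) (g i)))\<^sup>2))" for n
  have D0: "D \<longlonglongrightarrow> 0"
  proof -
    have "D \<longlonglongrightarrow> real (Suc l) * (0\<^sup>2 + C\<^sup>2 * (\<Sum>i<l. 0\<^sup>2))"
      unfolding D_def by (intro tendsto_intros B_pow_tendsto)
    then show ?thesis by simp
  qed
  have step: "(norm ((X ^^ n) f))\<^sup>2 \<le> real (Suc l) * ((norm ((B ^^ n) f))\<^sup>2 + (\<Sum>i<l. (norm (Y i n))\<^sup>2))" for n
  proof -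
    have "norm ((X ^^ n) f) \<le> norm ((B ^^ n) f) + norm (\<Sum>i<l. Y i n)"
      unfolding X_pow_eq[of n f] Y_def by (rule norm_triangle_ineq4)
    also have "\<dots> \<le> norm ((B ^^ n) f) + (\<Sum>i<l. norm (Y i n))" by (intro add_left_mono norm_sum)
    also have "\<dots> = (\<Sum>i<Suc l. if i = l then norm ((B ^^ n) f) else norm (Y i n))" by simp
    finally have "(norm ((X ^^ n) f))\<^sup>2 \<le> (\<Sum>i<Suc l. if i = l then norm ((B ^^ n) f) else norm (Y i n))\<^sup>2"
      by (rule power_mono) simp
    also have "\<dots> \<le> real (Suc l) * (\<Sum>i<Suc l. (if i = l then norm ((B ^^ n) f) else norm (Y i n))\<^sup>2)"
      using sum_squared_le_sum_of_squares[of "\<lambda>i. if i = l then norm ((B ^^ n) f) else norm (Y i n)" "{..<Suc l}"] by (simp only: card_lessThan mult.commute)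
    also have "\<dots> = real (Suc l) * ((norm ((B ^^ n) f))\<^sup>2 + (\<Sum>i<l. (norm (Y i n))\<^sup>2))" by simp
    finally show ?thesis .
  qed
  have "(norm ((X ^^ M) f))\<^sup>2 \<le> (\<Sum>n\<le>M. D n) / real (Suc M)" for M
  proof -
    have "real (Suc M) * (norm ((X ^^ M) f))\<^sup>2 = (\<Sum>n\<le>M. (norm ((X ^^ M) f))\<^sup>2)" by simp
    also have "\<dots> \<le> (\<Sum>n\<le>M. (norm ((X ^^ n) f))\<^sup>2)"
      by (intro sum_mono power_mono X_pow_norm_antimono) auto
    also have "\<dots> \<le> (\<Sum>n\<le>M. real (Suc l) * ((norm ((B ^^ n) f))\<^sup>2 + (\<Sum>i<l. (norm (Y i n))\<^sup>2)))"
      by (rule sum_mono) (rule step)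
    also have "\<dots> = real (Suc l) * ((\<Sum>n\<le>M. (norm ((B ^^ n) f))\<^sup>2) + (\<Sum>i<l. \<Sum>n\<le>M. (norm (Y i n))\<^sup>2))"
      by (subst sum.swap) (simp only: sum_distrib_left sum.distrib distrib_left)
    also have "\<dots> \<le> real (Suc l) * ((\<Sum>n\<le>M. (norm ((B ^^ n) f))\<^sup>2) + (\<Sum>i<l. C\<^sup>2 * (\<Sum>n\<le>M. (norm ((B ^^ n) (g i)))\<^sup>2)))"
      unfolding Y_def C_def by (intro mult_left_mono add_left_mono sum_mono convolution_norm_le f) auto
    also have "\<dots> = (\<Sum>n\<le>M. D n)"
      unfolding D_def sum_distrib_left[symmetric] sum.distrib by (subst (2) sum.swap) (simp only: sum_distrib_left)
    finally show ?thesis by (simp add: field_simps)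
  qed
  then have "(\<lambda>M. (norm ((X ^^ M) f))\<^sup>2) \<longlonglongrightarrow> 0"
    by (intro tendsto_sandwich[OF _ _ tendsto_const cesaro_tendsto_zero[OF D0]] always_eventually allI)
      (auto simp: D_def intro!: mult_nonneg_nonneg add_nonneg_nonneg sum_nonneg)
  then show ?thesis using tendsto_real_sqrt[of "\<lambda>M. (norm ((X ^^ M) f))\<^sup>2" 0] by simp
qed

text \<open>Removing the tail \<open>(T ^^ N) ((B ^^ N) f)\<close> leaves a vector killed by
  \<open>B ^^ N\<close>. The tail is small in norm and stays so under all powers of the contraction
  \<open>X\<close>.\<close>

theorem X_pow_tendsto: "(\<lambda>n. norm ((X ^^ n) f)) \<longlonglongrightarrow> 0"
proof (rule LIMSEQ_I)
  fix r :: real assume r: "0 < r"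
  obtain N where N: "norm ((B ^^ N) f) < r / 2"
    using order_tendstoD(2)[OF B_pow_tendsto, of "r / 2" f] r unfolding eventually_sequentially by auto
  define f' where "f' = f - (T ^^ N) ((B ^^ N) f)"
  have "(B ^^ N) f' = 0" unfolding f'_def B_pow_simps B_T_pow by simp
  from order_tendstoD(2)[OF X_pow_tendsto_nilpotent[OF this], of "r / 2"]
  obtain n0 where n0: "\<And>n. n \<ge> n0 \<Longrightarrow> norm ((X ^^ n) f') < r / 2"
    using r unfolding eventually_sequentially by auto
  have "norm ((X ^^ n) f) < r" if "n \<ge> n0" for n
  proof -
    have "(X ^^ n) f = (X ^^ n) f' + (X ^^ n) (f - f')" unfolding X_pow_diff by simp
    then have "norm ((X ^^ n) f) \<le> norm ((X ^^ n) f') + norm ((X ^^ n) (f - f'))" using norm_triangle_ineq by metis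
    also have "norm ((X ^^ n) (f - f')) \<le> norm (f - f')" by (rule X_pow_norm_le)
    also have "norm (f - f') = norm ((B ^^ N) f)" unfolding f'_def by (simp add: T_pow_norm)
    finally show ?thesis using n0[OF that] N by linarith
  qed
  then show "\<exists>no. \<forall>n\<ge>no. norm (norm ((X ^^ n) f) - 0) < r" by auto
qed

end

end

section \<open>Vector-valued Hardy spaces\<close>

lemma taylor_coeff_unique:
  assumes "\<And>z. cmod z < 1 \<Longrightarrow> (\<lambda>n. a n * z ^ n) sums f z"
  shows "taylor_coeff f k = a k"
proof -
  have "eventually (\<lambda>u. (\<lambda>n. fps_nth (Abs_fps a) n * u ^ n) sums f u) (nhds 0)"
    unfolding eventually_nhds_metric using assms by (intro exI[of _ 1]) auto
  then have "f has_fps_expansion Abs_fps a" by (rule has_fps_expansionI)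
  from fps_nth_fps_expansion[OF this, of k] show ?thesis unfolding taylor_coeff_def by simp
qed

lemma taylor_coeff_sums:
  assumes "f holomorphic_on ball 0 1" "cmod z < 1"
  shows "(\<lambda>n. taylor_coeff f n * z ^ n) sums f z"
  using holomorphic_power_series[OF assms(1), of z] assms(2) unfolding taylor_coeff_def by simp

lemma pser_holomorphic: "bounded (range a) \<Longrightarrow> pser a holomorphic_on ball 0 1"
  by (rule power_series_holomorphic[where a = a]) (auto intro: pser_sums)

definition vfun :: "nat \<Rightarrow> (nat \<Rightarrow> nat \<Rightarrow> complex) \<Rightarrow> complex \<Rightarrow> complex vec" where
  "vfun n a z = (if z \<in> ball 0 1 then vec n (\<lambda>i. pser (\<lambda>k. a k i) z) else 0\<^sub>v n)"

definition tc :: "(complex \<Rightarrow> complex vec) \<Rightarrow> nat \<Rightarrow> nat \<Rightarrow> complex" where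
  "tc h k i = taylor_coeff (\<lambda>z. h z $ i) k"

lemma tc_vfun:
  assumes "bounded (range (\<lambda>k. a k i))" "i < n"
  shows "tc (vfun n a) k i = a k i"
  unfolding tc_def
  by (rule taylor_coeff_unique) (use pser_sums[OF assms(1)] assms(2) in \<open>auto simp: vfun_def\<close>)

lemma vfun_H2:
  assumes a: "\<And>i. i < n \<Longrightarrow> summable (\<lambda>k. (cmod (a k i))\<^sup>2)"
  shows "vfun n a \<in> H2 n"
proof -
  have b: "bounded (range (\<lambda>k. a k i))" if "i < n" for i by (rule bounded_range_square_summable[OF a[OF that]])
  have "(\<lambda>z. vfun n a z $ i) holomorphic_on ball 0 1" if i: "i < n" for i
    by (rule holomorphic_transform[OF pser_holomorphic[OF b[OF i]]]) (use i in \<open>auto simp: vfun_def\<close>)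
  moreover have "summable (\<lambda>k. (cmod (taylor_coeff (\<lambda>z. vfun n a z $ i) k))\<^sup>2)" if i: "i < n" for i
    using a[OF i] tc_vfun[where a = a, OF b[OF i] i] unfolding tc_def by simp
  ultimately show ?thesis unfolding H2_def by (auto simp: vfun_def)
qed

lemma H2_tc_summable: "h \<in> H2 n \<Longrightarrow> i < n \<Longrightarrow> summable (\<lambda>k. (cmod (tc h k i))\<^sup>2)"
  unfolding H2_def tc_def by auto

lemma H2_eq_vfun:
  assumes "h \<in> H2 n"
  shows "h = vfun n (tc h)"
proof
  fix z
  show "h z = vfun n (tc h) z"
  proof (cases "z \<in> ball 0 1")
    case True
    show ?thesis
    proof (rule eq_vecI)
      show "dim_vec (h z) = dim_vec (vfun n (tc h) z)" using assms True unfolding H2_def vfun_def by auto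
      fix i assume "i < dim_vec (vfun n (tc h) z)"
      then have i: "i < n" using True by (simp add: vfun_def)
      have "(\<lambda>n. tc h n i * z ^ n) sums (h z $ i)"
        unfolding tc_def by (rule taylor_coeff_sums) (use assms i True in \<open>auto simp: H2_def\<close>)
      then show "h z $ i = vfun n (tc h) z $ i"
        using True i unfolding vfun_def pser_def by (simp add: sums_iff)
    qed
  next
    case False
    then show ?thesis using assms unfolding H2_def vfun_def by auto
  qed
qed

lemma H2_inner_tc: "H2_inner n h h' = (\<Sum>i<n. \<Sum>k. tc h k i * cnj (tc h' k i))"
  unfolding H2_inner_def tc_def ..

lemma H2_inner_sums:
  assumes "h \<in> H2 n" "h' \<in> H2 n"
  shows "(\<lambda>k. \<Sum>i<n. tc h k i * cnj (tc h' k i)) sums H2_inner n h h'"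
  unfolding H2_inner_tc
proof (rule sums_sum)
  fix i assume "i \<in> {..<n}"
  then have "summable (\<lambda>k. cmod (tc h k i * cnj (tc h' k i)))"
    using assms by (intro summable_mult_square_summable H2_tc_summable) auto
  then show "(\<lambda>k. tc h k i * cnj (tc h' k i)) sums (\<Sum>k. tc h k i * cnj (tc h' k i))"
    by (rule summable_sums[OF summable_norm_cancel])
qed

lemma pser_add: "bounded (range a) \<Longrightarrow> bounded (range b) \<Longrightarrow> cmod z < 1 \<Longrightarrow> pser (\<lambda>k. a k + b k) z = pser a z + pser b z"
  using sums_add[OF pser_sums pser_sums, of a z b z] unfolding pser_def by (simp add: sums_iff distrib_right)

lemma pser_scale: "bounded (range a) \<Longrightarrow> cmod z < 1 \<Longrightarrow> pser (\<lambda>k. c * a k) z = c * pser a z"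
  using sums_mult[OF pser_sums, of a z c] unfolding pser_def by (simp add: sums_iff mult.assoc)

context pure_shift
begin

lemma cf_bounded: "j < m \<Longrightarrow> bounded (range (\<lambda>k. cf x k j))"
  by (rule bounded_range_square_summable[OF cf_square_summable])

text \<open>Components of index \<open>n\<close> and above are dropped, so for \<open>n < m\<close>
  the map is isometric on \<open>L n\<close> but not on the whole space.\<close>

definition fn :: "nat \<Rightarrow> 'a \<Rightarrow> complex \<Rightarrow> complex vec" where "fn n x = vfun n (cf x)"

definition L :: "nat \<Rightarrow> 'a set" where "L n = {x. \<forall>k j. n \<le> j \<and> j < m \<longrightarrow> cf x k j = 0}"

lemma L_UNIV: "L m = UNIV" unfolding L_def by auto

lemma L_subspace: "csubspace (L n)"
  unfolding complex_vector.subspace_def L_def by (auto simp: cf_add cf_scale cf_zero)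

lemma L_closed: "closed (L n)"
proof -
  have "L n = (\<Inter>k. \<Inter>j\<in>{n..<m}. {x. cf x k j = 0})" unfolding L_def by auto
  moreover have "closed {x. cf x k j = 0}" for k j
    unfolding cf_alt by (intro closed_Collect_eq continuous_intros bounded_linear.continuous_on[OF bounded_linear_cinner_left])
  ultimately show ?thesis by (simp only:) (intro closed_INT ballI)
qed

lemma T_L: "x \<in> L n \<Longrightarrow> T x \<in> L n"
  unfolding L_def by (auto simp: cf_T)

lemma B_L: "x \<in> L n \<Longrightarrow> B x \<in> L n"
  unfolding L_def by (auto simp: cf_B)

context
  fixes n :: nat
  assumes n: "n \<le> m"
begin

lemma fn_H2: "fn n x \<in> H2 n"
  unfolding fn_def by (rule vfun_H2) (use n in \<open>auto intro: cf_square_summable\<close>)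

lemma tc_fn: "i < n \<Longrightarrow> tc (fn n x) k i = cf x k i"
  unfolding fn_def by (rule tc_vfun) (use n in \<open>auto intro: cf_bounded\<close>)

lemma fn_carrier [simp]: "fn n x z \<in> carrier_vec n" "dim_vec (fn n x z) = n"
  unfolding fn_def vfun_def by auto

lemma fn_nth: "cmod z < 1 \<Longrightarrow> i < n \<Longrightarrow> fn n x z $ i = pser (\<lambda>k. cf x k i) z"
  unfolding fn_def vfun_def by simp

lemma fn_outside: "z \<notin> ball 0 1 \<Longrightarrow> fn n x z = 0\<^sub>v n"
  unfolding fn_def vfun_def by simp

lemma fn_surj:
  assumes h: "h \<in> H2 n"
  obtains x where "x \<in> L n" "h = fn n x"
proof -
  define a where "a k j = (if j < n then tc h k j else 0)" for k j
  have sa: "summable (\<lambda>k. (cmod (a k j))\<^sup>2)" for j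
    unfolding a_def using H2_tc_summable[OF h, of j] by (cases "j < n") auto
  obtain x where x: "\<And>k j. j < m \<Longrightarrow> cf x k j = a k j" by (rule riesz_fischer[of a, OF sa]) (rule that, blast)
  have "x \<in> L n" unfolding L_def using x by (auto simp: a_def)
  moreover have "h = fn n x"
  proof -
    have "h = vfun n (tc h)" by (rule H2_eq_vfun[OF h])
    also have "\<dots> = vfun n (cf x)"
      unfolding vfun_def using x n by (intro ext) (auto simp: a_def intro!: eq_vecI)
    finally show ?thesis unfolding fn_def .
  qed
  ultimately show thesis by (rule that)
qed

text \<open>One argument in \<open>L n\<close> is enough, since the products of the dropped
  components then vanish.\<close>

lemma fn_inner:
  assumes "y \<in> L n"
  shows "H2_inner n (fn n x) (fn n y) = cinner x y" "H2_inner n (fn n y) (fn n x) = cinner y x"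
proof -
  have e: "(\<Sum>i<n. f i) = (\<Sum>i<m. f i)" if "\<And>i. n \<le> i \<Longrightarrow> i < m \<Longrightarrow> f i = 0" for f :: "nat \<Rightarrow> complex"
    by (rule sum.mono_neutral_left) (use n that in auto)
  have "(\<lambda>k. \<Sum>i<n. cf x k i * cnj (cf y k i)) sums H2_inner n (fn n x) (fn n y)"
    using H2_inner_sums[OF fn_H2 fn_H2, of x y] by (simp add: tc_fn)
  moreover have "(\<Sum>i<n. cf x k i * cnj (cf y k i)) = (\<Sum>i<m. cf x k i * cnj (cf y k i))" for k
    by (rule e) (use assms in \<open>auto simp: L_def\<close>)
  ultimately show "H2_inner n (fn n x) (fn n y) = cinner x y"
    using sums_unique2[OF cinner_sums[of x y]] by simp
  have "(\<lambda>k. \<Sum>i<n. cf y k i * cnj (cf x k i)) sums H2_inner n (fn n y) (fn n x)"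
    using H2_inner_sums[OF fn_H2 fn_H2, of y x] by (simp add: tc_fn)
  moreover have "(\<Sum>i<n. cf y k i * cnj (cf x k i)) = (\<Sum>i<m. cf y k i * cnj (cf x k i))" for k
    by (rule e) (use assms in \<open>auto simp: L_def\<close>)
  ultimately show "H2_inner n (fn n y) (fn n x) = cinner y x"
    using sums_unique2[OF cinner_sums[of y x]] by simp
qed

lemma fn_norm: "x \<in> L n \<Longrightarrow> H2_norm n (fn n x) = norm x"
  unfolding H2_norm_def using fn_inner[of x x] by (simp add: cinner_self)

lemma fn_inj: "x \<in> L n \<Longrightarrow> y \<in> L n \<Longrightarrow> fn n x = fn n y \<Longrightarrow> x = y"
proof (rule cf_eqI)
  fix k j assume *: "x \<in> L n" "y \<in> L n" "fn n x = fn n y" "j < m"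
  show "cf x k j = cf y k j"
    using * tc_fn[of j x k] tc_fn[of j y k] by (cases "j < n") (auto simp: L_def)
qed

lemma fn_add: "fn n (x + y) = (\<lambda>z. fn n x z + fn n y z)"
proof
  fix z show "fn n (x + y) z = fn n x z + fn n y z"
    using n by (intro eq_vecI, cases "z \<in> ball 0 1")
      (auto simp: fn_nth cf_add[abs_def] pser_add cf_bounded fn_outside)
qed

lemma fn_scale: "fn n (c *\<^sub>C x) = (\<lambda>z. c \<cdot>\<^sub>v fn n x z)"
proof
  fix z show "fn n (c *\<^sub>C x) z = c \<cdot>\<^sub>v fn n x z"
    using n by (intro eq_vecI, cases "z \<in> ball 0 1")
      (auto simp: fn_nth cf_scale[abs_def] pser_scale cf_bounded fn_outside)
qed

end

text \<open>\<open>fn m\<close> is onto \<open>H2 m\<close>, so \<open>U\<close> factors through a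
  linear isometry \<open>V\<close>. It fixes every \<open>(T ^^ i) (e j)\<close>, and by the
  expansion \<open>V x - x\<close> is at most twice the remainder of \<open>x\<close>; hence
  \<open>V\<close> is the identity. From here on coefficients can be used in place of
  \<open>U\<close>.\<close>

lemma wold_unitary_eq_fn:
  assumes U: "wold_unitary T m e U"
  shows "U = fn m"
proof -
  have lin: "U x \<in> H2 m" "U (x + y) = (\<lambda>z. U x z + U y z)" "U (c *\<^sub>C x) = (\<lambda>z. c \<cdot>\<^sub>v U x z)" "H2_norm m (U x) = norm x"
    for x y c using U unfolding wold_unitary_def linear_isometry_into_H2_def by auto
  have basis: "U ((T ^^ i) (e j)) = (\<lambda>z. if z \<in> ball 0 1 then z ^ i \<cdot>\<^sub>v unit_vec m j else 0\<^sub>v m)" if "j < m" for i j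
    using U that unfolding wold_unitary_def by blast
  have "\<exists>y. U x = fn m y" for x using fn_surj[OF order_refl lin(1)[of x]] by metis
  then obtain V where V: "\<And>x. U x = fn m (V x)" by metis
  have inj: "x = y" if "fn m x = fn m y" for x y using fn_inj[of m x y] that by (simp add: L_UNIV)
  have V_add: "V (x + y) = V x + V y" for x y
    by (rule inj) (use lin(2)[of x y] in \<open>simp add: V fn_add\<close>)
  have V_scale: "V (c *\<^sub>C x) = c *\<^sub>C V x" for c x
    by (rule inj) (use lin(3)[of c x] in \<open>simp add: V fn_scale\<close>)
  have V_norm: "norm (V x) = norm x" for x using lin(4)[of x] fn_norm[of m "V x"] by (simp add: V L_UNIV)
  have V0: "V 0 = 0" using V_norm[of 0] by simp
  have V_sum: "V (\<Sum>i\<in>A. f i) = (\<Sum>i\<in>A. V (f i))" for f and A :: "nat set"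
    by (induction A rule: infinite_finite_induct) (auto simp: V0 V_add)
  have V_basis: "V ((T ^^ i) (e j)) = (T ^^ i) (e j)" if j: "j < m" for i j
  proof (rule inj)
    show "fn m (V ((T ^^ i) (e j))) = fn m ((T ^^ i) (e j))"
      unfolding V[symmetric] basis[OF j]
    proof
      fix z
      show "(if z \<in> ball 0 1 then z ^ i \<cdot>\<^sub>v unit_vec m j else 0\<^sub>v m) = fn m ((T ^^ i) (e j)) z"
      proof (cases "z \<in> ball 0 1")
        case True
        have "z ^ i * (if j' = j then 1 else 0) = pser (\<lambda>k. if k = i \<and> j = j' then 1 else 0) z" for j'
        proof -
          have "(\<lambda>k. (if k = i \<and> j = j' then 1 else 0) * z ^ k) = (\<lambda>k. if k = i then (if j' = j then 1 else 0) * z ^ k else 0)" by auto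
          then show ?thesis unfolding pser_def using sums_single[of i "\<lambda>k. (if j' = j then 1 else 0) * z ^ k"] by (simp add: sums_iff)
        qed
        then show ?thesis using True j by (intro eq_vecI) (auto simp: fn_nth cf_basis unit_vec_def)
      qed (auto simp: fn_outside)
    qed
  qed
  have "V x = x" for x
  proof -
    have "norm (V x - x) \<le> 2 * norm ((B ^^ n) x)" for n
    proof -
      let ?p = "\<Sum>k<n. \<Sum>j<m. cf x k j *\<^sub>C (T ^^ k) (e j)" and ?r = "(T ^^ n) ((B ^^ n) x)"
      have x: "x = ?p + ?r" by (rule expansion)
      have "V ?p = ?p" by (simp add: V_sum V_scale V_basis)
      then have "V (?p + ?r) - (?p + ?r) = V ?r - ?r" by (simp add: V_add)
      then have "norm (V x - x) = norm (V ?r - ?r)" unfolding x[symmetric] by (rule arg_cong)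
      moreover have "norm (V ?r - ?r) \<le> norm (V ?r) + norm ?r" by (rule norm_triangle_ineq4)
      ultimately show ?thesis by (simp add: V_norm T_pow_norm)
    qed
    then have "\<exists>N. \<forall>n\<ge>N. norm (V x - x) \<le> 2 * norm ((B ^^ n) x)" by blast
    moreover have "(\<lambda>n. 2 * norm ((B ^^ n) x)) \<longlonglongrightarrow> 2 * 0" by (intro tendsto_intros B_pow_tendsto)
    ultimately have "norm (V x - x) \<le> 2 * 0" by (intro LIMSEQ_le_const)
    then show ?thesis by simp
  qed
  then show ?thesis using V by auto
qed

text \<open>Products of analytic functions become convolutions of Taylor coefficients. The identity
  on the disc is thus a triangular system of finite sums, whose right-hand sides make sense even for
  products outside \<open>H^2\<close>.\<close>

lemma represented_by_iff:
  assumes "l \<le> m"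
  shows "represented_by m (fn m) l g f (fn l y) \<longleftrightarrow>
    (\<forall>k. \<forall>j<m. cf f k j = (\<Sum>i<l. conv (\<lambda>s. cf y s i) (\<lambda>s. cf (g i) s j) k))"
    (is "_ \<longleftrightarrow> ?R")
proof -
  have s: "(\<lambda>k. (\<Sum>i<l. conv (\<lambda>s. cf y s i) (\<lambda>s. cf (g i) s j) k) * z ^ k) sums
       (\<Sum>i<l. fn l y z $ i * fn m (g i) z $ j)" if "cmod z < 1" "j < m" for z j
    unfolding sum_distrib_right
    using that assms by (intro sums_sum) (auto simp: fn_nth intro!: conv_sums cf_bounded)
  have r: "represented_by m (fn m) l g f (fn l y) \<longleftrightarrow>
     (\<forall>z. cmod z < 1 \<longrightarrow> (\<forall>j<m. pser (\<lambda>k. cf f k j) z = (\<Sum>i<l. fn l y z $ i * fn m (g i) z $ j)))"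
    unfolding represented_by_def by (auto simp: fn_nth)
  show ?thesis
  proof
    assume *: "represented_by m (fn m) l g f (fn l y)"
    show ?R
    proof (intro allI impI)
      fix k j assume j: "j < m"
      have "taylor_coeff (pser (\<lambda>k. cf f k j)) k = cf f k j"
        by (rule taylor_coeff_unique) (rule pser_sums[OF cf_bounded[OF j]])
      moreover have "taylor_coeff (pser (\<lambda>k. cf f k j)) k = (\<Sum>i<l. conv (\<lambda>s. cf y s i) (\<lambda>s. cf (g i) s j) k)"
        by (rule taylor_coeff_unique[where a = "\<lambda>k. \<Sum>i<l. conv (\<lambda>s. cf y s i) (\<lambda>s. cf (g i) s j) k"])
          (use s[OF _ j] * j in \<open>auto simp: r\<close>)
      ultimately show "cf f k j = (\<Sum>i<l. conv (\<lambda>s. cf y s i) (\<lambda>s. cf (g i) s j) k)" by simp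
    qed
  next
    assume ?R
    then show "represented_by m (fn m) l g f (fn l y)"
      unfolding r using s by (auto simp: pser_def sums_iff)
  qed
qed

end

section \<open>Inner functions and wandering families\<close>

lemma taylor_coeff_le:
  assumes f: "f holomorphic_on ball 0 1" and C: "\<And>z. cmod z < 1 \<Longrightarrow> cmod (f z) \<le> C"
  shows "cmod (taylor_coeff f k) \<le> C"
proof -
  have le: "cmod (taylor_coeff f k) * r ^ k \<le> C" if r: "0 < r" "r < 1" for r :: real
  proof -
    have "cmod ((deriv ^^ k) f 0) \<le> fact k * C / r ^ k"
    proof (rule Cauchy_inequality)
      show "f holomorphic_on ball 0 r" by (rule holomorphic_on_subset[OF f]) (use r in auto)
      show "continuous_on (cball 0 r) f"
        by (rule holomorphic_on_imp_continuous_on[OF holomorphic_on_subset[OF f]]) (use r in auto)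
    qed (use C r in auto)
    then show ?thesis using r by (simp add: taylor_coeff_def norm_divide field_simps)
  qed
  have "((\<lambda>r::real. cmod (taylor_coeff f k) * r ^ k) \<longlongrightarrow> cmod (taylor_coeff f k) * 1 ^ k) (at_left 1)"
    by (intro tendsto_intros)
  moreover have "eventually (\<lambda>r::real. cmod (taylor_coeff f k) * r ^ k \<le> C) (at_left 1)"
    by (rule eventually_at_leftI[of 0]) (auto intro: le)
  ultimately have "cmod (taylor_coeff f k) * 1 ^ k \<le> C"
    by (rule tendsto_upperbound) simp
  then show ?thesis by simp
qed

text \<open>Square summability follows from the Toeplitz estimate with \<open>\<gamma>\<close> the
  coefficients of the constant function 1: multiplication by \<open>f\<close> maps 1 to
  \<open>f\<close>.\<close>

lemma bounded_h2_taylor_coeff: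
  assumes f: "f holomorphic_on ball 0 1" and C: "\<And>z. cmod z < 1 \<Longrightarrow> cmod (f z) \<le> C"
  shows "bounded_h2 (taylor_coeff f) C" "cmod z < 1 \<Longrightarrow> pser (taylor_coeff f) z = f z"
proof -
  have b: "bounded (range (taylor_coeff f))"
    unfolding bounded_iff using taylor_coeff_le[OF f C] by auto
  show p: "pser (taylor_coeff f) z = f z" if "cmod z < 1" for z
    using taylor_coeff_sums[OF f that] unfolding pser_def by (simp add: sums_iff)
  have "(\<Sum>n\<le>N. (cmod (taylor_coeff f n))\<^sup>2) \<le> C\<^sup>2" for N
  proof -
    have "(\<Sum>s\<le>n. taylor_coeff f s * (if n - s = 0 then 1 else 0)) = taylor_coeff f n" for n
    proof -
      have "(\<Sum>s\<le>n. taylor_coeff f s * (if n - s = 0 then 1 else 0)) = (\<Sum>s\<le>n. if s = n then taylor_coeff f s else 0)"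
        by (intro sum.cong) auto
      then show ?thesis by simp
    qed
    moreover have "(\<Sum>n\<le>N. (cmod (if n = 0 then 1 else 0))\<^sup>2) = 1"
    proof -
      have "(\<Sum>n\<le>N. (cmod (if n = 0 then 1 else 0))\<^sup>2) = (\<Sum>n\<le>N. if n = 0 then 1 else 0)" by (intro sum.cong) auto
      then show ?thesis by simp
    qed
    ultimately show ?thesis
      using toeplitz_bound[OF b, where C = C and N = N and \<gamma> = "\<lambda>n. if n = 0 then 1 else 0"] p C by simp
  qed
  then have "summable (\<lambda>n. (cmod (taylor_coeff f n))\<^sup>2)"
    by (intro bounded_imp_summable) auto
  then show "bounded_h2 (taylor_coeff f) C"
    by unfold_locales (use p C in auto)
qed

text \<open>Polarisation: the sesquilinear form with matrix \<open>E\<close>, the Gram matrix minus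
  the identity, vanishes once its quadratic form does. The condition on columns consists of finitely
  many equations, each of which can be checked almost everywhere.\<close>

lemma isometry_mat_iff_orthonormal_cols:
  "isometry_mat n p A \<longleftrightarrow> A \<in> carrier_mat n p \<and>
    (\<forall>j<p. \<forall>j'<p. (\<Sum>i<n. A $$ (i, j) * cnj (A $$ (i, j'))) = (if j = j' then 1 else 0))"
proof (cases "A \<in> carrier_mat n p")
  case A: True
  define G where "G j j' = (\<Sum>i<n. A $$ (i, j) * cnj (A $$ (i, j')))" for j j'
  have norm_A: "(A *\<^sub>v v) \<bullet>c (A *\<^sub>v v) = (\<Sum>j<p. \<Sum>j'<p. v $ j * cnj (v $ j') * G j j')"
    if v: "v \<in> carrier_vec p" for v
  proof -
    have "(A *\<^sub>v v) \<bullet>c (A *\<^sub>v v) = (\<Sum>i<n. (\<Sum>j<p. A $$ (i, j) * v $ j) * cnj (\<Sum>j'<p. A $$ (i, j') * v $ j'))"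
      using A v unfolding scalar_prod_def by (auto simp: lessThan_atLeast0 scalar_prod_def intro!: sum.cong)
    also have "\<dots> = (\<Sum>i<n. \<Sum>j<p. \<Sum>j'<p. v $ j * cnj (v $ j') * (A $$ (i, j) * cnj (A $$ (i, j'))))"
      by (intro sum.cong refl) (simp add: cnj_sum sum_product mult_ac)
    also have "\<dots> = (\<Sum>j<p. \<Sum>i<n. \<Sum>j'<p. v $ j * cnj (v $ j') * (A $$ (i, j) * cnj (A $$ (i, j'))))"
      by (rule sum.swap)
    also have "\<dots> = (\<Sum>j<p. \<Sum>j'<p. v $ j * cnj (v $ j') * G j j')"
      unfolding G_def sum_distrib_left by (rule sum.cong[OF refl]) (rule sum.swap)
    finally show ?thesis .
  qed
  have norm_v: "v \<bullet>c v = (\<Sum>j<p. v $ j * cnj (v $ j))" if "v \<in> carrier_vec p" for v :: "complex vec"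
    using that unfolding scalar_prod_def by (auto simp: lessThan_atLeast0)
  show ?thesis
  proof
    assume iso: "isometry_mat n p A"
    define E where "E j j' = G j j' - (if j = j' then 1 else 0)" for j j'
    have E0: "(\<Sum>j<p. \<Sum>j'<p. f j * cnj (f j') * E j j') = 0" for f
    proof -
      have "(\<Sum>j<p. \<Sum>j'<p. f j * cnj (f j') * G j j') = (\<Sum>j<p. f j * cnj (f j))"
        using iso norm_A[of "vec p f"] norm_v[of "vec p f"] unfolding isometry_mat_def by auto
      moreover have "(\<Sum>j<p. \<Sum>j'<p. f j * cnj (f j') * (if j = j' then 1 else 0)) = (\<Sum>j<p. f j * cnj (f j))"
      proof (intro sum.cong refl)
        fix j assume "j \<in> {..<p}"
        have "(\<Sum>j'<p. f j * cnj (f j') * (if j = j' then 1 else 0)) = (\<Sum>j'<p. if j' = j then f j * cnj (f j) else 0)"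
          by (intro sum.cong) auto
        then show "(\<Sum>j'<p. f j * cnj (f j') * (if j = j' then 1 else 0)) = f j * cnj (f j)" using \<open>j \<in> {..<p}\<close> by simp
      qed
      ultimately show ?thesis unfolding E_def right_diff_distrib sum_subtractf by simp
    qed
    define f :: "nat \<Rightarrow> complex \<Rightarrow> nat \<Rightarrow> complex" where "f c x j = (if j = c then x else 0)" for c x j
    have single: "(\<Sum>j<p. \<Sum>j'<p. f c x j * cnj (f d y j') * E j j') = x * cnj y * E c d" if "c < p" "d < p" for c d x y
    proof -
      have in1: "(\<Sum>j'<p. f c x j * cnj (f d y j') * E j j') = f c x j * cnj y * E j d" for j
      proof -
        have "(\<Sum>j'<p. f c x j * cnj (f d y j') * E j j') = (\<Sum>j'<p. if j' = d then f c x j * cnj y * E j d else 0)"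
          by (intro sum.cong) (auto simp: f_def)
        then show ?thesis using that(2) by simp
      qed
      have "(\<Sum>j<p. \<Sum>j'<p. f c x j * cnj (f d y j') * E j j') = (\<Sum>j<p. if j = c then x * cnj y * E c d else 0)"
        unfolding in1 by (intro sum.cong) (auto simp: f_def)
      then show ?thesis using that(1) by simp
    qed
    have diag: "E a a = 0" if "a < p" for a
      using single[of a a 1 1] E0[of "f a 1"] that by simp
    have "E a b = 0" if ab: "a < p" "b < p" "a \<noteq> b" for a b
    proof -
      have "x * cnj y * E a b + y * cnj x * E b a = 0" for x y
        using E0[of "\<lambda>j. f a x j + f b y j"] single[OF ab(1,1), of x x] single[OF ab(1,2), of x y]
          single[OF ab(2,1), of y x] single[OF ab(2,2), of y y] diag ab
        by (simp add: distrib_left distrib_right sum.distrib add.commute)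
      \<comment> \<open>The test vectors with entries \<open>1, 1\<close> and \<open>1, \<i>\<close>
        separate the sum and the difference of the two off-diagonal entries.\<close>
      from this[of 1 1] this[of 1 "\<i>"] have "E a b + E b a = 0" "- \<i> * E a b + \<i> * E b a = 0" by auto
      then have "\<i> * (E b a - E a b) = 0" by (simp add: algebra_simps)
      then have "E b a = E a b" by simp
      with \<open>E a b + E b a = 0\<close> show ?thesis by simp
    qed
    with diag have "E a b = 0" if "a < p" "b < p" for a b using that by blast
    then show "A \<in> carrier_mat n p \<and> (\<forall>j<p. \<forall>j'<p. (\<Sum>i<n. A $$ (i, j) * cnj (A $$ (i, j'))) = (if j = j' then 1 else 0))"
      using A unfolding E_def G_def right_minus_eq by blast
  next
    assume R: "A \<in> carrier_mat n p \<and> (\<forall>j<p. \<forall>j'<p. (\<Sum>i<n. A $$ (i, j) * cnj (A $$ (i, j'))) = (if j = j' then 1 else 0))"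
    have "(\<Sum>j<p. \<Sum>j'<p. v $ j * cnj (v $ j') * G j j') = (\<Sum>j<p. v $ j * cnj (v $ j))" for v :: "complex vec"
    proof (intro sum.cong refl)
      fix j assume j: "j \<in> {..<p}"
      have "(\<Sum>j'<p. v $ j * cnj (v $ j') * G j j') = (\<Sum>j'<p. if j' = j then v $ j * cnj (v $ j) else 0)"
        using R j unfolding G_def by (intro sum.cong) auto
      then show "(\<Sum>j'<p. v $ j * cnj (v $ j') * G j j') = v $ j * cnj (v $ j)" using j by simp
    qed
    then show "isometry_mat n p A" unfolding isometry_mat_def using A norm_A norm_v by simp
  qed
qed (simp add: isometry_mat_def)

context pure_shift
begin

lemma pser_cf_T:
  assumes i: "i < m" and z: "cmod z < 1"
  shows "pser (\<lambda>k. cf (T x) k i) z = z * pser (\<lambda>k. cf x k i) z"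
proof -
  have "(\<lambda>k. z * (cf x k i * z ^ k)) sums (z * pser (\<lambda>k. cf x k i) z)"
    by (rule sums_mult[OF pser_sums[OF cf_bounded[OF i] z]])
  then have "(\<lambda>k. cf (T x) (Suc k) i * z ^ Suc k) sums (z * pser (\<lambda>k. cf x k i) z)"
    by (simp add: cf_T[OF i] mult_ac)
  then have "(\<lambda>k. cf (T x) k i * z ^ k) sums (z * pser (\<lambda>k. cf x k i) z)"
    by (subst (asm) sums_Suc_iff) (simp add: cf_T[OF i])
  then show ?thesis unfolding pser_def[of "\<lambda>k. cf (T x) k i"] by (simp add: sums_iff)
qed

text \<open>Powers of \<open>T\<close> on the left only: the other inner products of translates
  reduce to these by moving powers of \<open>T\<close> across as powers of \<open>B\<close>, and by
  conjugation.\<close>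

definition wandering :: "nat \<Rightarrow> (nat \<Rightarrow> 'a) \<Rightarrow> bool" where
  "wandering p \<phi> \<longleftrightarrow> (\<forall>k. \<forall>i<p. \<forall>j<p. cinner ((T ^^ k) (\<phi> i)) (\<phi> j) = (if k = 0 \<and> i = j then 1 else 0))"

lemma wandering_ortho:
  assumes "wandering p \<phi>" "i < p" "j < p"
  shows "cinner ((T ^^ k) (\<phi> i)) ((T ^^ k') (\<phi> j)) = (if k = k' \<and> i = j then 1 else 0)"
proof (cases "k' \<le> k")
  case True
  then obtain q where q: "k = k' + q" using le_Suc_ex by blast
  have "cinner ((T ^^ k) (\<phi> i)) ((T ^^ k') (\<phi> j)) = cinner ((T ^^ q) (\<phi> i)) (\<phi> j)"
    unfolding q funpow_add o_apply T_pow_adjoint[of k'] B_T_pow ..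
  then show ?thesis using assms q unfolding wandering_def by auto
next
  case False
  then obtain q where q: "k' = k + q" using le_Suc_ex by (metis nle_le)
  have "cinner ((T ^^ k) (\<phi> i)) ((T ^^ k') (\<phi> j)) = cinner (\<phi> i) ((T ^^ q) (\<phi> j))"
    unfolding q funpow_add o_apply T_pow_adjoint[of k] B_T_pow ..
  also have "\<dots> = cnj (cinner ((T ^^ q) (\<phi> j)) (\<phi> i))" by (rule cinner_commute)
  finally show ?thesis using assms False q unfolding wandering_def by auto
qed

definition columns :: "nat \<Rightarrow> nat \<Rightarrow> (complex \<Rightarrow> complex mat) \<Rightarrow> (nat \<Rightarrow> 'a) \<Rightarrow> bool" where
  "columns n p \<Phi> \<phi> \<longleftrightarrow> (\<forall>j<p. \<phi> j \<in> L n) \<and>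
     (\<forall>z\<in>ball 0 1. \<forall>i<n. \<forall>j<p. \<Phi> z $$ (i, j) = pser (\<lambda>k. cf (\<phi> j) k i) z)"

context
  fixes n :: nat
  assumes n: "n \<le> m"
begin

text \<open>Bounded entries have square summable Taylor coefficients, so every column is a vector of
  the Hilbert space, with zeros in the components from \<open>n\<close> on.\<close>

lemma columns_exist:
  assumes \<Phi>: "\<Phi> \<in> Hinf n p"
  obtains \<phi> C where "columns n p \<Phi> \<phi>" "\<And>i j. i < n \<Longrightarrow> j < p \<Longrightarrow> bounded_h2 (\<lambda>k. cf (\<phi> j) k i) C"
proof -
  obtain C where C: "\<And>z i j. z \<in> ball 0 1 \<Longrightarrow> i < n \<Longrightarrow> j < p \<Longrightarrow> cmod (\<Phi> z $$ (i, j)) \<le> C"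
    using \<Phi> unfolding Hinf_def by blast
  have hol: "(\<lambda>z. \<Phi> z $$ (i, j)) holomorphic_on ball 0 1" if "i < n" "j < p" for i j
    using \<Phi> that unfolding Hinf_def by blast
  have b: "bounded_h2 (taylor_coeff (\<lambda>z. \<Phi> z $$ (i, j))) C" if "i < n" "j < p" for i j
    by (rule bounded_h2_taylor_coeff(1)[OF hol[OF that]]) (use C that in auto)
  have "\<exists>x. \<forall>k i. i < m \<longrightarrow> cf x k i = (if i < n then taylor_coeff (\<lambda>z. \<Phi> z $$ (i, j)) k else 0)" if j: "j < p" for j
  proof -
    have "summable (\<lambda>k. (cmod (if i < n then taylor_coeff (\<lambda>z. \<Phi> z $$ (i, j)) k else 0))\<^sup>2)" for i
      using bounded_h2.square_summable[OF b[of i j]] j by (cases "i < n") auto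
    then show ?thesis
      by (rule riesz_fischer[of "\<lambda>k i. if i < n then taylor_coeff (\<lambda>z. \<Phi> z $$ (i, j)) k else 0"]) blast
  qed
  then obtain \<phi> where \<phi>: "\<And>j k i. j < p \<Longrightarrow> i < m \<Longrightarrow> cf (\<phi> j) k i = (if i < n then taylor_coeff (\<lambda>z. \<Phi> z $$ (i, j)) k else 0)"
    by metis
  have e: "(\<lambda>k. cf (\<phi> j) k i) = taylor_coeff (\<lambda>z. \<Phi> z $$ (i, j))" if "i < n" "j < p" for i j
    using \<phi>[of j i] that n by auto
  show thesis
  proof (rule that)
    show "columns n p \<Phi> \<phi>"
      unfolding columns_def
    proof (intro conjI allI impI ballI)
      show "\<phi> j \<in> L n" if "j < p" for j using \<phi>[OF that] unfolding L_def by auto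
      show "\<Phi> z $$ (i, j) = pser (\<lambda>k. cf (\<phi> j) k i) z" if "z \<in> ball 0 1" "i < n" "j < p" for z i j
        unfolding e[OF that(2,3)] by (rule bounded_h2_taylor_coeff(2)[OF hol[OF that(2,3)] C, symmetric]) (use that in auto)
    qed
    show "bounded_h2 (\<lambda>k. cf (\<phi> j) k i) C" if "i < n" "j < p" for i j
      unfolding e[OF that] by (rule b[OF that])
  qed
qed

text \<open>The bridge from the circle to the Hilbert space: the lag \<open>k\<close> in the
  coefficient sums is the action of \<open>B ^^ k\<close> on \<open>y\<close>, hence of
  \<open>T ^^ k\<close> on \<open>x\<close>. The first \<open>n\<close> components suffice because
  \<open>x\<close> lies in \<open>L n\<close>.\<close>

lemma moment_eq_cinner:
  assumes x: "\<And>i. i < n \<Longrightarrow> bounded_h2 (\<lambda>k. cf x k i) C" and y: "\<And>i. i < n \<Longrightarrow> bounded_h2 (\<lambda>k. cf y k i) C"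
    and xL: "x \<in> L n"
  shows "(LINT t|circ. cis (real k * t) * (\<Sum>i<n. bd (\<lambda>k. cf x k i) t * cnj (bd (\<lambda>k. cf y k i) t))) = 2 * pi * cinner ((T ^^ k) x) y"
proof -
  have "(LINT t|circ. cis (real k * t) * (\<Sum>i<n. bd (\<lambda>k. cf x k i) t * cnj (bd (\<lambda>k. cf y k i) t))) =
    (\<Sum>i<n. LINT t|circ. cis (real k * t) * bd (\<lambda>k. cf x k i) t * cnj (bd (\<lambda>k. cf y k i) t))"
    unfolding sum_distrib_left mult.assoc[symmetric]
    by (rule Bochner_Integration.integral_sum) (rule boundary_moment(2)[OF x y], auto)
  also have "\<dots> = (\<Sum>i<n. 2 * pi * (\<Sum>q. cf x q i * cnj (cf y (q + k) i)))"
    by (intro sum.cong refl boundary_moment(1)[OF x y]) auto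
  also have "\<dots> = 2 * pi * (\<Sum>i<n. \<Sum>q. cf x q i * cnj (cf ((B ^^ k) y) q i))"
    unfolding cf_B_pow by (simp add: sum_distrib_left add.commute)
  also have "(\<Sum>i<n. \<Sum>q. cf x q i * cnj (cf ((B ^^ k) y) q i)) = cinner x ((B ^^ k) y)"
    using fn_inner(2)[OF n xL, of "(B ^^ k) y"] unfolding H2_inner_tc by (simp add: tc_fn[OF n])
  finally show ?thesis unfolding T_pow_adjoint .
qed

text \<open>On the boundary the Gram function of two columns is constant almost everywhere, so its
  moments with \<open>k > 0\<close> vanish; these moments are the required inner products.\<close>

lemma inner_function_imp_wandering:
  assumes \<Phi>: "inner_function n p \<Phi>" and c: "columns n p \<Phi> \<phi>"
    and b: "\<And>i j. i < n \<Longrightarrow> j < p \<Longrightarrow> bounded_h2 (\<lambda>k. cf (\<phi> j) k i) C"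
  shows "wandering p \<phi>"
  unfolding wandering_def
proof (intro allI impI)
  fix k j j' assume j: "j < p" "j' < p"
  define d :: complex where "d = (if j = j' then 1 else 0)"
  have "AE t in circ. \<exists>A. isometry_mat n p A \<and>
        (\<forall>i<n. \<forall>j<p. ((\<lambda>r. \<Phi> (complex_of_real r * cis t) $$ (i, j)) \<longlongrightarrow> A $$ (i, j)) (at_left 1))"
    using \<Phi> unfolding inner_function_def by blast
  then have gram: "AE t in circ. (\<Sum>i<n. bd (\<lambda>k. cf (\<phi> j) k i) t * cnj (bd (\<lambda>k. cf (\<phi> j') k i) t)) = d"
  proof eventually_elim
    case (elim t)
    then obtain A where A: "isometry_mat n p A"
      and lim: "\<And>i j. i < n \<Longrightarrow> j < p \<Longrightarrow> ((\<lambda>r. \<Phi> (complex_of_real r * cis t) $$ (i, j)) \<longlongrightarrow> A $$ (i, j)) (at_left 1)" by blast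
    have "bd (\<lambda>k. cf (\<phi> j) k i) t = A $$ (i, j)" if ij: "i < n" "j < p" for i j
    proof (rule bd_eq, rule Lim_transform_eventually[OF lim[OF ij]])
      show "\<forall>\<^sub>F r in at_left 1. \<Phi> (complex_of_real r * cis t) $$ (i, j) = pser (\<lambda>k. cf (\<phi> j) k i) (complex_of_real r * cis t)"
        by (rule eventually_at_leftI[of 0]) (use c ij in \<open>auto simp: columns_def norm_mult\<close>)
    qed
    then show ?case using A j unfolding isometry_mat_iff_orthonormal_cols d_def by simp
  qed
  have "2 * pi * cinner ((T ^^ k) (\<phi> j)) (\<phi> j') = (LINT t|circ. cis (real k * t) * (\<Sum>i<n. bd (\<lambda>k. cf (\<phi> j) k i) t * cnj (bd (\<lambda>k. cf (\<phi> j') k i) t)))"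
    by (rule moment_eq_cinner[symmetric]) (use b c j in \<open>auto simp: columns_def\<close>)
  also have "\<dots> = (LINT t|circ. cis (real k * t) * d)"
  proof (rule integral_cong_AE)
    have [measurable]: "bd (\<lambda>k. cf (\<phi> j) k i) \<in> borel_measurable circ" if "i < n" "j < p" for i j
      by (rule bounded_h2.measurable[OF b[OF that]])
    show "(\<lambda>t. cis (real k * t) * (\<Sum>i<n. bd (\<lambda>k. cf (\<phi> j) k i) t * cnj (bd (\<lambda>k. cf (\<phi> j') k i) t))) \<in> borel_measurable circ"
      using j by (intro borel_measurable_times borel_measurable_sum) (auto intro: measurable_compose[OF _ measurable_cnj])
  qed (use gram in auto)
  also have "\<dots> = (LINT t|circ. cis (of_int (int k) * t)) * d" by simp
  also have "\<dots> = 2 * pi * (if k = 0 \<and> j = j' then 1 else 0)" unfolding integral_cis_circ by (simp add: d_def)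
  finally show "cinner ((T ^^ k) (\<phi> j)) (\<phi> j') = (if k = 0 \<and> j = j' then 1 else 0)" by simp
qed

text \<open>Bessel's inequality for the orthonormal family \<open>T\<^sup>t x\<close> and the Szego kernel.\<close>
lemma wandering_bounded:
  assumes w: "\<And>k. cinner ((T ^^ k) x) x = (if k = 0 then 1 else 0)" and i: "i < m" and z: "cmod z < 1"
  shows "cmod (pser (\<lambda>k. cf x k i) z) \<le> 1"
proof -
  \<comment> \<open>The coefficients of the Szego kernel at \<open>z\<close> in component
    \<open>i\<close>; pairing with the resulting vector \<open>s\<close> evaluates that component at
    \<open>z\<close>.\<close>
  define a where "a k j = (if j = i then cnj z ^ k else 0)" for k j
  have gs: "(\<lambda>k. (cmod z)\<^sup>2 ^ k) sums (1 / (1 - (cmod z)\<^sup>2))"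
    by (rule geometric_sums) (use z in \<open>simp add: power_less_one_iff abs_square_less_1\<close>)
  have "summable (\<lambda>k. (cmod (a k j))\<^sup>2)" for j
  proof (cases "j = i")
    case True
    have "(cmod z ^ k)\<^sup>2 = (cmod z)\<^sup>2 ^ k" for k by (simp flip: power_mult add: mult.commute)
    then show ?thesis using True sums_summable[OF gs] by (simp add: a_def norm_power)
  qed (simp add: a_def)
  then obtain s where s: "\<And>k j. j < m \<Longrightarrow> cf s k j = a k j" by (rule riesz_fischer[of a]) blast
  have sum_a: "(\<Sum>j<m. f j * (if j = i then c else 0)) = f i * c" for f and c :: complex
  proof -
    have "(\<Sum>j<m. f j * (if j = i then c else 0)) = (\<Sum>j<m. if j = i then f i * c else 0)" by (intro sum.cong) auto
    then show ?thesis using i by simp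
  qed
  have eval: "cinner y s = pser (\<lambda>k. cf y k i) z" for y
  proof -
    have "(\<Sum>j<m. cf y k j * cnj (cf s k j)) = cf y k i * z ^ k" for k
    proof -
      have "(\<Sum>j<m. cf y k j * cnj (cf s k j)) = (\<Sum>j<m. cf y k j * (if j = i then z ^ k else 0))"
        by (intro sum.cong refl) (use s in \<open>auto simp: a_def\<close>)
      then show ?thesis unfolding sum_a .
    qed
    then have "(\<lambda>k. cf y k i * z ^ k) sums cinner y s" using cinner_sums[of y s] by simp
    then show ?thesis unfolding pser_def by (simp add: sums_iff)
  qed
  have norm_s: "(norm s)\<^sup>2 = 1 / (1 - (cmod z)\<^sup>2)"
  proof -
    have "cinner s s = of_real (1 / (1 - (cmod z)\<^sup>2))"
    proof -
      have "(\<lambda>k. complex_of_real ((cmod z)\<^sup>2 ^ k)) sums of_real (1 / (1 - (cmod z)\<^sup>2))"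
        by (rule sums_of_real[OF gs])
      moreover have "cf s k i * z ^ k = complex_of_real ((cmod z)\<^sup>2 ^ k)" for k
      proof -
        have "cf s k i * z ^ k = (z * cnj z) ^ k" using s[OF i] by (simp add: a_def power_mult_distrib mult.commute)
        also have "z * cnj z = of_real ((cmod z)\<^sup>2)" by (rule complex_norm_square[symmetric])
        finally show ?thesis by simp
      qed
      ultimately show ?thesis unfolding eval pser_def by (simp add: sums_iff)
    qed
    then show ?thesis unfolding cinner_self by (simp only: of_real_eq_iff)
  qed
  define P where "P = pser (\<lambda>k. cf x k i) z"
  \<comment> \<open>Evaluation at \<open>z\<close> turns powers of \<open>T\<close> into powers of
    \<open>z\<close>. Hence Bessel's sum tends to \<open>(cmod P)^2\<close> times the squared norm
    of \<open>s\<close>, which forces \<open>cmod P \<le> 1\<close>.\<close>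
  have shiftP: "cinner ((T ^^ t) x) s = z ^ t * P" for t
  proof (induction t)
    case 0 then show ?case by (simp add: eval P_def)
  next
    case (Suc t)
    have "cinner (T y) s = z * cinner y s" for y unfolding eval by (rule pser_cf_T[OF i z])
    then show ?case by (simp add: Suc mult.assoc)
  qed
  have bessel: "(\<Sum>t<N. (cmod P)\<^sup>2 * (cmod z)\<^sup>2 ^ t) \<le> 1 / (1 - (cmod z)\<^sup>2)" for N
  proof -
    have ortho: "cinner ((T ^^ t) x) ((T ^^ t') x) = (if t = t' then 1 else 0)" for t t'
      using wandering_ortho[of 1 "\<lambda>_. x" 0 0 t t'] w unfolding wandering_def by simp
    have "(\<Sum>t<N. (cmod (cinner s ((T ^^ t) x)))\<^sup>2) \<le> (norm s)\<^sup>2"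
      using norm_sq_split_g[of N "\<lambda>t. (T ^^ t) x" s] ortho by simp
    moreover have "(cmod (cinner s ((T ^^ t) x)))\<^sup>2 = (cmod P)\<^sup>2 * (cmod z)\<^sup>2 ^ t" for t
    proof -
      have "cmod (cinner s ((T ^^ t) x)) = cmod (cinner ((T ^^ t) x) s)" by (metis cinner_commute complex_mod_cnj)
      then show ?thesis unfolding shiftP by (simp add: norm_mult norm_power power_mult_distrib mult.commute flip: power_mult)
    qed
    ultimately show ?thesis using norm_s by simp
  qed
  have "(\<lambda>t. (cmod P)\<^sup>2 * (cmod z)\<^sup>2 ^ t) sums ((cmod P)\<^sup>2 * (1 / (1 - (cmod z)\<^sup>2)))" by (rule sums_mult[OF gs])
  then have "(\<lambda>N. \<Sum>t<N. (cmod P)\<^sup>2 * (cmod z)\<^sup>2 ^ t) \<longlonglongrightarrow> (cmod P)\<^sup>2 * (1 / (1 - (cmod z)\<^sup>2))" unfolding sums_def .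
  then have "(cmod P)\<^sup>2 * (1 / (1 - (cmod z)\<^sup>2)) \<le> 1 / (1 - (cmod z)\<^sup>2)"
    by (rule LIMSEQ_le_const2) (use bessel in blast)
  moreover have "0 < 1 - (cmod z)\<^sup>2" using z by (simp add: abs_square_less_1)
  ultimately have "(cmod P)\<^sup>2 \<le> 1"
    using mult_right_le_imp_le[of "(cmod P)\<^sup>2" "1 / (1 - (cmod z)\<^sup>2)" 1] by simp
  then show ?thesis unfolding P_def by (simp add: abs_square_le_1)
qed

definition mat_of_columns :: "nat \<Rightarrow> (nat \<Rightarrow> 'a) \<Rightarrow> complex \<Rightarrow> complex mat" where
  "mat_of_columns p \<phi> z = (if z \<in> ball 0 1 then mat n p (\<lambda>(i, j). pser (\<lambda>k. cf (\<phi> j) k i) z) else 0\<^sub>m n p)"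

text \<open>The pointwise bound 1 gives membership in \<open>Hinf\<close> and makes bounded boundary
  values available. The wandering relations then say that the Gram functions minus the identity have
  vanishing Fourier coefficients.\<close>

lemma wandering_imp_inner_function:
  assumes w: "wandering p \<phi>" and \<phi>L: "\<And>j. j < p \<Longrightarrow> \<phi> j \<in> L n"
  shows "inner_function n p (mat_of_columns p \<phi>)" "columns n p (mat_of_columns p \<phi>) \<phi>"
    "\<And>i j. i < n \<Longrightarrow> j < p \<Longrightarrow> bounded_h2 (\<lambda>k. cf (\<phi> j) k i) 1"
proof -
  show cols: "columns n p (mat_of_columns p \<phi>) \<phi>"
    unfolding columns_def mat_of_columns_def using \<phi>L by auto
  have le1: "cmod (pser (\<lambda>k. cf (\<phi> j) k i) z) \<le> 1" if "i < n" "j < p" "cmod z < 1" for i j z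
    by (rule wandering_bounded) (use that n w in \<open>auto simp: wandering_def\<close>)
  show b: "bounded_h2 (\<lambda>k. cf (\<phi> j) k i) 1" if "i < n" "j < p" for i j
    by unfold_locales (use that n le1 cf_square_summable in auto)
  have "mat_of_columns p \<phi> \<in> Hinf n p"
    unfolding Hinf_def
  proof (intro CollectI conjI allI impI)
    fix i j assume ij: "i < n" "j < p"
    show "(\<lambda>z. mat_of_columns p \<phi> z $$ (i, j)) holomorphic_on ball 0 1"
      by (rule holomorphic_transform[OF pser_holomorphic[OF bounded_h2.bounded_coeffs[OF b[OF ij]]]])
        (use ij in \<open>auto simp: mat_of_columns_def\<close>)
  next
    show "\<exists>C. \<forall>z\<in>ball 0 1. \<forall>i<n. \<forall>j<p. cmod (mat_of_columns p \<phi> z $$ (i, j)) \<le> C"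
      by (rule exI[of _ 1]) (auto simp: mat_of_columns_def le1)
  qed (auto simp: mat_of_columns_def)
  moreover have "AE t in circ. \<exists>A. isometry_mat n p A \<and>
        (\<forall>i<n. \<forall>j<p. ((\<lambda>r. mat_of_columns p \<phi> (complex_of_real r * cis t) $$ (i, j)) \<longlongrightarrow> A $$ (i, j)) (at_left 1))"
  proof -
    have gram1: "AE t in circ. (\<Sum>i<n. bd (\<lambda>k. cf (\<phi> j) k i) t * cnj (bd (\<lambda>k. cf (\<phi> j') k i) t)) = (if j = j' then 1 else 0)"
      if j: "j < p" "j' < p" for j j'
    proof (rule AE_zero_of_moments[where C = 1])
      let ?d = "(if j = j' then 1 else 0) :: complex"
      let ?u = "\<lambda>j j' t. \<Sum>i<n. bd (\<lambda>k. cf (\<phi> j) k i) t * cnj (bd (\<lambda>k. cf (\<phi> j') k i) t)"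
      show "bounded_h2 (\<lambda>k. cf (\<phi> j) k i) 1" "bounded_h2 (\<lambda>k. cf (\<phi> j') k i) 1" if "i < n" for i
        using b that j by auto
      \<comment> \<open>Stated for every pair of columns, because a negative frequency for
        \<open>j, j'\<close> is the conjugate of a positive one for \<open>j', j\<close>.\<close>
      have nonneg: "(LINT t|circ. cis (real k * t) * ?u j j' t) = 2 * pi * (if k = 0 then (if j = j' then 1 else 0) else 0)"
        if j: "j < p" "j' < p" for k j j'
        by (subst moment_eq_cinner[where C = 1]) (use b \<phi>L j w in \<open>auto simp: wandering_def\<close>)
      have all: "(LINT t|circ. cis (of_int k * t) * ?u j j' t) = 2 * pi * (if k = 0 then ?d else 0)" for k :: int
      proof (cases "0 \<le> k")
        case True
        then show ?thesis using nonneg[OF j, of "nat k"] by simp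
      next
        case False
        then have k: "of_int k = - real (nat (- k))" by simp
        have "cis (of_int k * t) * ?u j j' t = cnj (cis (real (nat (- k)) * t) * ?u j' j t)" for t
          unfolding k by (simp add: cis_cnj cnj_sum mult.commute)
        then have "(LINT t|circ. cis (of_int k * t) * ?u j j' t) = cnj (LINT t|circ. cis (real (nat (- k)) * t) * ?u j' j t)"
          by (simp only: Bochner_Integration.integral_cnj)
        then show ?thesis unfolding nonneg[OF j(2,1)] using False by simp
      qed
      have iu: "integrable circ (\<lambda>t. cis (x * t) * ?u j j' t)" for x
        unfolding sum_distrib_left mult.assoc[symmetric]
        by (intro Bochner_Integration.integrable_sum boundary_moment(2)[where C = 1 and D = 1]) (use b j in auto)
      show "(LINT t|circ. cis (of_int k * t) * (?u j j' t - ?d)) = 0" for k :: int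
      proof -
        have ic: "integrable circ (\<lambda>t. cis (of_int k * t) * ?d)"
          by (rule integrable_circ_bounded[where C = 1]) (auto simp: norm_mult)
        have "(LINT t|circ. cis (of_int k * t) * (?u j j' t - ?d)) = (LINT t|circ. cis (of_int k * t) * ?u j j' t) - (LINT t|circ. cis (of_int k * t) * ?d)"
          unfolding right_diff_distrib by (rule Bochner_Integration.integral_diff[OF iu ic])
        also have "(LINT t|circ. cis (of_int k * t) * ?d) = (LINT t|circ. cis (of_int k * t)) * ?d" by simp
        finally show ?thesis unfolding all integral_cis_circ by simp
      qed
    qed
    have "AE t in circ. \<forall>j\<in>{..<p}. \<forall>j'\<in>{..<p}. (\<Sum>i<n. bd (\<lambda>k. cf (\<phi> j) k i) t * cnj (bd (\<lambda>k. cf (\<phi> j') k i) t)) = (if j = j' then 1 else 0)"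
      by (intro AE_ball_countable[THEN iffD2] ballI gram1) auto
    moreover have "AE t in circ. \<forall>i\<in>{..<n}. \<forall>j\<in>{..<p}. ((\<lambda>r. pser (\<lambda>k. cf (\<phi> j) k i) (of_real r * cis t)) \<longlongrightarrow> bd (\<lambda>k. cf (\<phi> j) k i) t) (at_left 1)"
      by (intro AE_ball_countable[THEN iffD2] ballI AE_radial_limit bounded_h2.square_summable[OF b]) auto
    ultimately show ?thesis
    proof eventually_elim
      case (elim t)
      let ?A = "mat n p (\<lambda>(i, j). bd (\<lambda>k. cf (\<phi> j) k i) t)"
      have "isometry_mat n p ?A" unfolding isometry_mat_iff_orthonormal_cols using elim(1) by simp
      moreover have "((\<lambda>r. mat_of_columns p \<phi> (complex_of_real r * cis t) $$ (i, j)) \<longlongrightarrow> ?A $$ (i, j)) (at_left 1)" if ij: "i < n" "j < p" for i j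
      proof (rule Lim_transform_eventually)
        show "((\<lambda>r. pser (\<lambda>k. cf (\<phi> j) k i) (of_real r * cis t)) \<longlongrightarrow> ?A $$ (i, j)) (at_left 1)" using elim(2) ij by simp
        show "\<forall>\<^sub>F r in at_left 1. pser (\<lambda>k. cf (\<phi> j) k i) (of_real r * cis t) = mat_of_columns p \<phi> (complex_of_real r * cis t) $$ (i, j)"
          by (rule eventually_at_leftI[of 0]) (use ij in \<open>auto simp: mat_of_columns_def norm_mult\<close>)
      qed
      ultimately show ?case by blast
    qed
  qed
  ultimately show "inner_function n p (mat_of_columns p \<phi>)" unfolding inner_function_def by blast
qed

end

end

section \<open>Model spaces and the Beurling-Lax theorem\<close>

lemma summable_norm_sq_sum:
  fixes f :: "nat \<Rightarrow> nat \<Rightarrow> complex"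
  assumes "\<And>j. j < p \<Longrightarrow> summable (\<lambda>k. (cmod (f j k))\<^sup>2)"
  shows "summable (\<lambda>k. (cmod (\<Sum>j<p. f j k))\<^sup>2)"
    "(\<Sum>k. (cmod (\<Sum>j<p. f j k))\<^sup>2) \<le> real p * (\<Sum>j<p. \<Sum>k. (cmod (f j k))\<^sup>2)"
proof -
  have le: "(cmod (\<Sum>j<p. f j k))\<^sup>2 \<le> real p * (\<Sum>j<p. (cmod (f j k))\<^sup>2)" for k
  proof -
    have "(cmod (\<Sum>j<p. f j k))\<^sup>2 \<le> (\<Sum>j<p. cmod (f j k))\<^sup>2" by (intro power_mono norm_sum) auto
    also have "\<dots> \<le> real p * (\<Sum>j<p. (cmod (f j k))\<^sup>2)"
      using sum_squared_le_sum_of_squares[of "\<lambda>j. cmod (f j k)" "{..<p}"] by (simp only: card_lessThan mult.commute)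
    finally show ?thesis .
  qed
  have s: "(\<lambda>k. real p * (\<Sum>j<p. (cmod (f j k))\<^sup>2)) sums (real p * (\<Sum>j<p. \<Sum>k. (cmod (f j k))\<^sup>2))"
    by (intro sums_mult sums_sum summable_sums assms) auto
  show s': "summable (\<lambda>k. (cmod (\<Sum>j<p. f j k))\<^sup>2)"
    by (rule summable_comparison_test'[OF sums_summable[OF s], of 0]) (use le in auto)
  show "(\<Sum>k. (cmod (\<Sum>j<p. f j k))\<^sup>2) \<le> real p * (\<Sum>j<p. \<Sum>k. (cmod (f j k))\<^sup>2)"
    by (rule sums_le[OF le summable_sums[OF s'] s])
qed

lemma (in bounded_h2) conv_square_summable:
  assumes y: "summable (\<lambda>k. (cmod (\<gamma> k))\<^sup>2)"
  shows "summable (\<lambda>k. (cmod (conv a \<gamma> k))\<^sup>2)"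
    "(\<Sum>k. (cmod (conv a \<gamma> k))\<^sup>2) \<le> C\<^sup>2 * (\<Sum>k. (cmod (\<gamma> k))\<^sup>2)"
proof -
  have le: "(\<Sum>k\<le>N. (cmod (conv a \<gamma> k))\<^sup>2) \<le> C\<^sup>2 * (\<Sum>k. (cmod (\<gamma> k))\<^sup>2)" for N
  proof -
    have "(\<Sum>k\<le>N. (cmod (conv a \<gamma> k))\<^sup>2) \<le> C\<^sup>2 * (\<Sum>k\<le>N. (cmod (\<gamma> k))\<^sup>2)"
      unfolding conv_def by (rule toeplitz_bound[OF bounded_coeffs bounded])
    also have "\<dots> \<le> C\<^sup>2 * (\<Sum>k. (cmod (\<gamma> k))\<^sup>2)"
      by (intro mult_left_mono sum_le_suminf y) auto
    finally show ?thesis .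
  qed
  show s: "summable (\<lambda>k. (cmod (conv a \<gamma> k))\<^sup>2)"
    by (rule bounded_imp_summable[OF _ le]) simp
  show "(\<Sum>k. (cmod (conv a \<gamma> k))\<^sup>2) \<le> C\<^sup>2 * (\<Sum>k. (cmod (\<gamma> k))\<^sup>2)"
  proof (rule suminf_le_const[OF s])
    fix N show "(\<Sum>k<N. (cmod (conv a \<gamma> k))\<^sup>2) \<le> C\<^sup>2 * (\<Sum>k. (cmod (\<gamma> k))\<^sup>2)"
      by (rule order_trans[OF sum_mono2 le[of N]]) auto
  qed
qed

lemma conv_add_right: "conv a (\<lambda>k. b k + c k) n = conv a b n + conv a c n"
  unfolding conv_def by (simp add: distrib_left sum.distrib)

lemma conv_scale_right: "conv a (\<lambda>k. c * b k) n = c * conv a b n"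
  unfolding conv_def by (simp add: sum_distrib_left mult_ac)

lemma conv_diff_left: "conv (\<lambda>k. a k - b k) c n = conv a c n - conv b c n"
  unfolding conv_def by (simp add: left_diff_distrib sum_subtractf)

lemma conv_delta_right: "conv a (\<lambda>k. if k = q then c else 0) n = (if n < q then 0 else a (n - q) * c)"
proof -
  have "conv a (\<lambda>k. if k = q then c else 0) n = (\<Sum>s\<le>n. if s = n - q \<and> q \<le> n then a (n - q) * c else 0)"
    unfolding conv_def by (intro sum.cong) auto
  also have "\<dots> = (if n < q then 0 else a (n - q) * c)"
    by (cases "q \<le> n") auto
  finally show ?thesis .
qed

context pure_shift
begin

lemma card_independent_le:
  fixes v :: "nat \<Rightarrow> 'a" and p n :: nat
  assumes v: "\<And>i. i < p \<Longrightarrow> v i \<in> cspan (e ` {..<n})"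
    and indep: "\<And>a i. (\<Sum>i<p. a i *\<^sub>C v i) = 0 \<Longrightarrow> i < p \<Longrightarrow> a i = 0"
  shows "p \<le> n"
proof -
  have inj: "inj_on v {..<p}"
  proof (rule inj_onI, rule ccontr)
    fix i j assume ij: "i \<in> {..<p}" "j \<in> {..<p}" "v i = v j" "i \<noteq> j"
    have "(\<Sum>k<p. (if k = i then 1 else if k = j then - 1 else 0) *\<^sub>C v k) = (\<Sum>k\<in>{i, j}. (if k = i then 1 else if k = j then - 1 else 0) *\<^sub>C v k)"
      by (rule sum.mono_neutral_right) (use ij in auto)
    also have "\<dots> = 0" using ij by simp
    finally show False using indep[of "\<lambda>k. if k = i then 1 else if k = j then - 1 else 0" i] ij by simp
  qed
  have "complex_vector.independent (v ` {..<p})"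
  proof (rule complex_vector.independent_if_scalars_zero)
    fix f x assume "(\<Sum>x\<in>v ` {..<p}. f x *\<^sub>C x) = 0" "x \<in> v ` {..<p}"
    then show "f x = 0" using indep[of "\<lambda>i. f (v i)"] by (auto simp: sum.reindex[OF inj])
  qed simp
  then have "card (v ` {..<p}) \<le> card (e ` {..<n})"
    using complex_vector.independent_span_bound[of "e ` {..<n}" "v ` {..<p}"] v by auto
  also have "\<dots> \<le> n" using card_image_le[of "{..<n}" e] by simp
  finally show ?thesis using card_image[OF inj] by simp
qed

context
  fixes n :: nat
  assumes n: "n \<le> m"
begin

text \<open>\<open>F\<close> is multiplication by the matrix with columns \<open>\<phi> j\<close>,
  transported to the given space; the Toeplitz estimate bounds it. The value of \<open>K\<close> is
  crude, a Cauchy-Schwarz factor over the columns included, since boundedness is all that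
  matters.\<close>

lemma mult_operator:
  assumes p: "p \<le> m" and b: "\<And>i j. i < n \<Longrightarrow> j < p \<Longrightarrow> bounded_h2 (\<lambda>k. cf (\<phi> j) k i) C"
  obtains F K where "\<And>u. F u \<in> L n"
    "\<And>u k i. i < n \<Longrightarrow> cf (F u) k i = (\<Sum>j<p. conv (\<lambda>s. cf (\<phi> j) s i) (\<lambda>s. cf u s j) k)"
    "\<And>u. (norm (F u))\<^sup>2 \<le> K * (norm u)\<^sup>2"
proof -
  define a where "a u k i = (if i < n then (\<Sum>j<p. conv (\<lambda>s. cf (\<phi> j) s i) (\<lambda>s. cf u s j) k) else 0)" for u k i
  have u_le: "(\<Sum>k. (cmod (cf u k j))\<^sup>2) \<le> (norm u)\<^sup>2" if "j < p" for u j
  proof -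
    have "(\<Sum>k. (cmod (cf u k j))\<^sup>2) \<le> (\<Sum>k. \<Sum>j<m. (cmod (cf u k j))\<^sup>2)"
      using that p by (intro suminf_le cf_square_summable sums_summable[OF parseval] member_le_sum) auto
    also have "\<dots> = (norm u)\<^sup>2" by (rule sums_unique[OF parseval, symmetric])
    finally show ?thesis .
  qed
  have sconv: "summable (\<lambda>k. (cmod (conv (\<lambda>s. cf (\<phi> j) s i) (\<lambda>s. cf u s j) k))\<^sup>2)" if "i < n" "j < p" for i j u
    by (rule bounded_h2.conv_square_summable(1)[OF b[OF that] cf_square_summable]) (use that p in auto)
  have conv_le: "(\<Sum>k. (cmod (conv (\<lambda>s. cf (\<phi> j) s i) (\<lambda>s. cf u s j) k))\<^sup>2) \<le> C\<^sup>2 * (norm u)\<^sup>2" if "i < n" "j < p" for i j u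
  proof -
    have "(\<Sum>k. (cmod (conv (\<lambda>s. cf (\<phi> j) s i) (\<lambda>s. cf u s j) k))\<^sup>2) \<le> C\<^sup>2 * (\<Sum>k. (cmod (cf u k j))\<^sup>2)"
      by (rule bounded_h2.conv_square_summable(2)[OF b[OF that] cf_square_summable]) (use that p in auto)
    also have "\<dots> \<le> C\<^sup>2 * (norm u)\<^sup>2" by (intro mult_left_mono u_le that) auto
    finally show ?thesis .
  qed
  have sa: "summable (\<lambda>k. (cmod (a u k i))\<^sup>2)" for u i
    unfolding a_def by (cases "i < n") (auto intro: summable_norm_sq_sum(1) sconv)
  have "\<exists>x. \<forall>k i. i < m \<longrightarrow> cf x k i = a u k i" for u
    by (rule riesz_fischer[of "a u", OF sa]) blast
  then obtain F where F: "\<And>u k i. i < m \<Longrightarrow> cf (F u) k i = a u k i" by metis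
  show thesis
  proof (rule that[of F "real n * (real p * (real p * C\<^sup>2))"])
    show "F u \<in> L n" for u unfolding L_def using F by (auto simp: a_def)
    show "cf (F u) k i = (\<Sum>j<p. conv (\<lambda>s. cf (\<phi> j) s i) (\<lambda>s. cf u s j) k)" if "i < n" for u k i
      using F[of i u k] that n by (simp add: a_def)
    show "(norm (F u))\<^sup>2 \<le> real n * (real p * (real p * C\<^sup>2)) * (norm u)\<^sup>2" for u
    proof -
      have "(norm (F u))\<^sup>2 = (\<Sum>k. \<Sum>i<m. (cmod (cf (F u) k i))\<^sup>2)" by (rule sums_unique[OF parseval])
      also have "\<dots> = (\<Sum>k. \<Sum>i<n. (cmod (a u k i))\<^sup>2)"
      proof (rule suminf_cong)
        show "(\<Sum>i<m. (cmod (cf (F u) k i))\<^sup>2) = (\<Sum>i<n. (cmod (a u k i))\<^sup>2)" for k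
          by (rule sum.mono_neutral_cong_right) (use n F in \<open>auto simp: a_def\<close>)
      qed
      also have "\<dots> = (\<Sum>i<n. \<Sum>k. (cmod (a u k i))\<^sup>2)" by (rule suminf_sum) (rule sa)
      also have "\<dots> \<le> (\<Sum>i<n. real p * (\<Sum>j<p. C\<^sup>2 * (norm u)\<^sup>2))"
      proof (rule sum_mono)
        fix i assume "i \<in> {..<n}"
        then have i: "i < n" by simp
        have "(\<Sum>k. (cmod (a u k i))\<^sup>2) \<le> real p * (\<Sum>j<p. \<Sum>k. (cmod (conv (\<lambda>s. cf (\<phi> j) s i) (\<lambda>s. cf u s j) k))\<^sup>2)"
          using summable_norm_sq_sum(2)[of p "\<lambda>j. conv (\<lambda>s. cf (\<phi> j) s i) (\<lambda>s. cf u s j)", OF sconv[OF i]] i by (simp add: a_def)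
        also have "\<dots> \<le> real p * (\<Sum>j<p. C\<^sup>2 * (norm u)\<^sup>2)"
          by (intro mult_left_mono sum_mono conv_le i) auto
        finally show "(\<Sum>k. (cmod (a u k i))\<^sup>2) \<le> real p * (\<Sum>j<p. C\<^sup>2 * (norm u)\<^sup>2)" .
      qed
      finally show ?thesis by (simp add: mult_ac)
    qed
  qed
qed

text \<open>The subtracted space is the image of \<open>L p\<close> under the multiplication
  operator \<open>F\<close>, and \<open>F\<close> maps \<open>(T ^^ k) (e j)\<close> to
  \<open>(T ^^ k) (\<phi> j)\<close>. As \<open>F\<close> is bounded, orthogonality may be tested on
  these vectors alone.\<close>

lemma model_space_iff:
  assumes \<Phi>: "\<Phi> \<in> Hinf n p" and p: "p \<le> m" and c: "columns n p \<Phi> \<phi>"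
    and b: "\<And>i j. i < n \<Longrightarrow> j < p \<Longrightarrow> bounded_h2 (\<lambda>k. cf (\<phi> j) k i) C"
    and y: "y \<in> L n"
  shows "fn n y \<in> model_space n p \<Phi> \<longleftrightarrow> (\<forall>k. \<forall>j<p. cinner y ((T ^^ k) (\<phi> j)) = 0)"
proof -
  obtain F K where F: "\<And>u. F u \<in> L n"
    "\<And>u k i. i < n \<Longrightarrow> cf (F u) k i = (\<Sum>j<p. conv (\<lambda>s. cf (\<phi> j) s i) (\<lambda>s. cf u s j) k)"
    "\<And>u. (norm (F u))\<^sup>2 \<le> K * (norm u)\<^sup>2"
    by (rule mult_operator[where \<phi> = \<phi> and C = C, OF p b], assumption, assumption) (rule that, blast, blast, blast)
  have cfF: "cf (F u) k i = (if i < n then (\<Sum>j<p. conv (\<lambda>s. cf (\<phi> j) s i) (\<lambda>s. cf u s j) k) else 0)" if "i < m" for u k i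
    using F(1)[of u] F(2)[of i u k] that by (auto simp: L_def)
  have F_add: "F (u + v) = F u + F v" for u v
    by (rule cf_eqI) (simp add: cfF cf_add conv_add_right sum.distrib)
  have F_scale: "F (a *\<^sub>C u) = a *\<^sub>C F u" for a u
    by (rule cf_eqI) (simp add: cfF cf_scale conv_scale_right sum_distrib_left)
  have F0: "F 0 = 0" using F_scale[of 0 0] by simp
  have F_sum: "F (\<Sum>i\<in>A. f i) = (\<Sum>i\<in>A. F (f i))" for f and A :: "nat set"
    by (induction A rule: infinite_finite_induct) (auto simp: F0 F_add)
  have F_basis: "F ((T ^^ q) (e j)) = (T ^^ q) (\<phi> j)" if j: "j < p" for q j
  proof (rule cf_eqI)
    fix k i assume i: "i < m"
    have "(\<Sum>j'<p. conv (\<lambda>s. cf (\<phi> j') s i) (\<lambda>s. cf ((T ^^ q) (e j)) s j') k) = (\<Sum>j'<p. if j' = j then (if k < q then 0 else cf (\<phi> j) (k - q) i) else 0)"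
    proof (intro sum.cong refl)
      fix j' assume j': "j' \<in> {..<p}"
      have "(\<lambda>s. cf ((T ^^ q) (e j)) s j') = (\<lambda>s. if s = q then (if j' = j then 1 else 0) else 0)"
        using cf_basis[of j j' q] j j' p by auto
      then show "conv (\<lambda>s. cf (\<phi> j') s i) (\<lambda>s. cf ((T ^^ q) (e j)) s j') k = (if j' = j then (if k < q then 0 else cf (\<phi> j) (k - q) i) else 0)"
        by (simp add: conv_delta_right)
    qed
    also have "\<dots> = (if k < q then 0 else cf (\<phi> j) (k - q) i)" using j by simp
    finally have "cf (F ((T ^^ q) (e j))) k i = (if i < n then (if k < q then 0 else cf (\<phi> j) (k - q) i) else 0)"
      by (simp add: cfF[OF i])
    moreover have "\<phi> j \<in> L n" using c j unfolding columns_def by blast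
    ultimately show "cf (F ((T ^^ q) (e j))) k i = cf ((T ^^ q) (\<phi> j)) k i"
      using i unfolding cf_T_pow[OF i] L_def by auto
  qed
  have fnF: "(\<lambda>z. \<Phi> z *\<^sub>v fn p u z) = fn n (F u)" for u
  proof
    fix z
    have car: "\<Phi> z \<in> carrier_mat n p" using \<Phi> unfolding Hinf_def by blast
    show "\<Phi> z *\<^sub>v fn p u z = fn n (F u) z"
    proof (cases "z \<in> ball 0 1")
      case True
      show ?thesis
      proof (rule eq_vecI)
        fix i assume "i < dim_vec (fn n (F u) z)"
        then have i: "i < n" using n by simp
        have "(\<Phi> z *\<^sub>v fn p u z) $ i = (\<Sum>j<p. \<Phi> z $$ (i, j) * fn p u z $ j)"
          using car i p by (simp add: scalar_prod_def lessThan_atLeast0)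
        also have "\<dots> = (\<Sum>j<p. pser (\<lambda>k. cf (\<phi> j) k i) z * pser (\<lambda>k. cf u k j) z)"
          using c True i p unfolding columns_def by (intro sum.cong) (auto simp: fn_nth)
        finally have l: "(\<Phi> z *\<^sub>v fn p u z) $ i = (\<Sum>j<p. pser (\<lambda>k. cf (\<phi> j) k i) z * pser (\<lambda>k. cf u k j) z)" .
        have "(\<lambda>k. \<Sum>j<p. conv (\<lambda>s. cf (\<phi> j) s i) (\<lambda>s. cf u s j) k * z ^ k) sums (\<Sum>j<p. pser (\<lambda>k. cf (\<phi> j) k i) z * pser (\<lambda>k. cf u k j) z)"
          using True i n p by (intro sums_sum conv_sums cf_bounded) auto
        then have "pser (\<lambda>k. cf (F u) k i) z = (\<Sum>j<p. pser (\<lambda>k. cf (\<phi> j) k i) z * pser (\<lambda>k. cf u k j) z)"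
          unfolding pser_def F(2)[OF i] sum_distrib_right by (simp add: sums_iff)
        then show "(\<Phi> z *\<^sub>v fn p u z) $ i = fn n (F u) z $ i"
          unfolding l using True i n by (simp add: fn_nth)
      qed (use car n in simp)
    next
      case False
      have "\<Phi> z = 0\<^sub>m n p" using \<Phi> False unfolding Hinf_def by blast
      then show ?thesis using False n p by (auto simp: fn_outside intro!: eq_vecI)
    qed
  qed
  have mem: "fn n y \<in> model_space n p \<Phi> \<longleftrightarrow> (\<forall>u\<in>L p. cinner y (F u) = 0)"
  proof -
    have "(\<forall>k\<in>H2 p. H2_inner n (fn n y) (\<lambda>z. \<Phi> z *\<^sub>v k z) = 0) \<longleftrightarrow> (\<forall>u\<in>L p. H2_inner n (fn n y) (\<lambda>z. \<Phi> z *\<^sub>v fn p u z) = 0)"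
      using fn_surj[OF p] fn_H2[OF p] by metis
    then show ?thesis unfolding model_space_def using fn_H2[OF n, of y]
      by (simp add: fnF fn_inner(2)[OF n y])
  qed
  show ?thesis
  proof
    assume *: "fn n y \<in> model_space n p \<Phi>"
    show "\<forall>k. \<forall>j<p. cinner y ((T ^^ k) (\<phi> j)) = 0"
    proof (intro allI impI)
      fix k j assume j: "j < p"
      have "(T ^^ k) (e j) \<in> L p" unfolding L_def using cf_basis[of j _ k] j p by auto
      then show "cinner y ((T ^^ k) (\<phi> j)) = 0" using * mem F_basis[OF j] by metis
    qed
  next
    assume R: "\<forall>k. \<forall>j<p. cinner y ((T ^^ k) (\<phi> j)) = 0"
    have "cinner y (F u) = 0" if u: "u \<in> L p" for u
    proof -
      have le: "(cmod (cinner y (F u)))\<^sup>2 \<le> (norm y)\<^sup>2 * (K * (norm ((B ^^ N) u))\<^sup>2)" for N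
      proof -
        let ?r = "(T ^^ N) ((B ^^ N) u)"
        have "(\<Sum>j<m. cf u k j *\<^sub>C (T ^^ k) (e j)) = (\<Sum>j<p. cf u k j *\<^sub>C (T ^^ k) (e j))" for k
          by (rule sum.mono_neutral_right) (use u p in \<open>auto simp: L_def\<close>)
        then have "u = (\<Sum>k<N. \<Sum>j<p. cf u k j *\<^sub>C (T ^^ k) (e j)) + ?r" using expansion[of u N] by simp
        then have "F u = F ((\<Sum>k<N. \<Sum>j<p. cf u k j *\<^sub>C (T ^^ k) (e j)) + ?r)" by simp
        also have "\<dots> = (\<Sum>k<N. \<Sum>j<p. cf u k j *\<^sub>C (T ^^ k) (\<phi> j)) + F ?r"
          unfolding F_add F_sum F_scale by (simp add: F_basis)
        \<comment> \<open>The finite part of the expansion is annihilated by \<open>R\<close>; what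
          is left is the remainder, whose norm tends to 0.\<close>
        finally have "cinner y (F u) = cinner y (F ?r)"
          using R by (simp add: cinner_add_right cinner_sum_right cinner_scaleC_right)
        then have "cmod (cinner y (F u)) \<le> norm y * norm (F ?r)" using norm_cinner_le by metis
        then have "(cmod (cinner y (F u)))\<^sup>2 \<le> (norm y * norm (F ?r))\<^sup>2" by (intro power_mono) auto
        also have "\<dots> \<le> (norm y)\<^sup>2 * (K * (norm ?r)\<^sup>2)"
          unfolding power_mult_distrib by (intro mult_left_mono F(3)) auto
        finally show ?thesis by (simp add: T_pow_norm)
      qed
      have "(\<lambda>N. (norm y)\<^sup>2 * (K * (norm ((B ^^ N) u))\<^sup>2)) \<longlonglongrightarrow> (norm y)\<^sup>2 * (K * 0\<^sup>2)"
        by (intro tendsto_intros B_pow_tendsto)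
      then have "(cmod (cinner y (F u)))\<^sup>2 \<le> (norm y)\<^sup>2 * (K * 0\<^sup>2)"
        by (rule LIMSEQ_le_const) (use le in blast)
      then show ?thesis by simp
    qed
    then show "fn n y \<in> model_space n p \<Phi>" using mem by blast
  qed
qed

text \<open>The circle has positive measure, so at least one isometric boundary value exists. Its
  columns yield \<open>p\<close> orthonormal vectors in the span of \<open>n\<close> of the
  \<open>e i\<close>.\<close>

lemma inner_function_dim_le:
  assumes "inner_function n p \<Phi>"
  shows "p \<le> n"
proof -
  have "\<exists>A. isometry_mat n p A"
  proof (rule ccontr)
    assume no: "\<nexists>A. isometry_mat n p A"
    have "AE t in circ. \<exists>A. isometry_mat n p A"
      using assms unfolding inner_function_def by (auto elim: eventually_mono)
    with no have "AE t in circ. False" by simp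
    then have "(LINT x|circ. (1::real)) = (LINT x|circ. 0)"
      by (intro integral_cong_AE) (auto elim: eventually_mono)
    then show False using measure_circ by simp
  qed
  then obtain A where A: "\<And>j j'. j < p \<Longrightarrow> j' < p \<Longrightarrow> (\<Sum>i<n. A $$ (i, j) * cnj (A $$ (i, j'))) = (if j = j' then 1 else 0)"
    unfolding isometry_mat_iff_orthonormal_cols by auto
  define v where "v j = (\<Sum>i<n. A $$ (i, j) *\<^sub>C e i)" for j
  have vv: "cinner (v j) (v j') = (if j = j' then 1 else 0)" if "j < p" "j' < p" for j j'
  proof -
    have "cinner (e i) (v j') = cnj (A $$ (i, j'))" if i: "i < n" for i j'
    proof -
      have "cinner (e i) (v j') = (\<Sum>i'<n. if i' = i then cnj (A $$ (i, j')) else 0)"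
        unfolding v_def cinner_sum_right cinner_scaleC_right by (intro sum.cong) (use e_ortho i n in auto)
      then show ?thesis using i by simp
    qed
    then have "cinner (v j) (v j') = (\<Sum>i<n. A $$ (i, j) * cnj (A $$ (i, j')))"
      unfolding v_def[of j] by (simp add: cinner_sum_left cinner_scaleC_left)
    then show ?thesis using A that by simp
  qed
  show ?thesis
  proof (rule card_independent_le[of p v])
    show "v i \<in> cspan (e ` {..<n})" for i
      unfolding v_def by (intro complex_vector.span_sum complex_vector.span_scale complex_vector.span_base) auto
    fix a i assume z: "(\<Sum>i<p. a i *\<^sub>C v i) = 0" and i: "i < p"
    have "0 = cinner (\<Sum>i<p. a i *\<^sub>C v i) (v i)" unfolding z by simp
    also have "\<dots> = (\<Sum>j<p. if j = i then a i else 0)"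
      unfolding cinner_sum_left cinner_scaleC_left by (intro sum.cong) (use vv i in auto)
    finally show "a i = 0" using i by simp
  qed
qed

text \<open>The Beurling-Lax theorem, stated for the orthogonal complement \<open>S\<close> of the shift invariant subspace.\<close>
lemma beurling_lax:
  assumes S: "csubspace S" "closed S" "S \<subseteq> L n" "\<And>s. s \<in> S \<Longrightarrow> B s \<in> S"
  obtains p \<phi> where "p \<le> n" "wandering p \<phi>" "\<And>j. j < p \<Longrightarrow> \<phi> j \<in> L n"
    "\<And>y. y \<in> L n \<Longrightarrow> (\<forall>k. \<forall>j<p. cinner y ((T ^^ k) (\<phi> j)) = 0) \<longleftrightarrow> y \<in> S"
proof -
  define N where "N = {x \<in> L n. \<forall>s\<in>S. cinner x s = 0}"
  have N_sub: "csubspace N"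
    unfolding N_def complex_vector.subspace_def
    using complex_vector.subspace_0[OF L_subspace] complex_vector.subspace_add[OF L_subspace] complex_vector.subspace_scale[OF L_subspace]
    by (auto simp: cinner_add_left cinner_scaleC_left)
  have N_closed: "closed N"
  proof -
    have "N = L n \<inter> (\<Inter>s\<in>S. {x. cinner x s = 0})" unfolding N_def by auto
    moreover have "closed {x. cinner x s = 0}" for s
      by (intro closed_Collect_eq continuous_intros bounded_linear.continuous_on[OF bounded_linear_cinner_left])
    ultimately show ?thesis by (simp only:) (intro closed_Int L_closed closed_INT ballI)
  qed
  have TN: "T x \<in> N" if "x \<in> N" for x
    using that S(4) T_L unfolding N_def by (auto simp: B_adjoint)
  have TN_pow: "(T ^^ k) x \<in> N" if "x \<in> N" for x k
    using that by (induction k) (auto intro: TN)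
  define W where "W = {w \<in> N. \<forall>x\<in>N. cinner w (T x) = 0}"
  have W_N: "w \<in> N" if "w \<in> W" for w using that unfolding W_def by simp
  have wand: "wandering p \<phi>" if \<phi>: "\<And>j. j < p \<Longrightarrow> \<phi> j \<in> W" "\<And>i j. i < p \<Longrightarrow> j < p \<Longrightarrow> cinner (\<phi> i) (\<phi> j) = (if i = j then 1 else 0)" for p :: nat and \<phi>
    unfolding wandering_def
  proof (intro allI impI)
    fix k i j assume ij: "i < p" "j < p"
    show "cinner ((T ^^ k) (\<phi> i)) (\<phi> j) = (if k = 0 \<and> i = j then 1 else 0)"
    proof (cases k)
      case (Suc q)
      have "cinner (\<phi> j) (T ((T ^^ q) (\<phi> i))) = 0"
        using \<phi>(1)[OF ij(2)] TN_pow[OF W_N[OF \<phi>(1)[OF ij(1)]]] unfolding W_def by blast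
      then show ?thesis using Suc cinner_eq_zero_commute by auto
    qed (use \<phi>(2)[OF ij] in simp)
  qed
  define good where "good p \<longleftrightarrow> (\<exists>\<phi>. (\<forall>j<p. \<phi> j \<in> W) \<and> (\<forall>i<p. \<forall>j<p. cinner (\<phi> i) (\<phi> j) = (if i = j then 1 else 0)))" for p :: nat
  \<comment> \<open>Orthonormal families in \<open>W\<close> are columns of inner functions with
    \<open>n\<close> rows, so they have at most \<open>n\<close> members. This bounds the dimension
    of \<open>W\<close>, and a family of greatest size exists.\<close>
  have good_le: "p \<le> n" if "good p" for p
  proof -
    obtain \<phi> where \<phi>: "\<And>j. j < p \<Longrightarrow> \<phi> j \<in> W" "\<And>i j. i < p \<Longrightarrow> j < p \<Longrightarrow> cinner (\<phi> i) (\<phi> j) = (if i = j then 1 else 0)"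
      using \<open>good p\<close> unfolding good_def by blast
    have "\<phi> j \<in> L n" if "j < p" for j using W_N[OF \<phi>(1)[OF that]] unfolding N_def by simp
    from inner_function_dim_le[OF wandering_imp_inner_function(1)[OF n wand[of p \<phi>, OF \<phi>] this]] show ?thesis by blast
  qed
  have "good 0" unfolding good_def by simp
  define p where "p = (GREATEST p. good p)"
  have gp: "good p" unfolding p_def using GreatestI_nat[of good 0 n] \<open>good 0\<close> good_le by blast
  have gmax: "q \<le> p" if "good q" for q unfolding p_def using Greatest_le_nat[of good q n] that good_le by blast
  obtain \<phi> where \<phi>: "\<And>j. j < p \<Longrightarrow> \<phi> j \<in> W" "\<And>i j. i < p \<Longrightarrow> j < p \<Longrightarrow> cinner (\<phi> i) (\<phi> j) = (if i = j then 1 else 0)"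
    using gp unfolding good_def by blast
  have complete: "w = 0" if w: "w \<in> W" "\<And>j. j < p \<Longrightarrow> cinner w (\<phi> j) = 0" for w
  proof (rule ccontr)
    assume "w \<noteq> 0"
    define w' where "w' = (1 / complex_of_real (norm w)) *\<^sub>C w"
    have w'W: "w' \<in> W" using w(1) complex_vector.subspace_scale[OF N_sub] unfolding w'_def W_def by (auto simp: cinner_scaleC_left)
    have "cinner w' w' = of_real ((norm w')\<^sup>2)" by (rule cinner_self)
    also have "norm w' = 1" using \<open>w \<noteq> 0\<close> by (simp add: w'_def norm_scaleC norm_divide)
    finally have w'1: "cinner w' w' = 1" by simp
    have w'0: "cinner w' (\<phi> j) = 0" "cinner (\<phi> j) w' = 0" if "j < p" for j
      using w(2)[OF that] cinner_eq_zero_commute by (auto simp: w'_def cinner_scaleC_left cinner_scaleC_right)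
    have "good (Suc p)"
      unfolding good_def using \<phi> w'W w'1 w'0
      by (intro exI[of _ "\<lambda>j. if j = p then w' else \<phi> j"]) (auto simp: less_Suc_eq)
    from gmax[OF this] show False by simp
  qed
  \<comment> \<open>The part of \<open>z\<close> orthogonal to \<open>T N\<close> lies in
    \<open>W\<close> and is orthogonal to all \<open>\<phi> j\<close>, hence it is 0 by maximality.
    So \<open>z\<close> can be divided by \<open>T\<close> within \<open>N\<close>, and the quotient
    inherits the hypotheses.\<close>
  have step: "z = T (B z) \<and> B z \<in> N \<and> (\<forall>k. \<forall>j<p. cinner (B z) ((T ^^ k) (\<phi> j)) = 0)"
    if z: "z \<in> N" "\<And>k j. j < p \<Longrightarrow> cinner z ((T ^^ k) (\<phi> j)) = 0" for z
  proof -
    obtain t where t: "t \<in> T ` N" "\<And>u. u \<in> T ` N \<Longrightarrow> cinner (z - t) u = 0"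
      using projection_exists[OF T_subspace[OF N_sub] T_closed[OF N_closed], of z] by blast
    then obtain z' where z': "z' \<in> N" "t = T z'" by blast
    have "z - t \<in> W" unfolding W_def using z'(1) z(1) t(2) TN[OF z'(1)] z'(2) complex_vector.subspace_diff[OF N_sub] by auto
    moreover have "cinner (z - t) (\<phi> j) = 0" if "j < p" for j
    proof -
      have "cinner (\<phi> j) (T z') = 0" using \<phi>(1)[OF that] z'(1) unfolding W_def by blast
      then have "cinner (T z') (\<phi> j) = 0" using cinner_eq_zero_commute by blast
      then show ?thesis using z(2)[OF that, of 0] by (simp add: cinner_diff_left z'(2))
    qed
    ultimately have "z - t = 0" by (rule complete)
    then have zt: "z = T z'" using z'(2) by simp
    then have Bz: "B z = z'" by (simp add: B_T)
    have "cinner z' ((T ^^ k) (\<phi> j)) = 0" if "j < p" for k j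
      using z(2)[OF that, of "Suc k"] unfolding zt by (simp add: T_cinner)
    then show ?thesis using zt Bz z'(1) by simp
  qed
  \<comment> \<open>Repeated division by \<open>T\<close> preserves the norm, whereas the powers of
    \<open>B\<close> tend strongly to 0.\<close>
  have zero: "z = 0" if z: "z \<in> N" "\<And>k j. j < p \<Longrightarrow> cinner z ((T ^^ k) (\<phi> j)) = 0" for z
  proof -
    have "(B ^^ k) z \<in> N \<and> (\<forall>q. \<forall>j<p. cinner ((B ^^ k) z) ((T ^^ q) (\<phi> j)) = 0) \<and> norm ((B ^^ k) z) = norm z" for k
    proof (induction k)
      case (Suc k)
      then have s: "(B ^^ k) z = T (B ((B ^^ k) z)) \<and> B ((B ^^ k) z) \<in> N \<and> (\<forall>q. \<forall>j<p. cinner (B ((B ^^ k) z)) ((T ^^ q) (\<phi> j)) = 0)"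
        by (intro step) blast+
      then have "norm ((B ^^ k) z) = norm (B ((B ^^ k) z))" using T_norm by metis
      then show ?case using s Suc by simp
    qed (use z in simp)
    then have "(\<lambda>k. norm z) \<longlonglongrightarrow> 0" using B_pow_tendsto[of z] by simp
    then show ?thesis by (simp add: LIMSEQ_const_iff)
  qed
  show thesis
  proof (rule that[of p \<phi>])
    show "p \<le> n" by (rule good_le[OF gp])
    show "wandering p \<phi>" by (rule wand[OF \<phi>])
    show "\<phi> j \<in> L n" if "j < p" for j using W_N[OF \<phi>(1)[OF that]] unfolding N_def by simp
    show "(\<forall>k. \<forall>j<p. cinner y ((T ^^ k) (\<phi> j)) = 0) \<longleftrightarrow> y \<in> S" if y: "y \<in> L n" for y
    proof
      assume "y \<in> S"
      then show "\<forall>k. \<forall>j<p. cinner y ((T ^^ k) (\<phi> j)) = 0"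
        using TN_pow[OF W_N[OF \<phi>(1)]] cinner_eq_zero_commute unfolding N_def by blast
    next
      assume R: "\<forall>k. \<forall>j<p. cinner y ((T ^^ k) (\<phi> j)) = 0"
      obtain s where s: "s \<in> S" "\<And>u. u \<in> S \<Longrightarrow> cinner (y - s) u = 0"
        using projection_exists[OF S(1,2), of y] by blast
      have "y - s \<in> N" unfolding N_def using s S(3) y complex_vector.subspace_diff[OF L_subspace] by auto
      moreover have "cinner (y - s) ((T ^^ k) (\<phi> j)) = 0" if "j < p" for k j
      proof -
        have "cinner ((T ^^ k) (\<phi> j)) s = 0" using TN_pow[OF W_N[OF \<phi>(1)[OF that]]] s(1) unfolding N_def by blast
        then have "cinner s ((T ^^ k) (\<phi> j)) = 0" using cinner_eq_zero_commute by blast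
        then show ?thesis using R that by (simp add: cinner_diff_left)
      qed
      ultimately have "y - s = 0" by (rule zero)
      then show "y \<in> S" using s(1) by simp
    qed
  qed
qed

end

end

section \<open>Nearly invariant subspaces\<close>

context pure_shift
begin

text \<open>Both families are bases of \<open>N \<ominus> T N\<close>, where \<open>N\<close> is the shift invariant subspace that they generate.\<close>
lemma wandering_expand:
  assumes \<phi>: "wandering p \<phi>" "\<And>i. i < p \<Longrightarrow> \<phi> i \<in> L n" and \<psi>: "wandering q \<psi>" "\<And>j. j < q \<Longrightarrow> \<psi> j \<in> L n"
    and \<phi>S: "\<And>y. y \<in> L n \<Longrightarrow> (\<forall>k. \<forall>j<p. cinner y ((T ^^ k) (\<phi> j)) = 0) \<longleftrightarrow> y \<in> S"
    and \<psi>S: "\<And>y. y \<in> L n \<Longrightarrow> (\<forall>k. \<forall>j<q. cinner y ((T ^^ k) (\<psi> j)) = 0) \<longleftrightarrow> y \<in> S"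
    and SL: "S \<subseteq> L n" and j: "j < q"
  shows "\<psi> j = (\<Sum>i<p. cinner (\<psi> j) (\<phi> i) *\<^sub>C \<phi> i)"
proof -
  define d where "d = \<psi> j - (\<Sum>i<p. cinner (\<psi> j) (\<phi> i) *\<^sub>C \<phi> i)"
  have dL: "d \<in> L n"
    unfolding d_def
    by (intro complex_vector.subspace_diff complex_vector.subspace_sum complex_vector.subspace_scale L_subspace \<phi>(2) \<psi>(2) j) auto
  \<comment> \<open>\<open>B\<close> moves to the other side as one more power of \<open>T\<close>,
    where the wandering property of \<open>\<psi>\<close> applies. Read through the family
    \<open>\<phi>\<close>, this makes \<open>\<psi> j\<close> orthogonal to all positive translates
    of the \<open>\<phi> i\<close>.\<close>
  have BS: "B (\<psi> j) \<in> S"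
  proof -
    have "cinner (B (\<psi> j)) ((T ^^ k) (\<psi> i)) = 0" if "i < q" for k i
      using wandering_ortho[OF \<psi>(1) j that, of 0 "Suc k"] by (simp add: B_adjoint')
    then show ?thesis using \<psi>S[OF B_L[OF \<psi>(2)[OF j]]] by blast
  qed
  have ortho: "cinner (\<phi> i) ((T ^^ k) (\<phi> i')) = (if k = 0 \<and> i = i' then 1 else 0)" if "i < p" "i' < p" for i i' k
    using wandering_ortho[OF \<phi>(1) that, of 0 k] by simp
  have "cinner d ((T ^^ k) (\<phi> i')) = 0" if i': "i' < p" for k i'
  proof -
    have "(\<Sum>i<p. cinner (\<psi> j) (\<phi> i) * cinner (\<phi> i) ((T ^^ k) (\<phi> i'))) = (\<Sum>i<p. if i = i' then (if k = 0 then cinner (\<psi> j) (\<phi> i') else 0) else 0)"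
      by (intro sum.cong) (use ortho i' in auto)
    then have "cinner d ((T ^^ k) (\<phi> i')) = cinner (\<psi> j) ((T ^^ k) (\<phi> i')) - (if k = 0 then cinner (\<psi> j) (\<phi> i') else 0)"
      using i' unfolding d_def by (simp add: cinner_diff_left cinner_sum_left cinner_scaleC_left)
    also have "\<dots> = 0"
    proof (cases k)
      case (Suc k')
      have "cinner (\<psi> j) (T ((T ^^ k') (\<phi> i'))) = cinner (B (\<psi> j)) ((T ^^ k') (\<phi> i'))" by (simp add: B_adjoint')
      also have "\<dots> = 0" using BS \<phi>S[of "B (\<psi> j)"] SL i' by blast
      finally show ?thesis using Suc by simp
    qed simp
    finally show ?thesis .
  qed
  \<comment> \<open>Membership in \<open>S\<close> is obtained from the family \<open>\<phi>\<close>
    and then used for the family \<open>\<psi>\<close>: it makes \<open>d\<close> orthogonal to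
    \<open>\<psi> j\<close> as well, hence to itself.\<close>
  then have dS: "d \<in> S" using \<phi>S[OF dL] by blast
  then have "cinner d ((T ^^ 0) (\<psi> j)) = 0" "\<And>i. i < p \<Longrightarrow> cinner d ((T ^^ 0) (\<phi> i)) = 0"
    using \<phi>S[OF dL] \<psi>S[OF dL] j by blast+
  then have "cinner d d = 0"
    by (subst (2) d_def) (simp add: cinner_diff_right cinner_sum_right cinner_scaleC_right)
  then show ?thesis unfolding d_def by (simp add: cinner_self)
qed

text \<open>Each family expands in the other, so the matrix of mutual inner products has orthonormal
  rows and orthonormal columns.\<close>

lemma wandering_unitary:
  assumes \<phi>: "wandering p \<phi>" "\<And>i. i < p \<Longrightarrow> \<phi> i \<in> L n" and \<psi>: "wandering q \<psi>" "\<And>j. j < q \<Longrightarrow> \<psi> j \<in> L n"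
    and \<phi>S: "\<And>y. y \<in> L n \<Longrightarrow> (\<forall>k. \<forall>j<p. cinner y ((T ^^ k) (\<phi> j)) = 0) \<longleftrightarrow> y \<in> S"
    and \<psi>S: "\<And>y. y \<in> L n \<Longrightarrow> (\<forall>k. \<forall>j<q. cinner y ((T ^^ k) (\<psi> j)) = 0) \<longleftrightarrow> y \<in> S"
    and SL: "S \<subseteq> L n"
  shows "q = p" "\<exists>V. unitary_mat p V \<and> (\<forall>j<p. \<psi> j = (\<Sum>i<p. V $$ (i, j) *\<^sub>C \<phi> i))"
proof -
  define v where "v i j = cinner (\<psi> j) (\<phi> i)" for i j
  have e\<psi>: "\<psi> j = (\<Sum>i<p. cinner (\<psi> j) (\<phi> i) *\<^sub>C \<phi> i)" if "j < q" for j
    by (rule wandering_expand[where n = n and q = q and S = S]) (rule \<phi> \<psi> \<phi>S \<psi>S SL that | assumption)+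
  have e\<phi>: "\<phi> j = (\<Sum>i<q. cinner (\<phi> j) (\<psi> i) *\<^sub>C \<psi> i)" if "j < p" for j
    by (rule wandering_expand[where n = n and q = p and S = S]) (rule \<phi> \<psi> \<phi>S \<psi>S SL that | assumption)+
  have cv: "cinner (\<phi> i) (\<psi> j) = cnj (v i j)" for i j unfolding v_def by (rule cinner_commute)
  have cols: "(\<Sum>i<p. v i j * cnj (v i j')) = (if j = j' then 1 else 0)" if "j < q" "j' < q" for j j'
  proof -
    have "cinner (\<psi> j) (\<psi> j') = (\<Sum>i<p. v i j * cnj (v i j'))"
      by (subst e\<psi>[OF that(1)]) (simp add: cinner_sum_left cinner_scaleC_left cv flip: v_def)
    then show ?thesis using wandering_ortho[OF \<psi>(1) that, of 0 0] by simp
  qed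
  have rows: "(\<Sum>j<q. v i j * cnj (v i' j)) = (if i = i' then 1 else 0)" if "i < p" "i' < p" for i i'
  proof -
    have "cinner (\<phi> i') (\<phi> i) = (\<Sum>j<q. v i j * cnj (v i' j))"
      by (subst e\<phi>[OF that(2)]) (simp add: cinner_sum_left cinner_scaleC_left cv mult.commute flip: v_def)
    then show ?thesis using wandering_ortho[OF \<phi>(1) that(2,1), of 0 0] by auto
  qed
  \<comment> \<open>Summing the squared moduli of all entries by columns gives \<open>q\<close>, by
    rows \<open>p\<close>.\<close>
  have "complex_of_nat q = (\<Sum>j<q. \<Sum>i<p. v i j * cnj (v i j))" using cols by simp
  also have "\<dots> = (\<Sum>i<p. \<Sum>j<q. v i j * cnj (v i j))" by (rule sum.swap)
  also have "\<dots> = of_nat p" using rows by simp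
  finally show qp: "q = p" by simp
  define V where "V = mat p p (\<lambda>(i, j). v i j)"
  have adj: "mat_adjoint V = mat p p (\<lambda>(i, j). cnj (v j i))"
    unfolding V_def mat_adjoint_def by (intro eq_matI) (auto simp: mat_of_rows_def)
  have "mat_adjoint V * V = 1\<^sub>m p"
    unfolding adj unfolding V_def
  proof (intro eq_matI)
    fix i j assume "i < dim_row (1\<^sub>m p)" "j < dim_col (1\<^sub>m p)"
    then show "(mat p p (\<lambda>(i, j). cnj (v j i)) * mat p p (\<lambda>(i, j). v i j)) $$ (i, j) = 1\<^sub>m p $$ (i, j)"
      using cols[of j i] qp by (simp add: scalar_prod_def lessThan_atLeast0 mult.commute)
  qed auto
  moreover have "V * mat_adjoint V = 1\<^sub>m p"
    unfolding adj unfolding V_def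
  proof (intro eq_matI)
    fix i j assume "i < dim_row (1\<^sub>m p)" "j < dim_col (1\<^sub>m p)"
    then show "(mat p p (\<lambda>(i, j). v i j) * mat p p (\<lambda>(i, j). cnj (v j i))) $$ (i, j) = 1\<^sub>m p $$ (i, j)"
      using rows[of i j] qp by (simp add: scalar_prod_def lessThan_atLeast0)
  qed auto
  ultimately have "unitary_mat p V" unfolding unitary_mat_def V_def by simp
  moreover have "\<psi> j = (\<Sum>i<p. V $$ (i, j) *\<^sub>C \<phi> i)" if "j < p" for j
  proof -
    have "\<psi> j = (\<Sum>i<p. cinner (\<psi> j) (\<phi> i) *\<^sub>C \<phi> i)"
      by (rule e\<psi>) (use that qp in simp)
    also have "\<dots> = (\<Sum>i<p. V $$ (i, j) *\<^sub>C \<phi> i)" using that by (intro sum.cong) (auto simp: V_def v_def)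
    finally show ?thesis .
  qed
  ultimately show "\<exists>V. unitary_mat p V \<and> (\<forall>j<p. \<psi> j = (\<Sum>i<p. V $$ (i, j) *\<^sub>C \<phi> i))" by blast
qed

text \<open>Such vectors act as multipliers: their products with \<open>G_0\<close> stay in
  \<open>H^2\<close>, whereas for general \<open>h\<close> the product is merely analytic.\<close>

definition bounded_components :: "nat \<Rightarrow> 'a \<Rightarrow> bool" where
  "bounded_components n x \<longleftrightarrow> (\<exists>C. \<forall>i<n. bounded_h2 (\<lambda>k. cf x k i) C)"

context
  fixes n :: nat
  assumes n: "n \<le> m"
begin

lemma bounded_components_iff:
  "bounded_components n x \<longleftrightarrow> (\<exists>C. \<forall>i<n. \<forall>z. cmod z < 1 \<longrightarrow> cmod (pser (\<lambda>k. cf x k i) z) \<le> C)"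
  unfolding bounded_components_def bounded_h2_def using cf_square_summable n by (meson less_le_trans)

lemma bounded_components_add:
  assumes "bounded_components n x" "bounded_components n y"
  shows "bounded_components n (x + y)"
proof -
  obtain C D where C: "\<And>i z. i < n \<Longrightarrow> cmod z < 1 \<Longrightarrow> cmod (pser (\<lambda>k. cf x k i) z) \<le> C"
    and D: "\<And>i z. i < n \<Longrightarrow> cmod z < 1 \<Longrightarrow> cmod (pser (\<lambda>k. cf y k i) z) \<le> D"
    using assms unfolding bounded_components_iff by blast
  have "cmod (pser (\<lambda>k. cf (x + y) k i) z) \<le> C + D" if "i < n" "cmod z < 1" for i z
    using norm_triangle_mono[OF C[OF that] D[OF that]] that n by (simp add: cf_add pser_add cf_bounded)
  then show ?thesis unfolding bounded_components_iff by blast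
qed

lemma bounded_components_scale:
  assumes "bounded_components n x"
  shows "bounded_components n (c *\<^sub>C x)"
proof -
  obtain C where C: "\<And>i z. i < n \<Longrightarrow> cmod z < 1 \<Longrightarrow> cmod (pser (\<lambda>k. cf x k i) z) \<le> C"
    using assms unfolding bounded_components_iff by blast
  have "cmod (pser (\<lambda>k. cf (c *\<^sub>C x) k i) z) \<le> cmod c * C" if "i < n" "cmod z < 1" for i z
    using C[OF that] that n by (simp add: cf_scale pser_scale cf_bounded norm_mult mult_left_mono)
  then show ?thesis unfolding bounded_components_iff by blast
qed

lemma bounded_components_sum:
  "(\<And>i. i \<in> A \<Longrightarrow> bounded_components n (f i)) \<Longrightarrow> bounded_components n (\<Sum>i\<in>A. f i)"
proof (induction A rule: infinite_finite_induct)
  case (insert a A)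
  then show ?case by (simp add: bounded_components_add)
qed (auto simp: bounded_components_iff cf_zero pser_def intro!: exI[of _ 0])

lemma bounded_components_T_pow:
  assumes "bounded_components n x"
  shows "bounded_components n ((T ^^ k) x)"
proof (induction k)
  case (Suc k)
  obtain C where C: "\<And>i z. i < n \<Longrightarrow> cmod z < 1 \<Longrightarrow> cmod (pser (\<lambda>q. cf ((T ^^ k) x) q i) z) \<le> C"
    using Suc unfolding bounded_components_iff by blast
  have "cmod (pser (\<lambda>q. cf ((T ^^ Suc k) x) q i) z) \<le> C" if "i < n" "cmod z < 1" for i z
    using C[OF that] that n mult_mono[of "cmod z" 1 "cmod (pser (\<lambda>q. cf ((T ^^ k) x) q i) z)" C]
    by (simp add: pser_cf_T norm_mult)
  then show ?case unfolding bounded_components_iff by blast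
qed (use assms in simp)

lemma bounded_components_e:
  assumes j: "j < m"
  shows "bounded_components n (e j)"
proof -
  have "pser (\<lambda>k. cf (e j) k i) z = (if i = j then 1 else 0)" if "i < n" for i z
  proof -
    have "(\<lambda>k. cf (e j) k i * z ^ k) = (\<lambda>k. if k = 0 then (if i = j then 1 else 0) else 0)"
      using cf_basis[of j i 0] that n j by auto
    then show ?thesis unfolding pser_def using sums_single[of 0 "\<lambda>_. if i = j then 1 else 0::complex"] by (simp add: sums_iff)
  qed
  then show ?thesis unfolding bounded_components_iff by (intro exI[of _ 1]) auto
qed

end

section \<open>Hitt's algorithm and the isometry \<open>Q\<close>\<close>

context
  fixes M :: "'a set" and l :: nat and g :: "nat \<Rightarrow> 'a"
  assumes M: "nearly_inverse_invariant T M" and g: "onb_of l g (ortho_diff M (M \<inter> range T))"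
begin

lemma M_sub: "csubspace M" and M_closed: "closed M" and M_inv: "T x \<in> M \<Longrightarrow> x \<in> M"
  using M unfolding nearly_inverse_invariant_def by auto

lemma g_ortho: "i < l \<Longrightarrow> j < l \<Longrightarrow> cinner (g i) (g j) = (if i = j then 1 else 0)"
  using g unfolding onb_of_def by auto

lemma g_in: "i < l \<Longrightarrow> g i \<in> ortho_diff M (M \<inter> range T)"
proof -
  assume "i < l"
  then have "g i \<in> cspan (g ` {..<l})" by (intro complex_vector.span_base) auto
  then show ?thesis using g unfolding onb_of_def by simp
qed

lemma g_perp: "i < l \<Longrightarrow> T y \<in> M \<Longrightarrow> cinner (T y) (g i) = 0"
proof -
  assume "i < l" "T y \<in> M"
  then have "cinner (g i) (T y) = 0" using g_in unfolding ortho_diff_def by blast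
  then show ?thesis using cinner_eq_zero_commute by blast
qed

text \<open>The facts about \<open>X\<close> carry orthonormality of the \<open>g i\<close> as a
  premise; it is discharged here and in the next lemmas once for all.\<close>

lemma X_eq: "X l g f = B (f - (\<Sum>i<l. cinner f (g i) *\<^sub>C g i))"
  by (rule X_def) (rule g_ortho)

lemma X_minus: "X l g (x - y) = X l g x - X l g y"
  by (rule X_diff) (rule g_ortho)

lemma X_pow_null: "(\<lambda>n. norm ((X l g ^^ n) f)) \<longlonglongrightarrow> 0"
  by (rule X_pow_tendsto) (rule g_ortho)

lemma norm_sq_split:
  "(norm f)\<^sup>2 = (\<Sum>i<l. (cmod (cinner f (g i)))\<^sup>2) + (norm (f - (\<Sum>i<l. cinner f (g i) *\<^sub>C g i)))\<^sup>2"
  by (rule norm_sq_split_g) (rule g_ortho)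

lemma X_add: "X l g (x + y) = X l g x + X l g y"
proof -
  have "X l g 0 = 0" using X_minus[of 0 0] by simp
  then have "X l g (- y) = - X l g y" using X_minus[of 0 y] by simp
  then show ?thesis using X_minus[of x "- y"] by simp
qed

lemma X_scale: "X l g (c *\<^sub>C x) = c *\<^sub>C X l g x"
proof -
  have "c *\<^sub>C x - (\<Sum>i<l. cinner (c *\<^sub>C x) (g i) *\<^sub>C g i) = c *\<^sub>C (x - (\<Sum>i<l. cinner x (g i) *\<^sub>C g i))"
    by (simp add: complex_vector.scale_right_diff_distrib complex_vector.scale_sum_right cinner_scaleC_left)
  then show ?thesis unfolding X_eq by (simp only: B_scale)
qed

lemma X_pow_add: "(X l g ^^ n) (x + y) = (X l g ^^ n) x + (X l g ^^ n) y"
  by (induction n) (auto simp: X_add)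

lemma X_pow_scale: "(X l g ^^ n) (c *\<^sub>C x) = c *\<^sub>C (X l g ^^ n) x"
  by (induction n) (auto simp: X_scale)

text \<open>Near invariance enters here. The projection of \<open>f\<close> onto
  \<open>M \<inter> range T\<close> has the form \<open>T y\<close> and lies in \<open>M\<close>, so
  \<open>y\<close> lies in \<open>M\<close>; the residual is in the span of the \<open>g i\<close>,
  and \<open>B\<close> recovers \<open>y\<close>.\<close>

lemma hitt_step:
  assumes f: "f \<in> M"
  shows "X l g f \<in> M" "f = (\<Sum>i<l. cinner f (g i) *\<^sub>C g i) + T (X l g f)"
proof -
  let ?p = "\<Sum>i<l. cinner f (g i) *\<^sub>C g i"
  have "csubspace (M \<inter> range T)"
    by (intro complex_vector.subspace_inter M_sub T_subspace complex_vector.subspace_UNIV)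
  moreover have "closed (M \<inter> range T)" by (intro closed_Int M_closed T_closed closed_UNIV)
  ultimately obtain u where u: "u \<in> M \<inter> range T" "\<And>y. y \<in> M \<inter> range T \<Longrightarrow> cinner (f - u) y = 0"
    using projection_exists[of "M \<inter> range T" f] by blast
  then have "f - u \<in> ortho_diff M (M \<inter> range T)"
    using f complex_vector.subspace_diff[OF M_sub] unfolding ortho_diff_def by auto
  then have "(\<Sum>i<l. cinner (f - u) (g i) *\<^sub>C g i) = f - u" by (rule onb_projection(3)[OF g])
  moreover have "cinner u (g i) = 0" if "i < l" for i using g_perp[OF that] u(1) by blast
  ultimately have p: "?p = f - u" by (simp add: cinner_diff_left)
  obtain y where y: "u = T y" using u(1) by blast
  have X: "X l g f = y" unfolding X_eq p y by (simp add: B_T)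
  show "f = ?p + T (X l g f)" unfolding X p y by simp
  show "X l g f \<in> M" unfolding X using u(1) y M_inv[of y] by simp
qed

lemma hitt_expansion:
  assumes f: "f \<in> M"
  shows "(X l g ^^ n) f \<in> M"
    "f = (\<Sum>k<n. (T ^^ k) (\<Sum>i<l. cinner ((X l g ^^ k) f) (g i) *\<^sub>C g i)) + (T ^^ n) ((X l g ^^ n) f)"
proof (induction n)
  case (Suc n)
  { case 1 show ?case using hitt_step(1)[OF Suc(1)] by simp }
  { case 2
    have "(T ^^ n) ((X l g ^^ n) f) = (T ^^ n) (\<Sum>i<l. cinner ((X l g ^^ n) f) (g i) *\<^sub>C g i) + (T ^^ Suc n) ((X l g ^^ Suc n) f)"
      by (subst hitt_step(2)[OF Suc(1)]) (simp add: T_pow_simps funpow_swap1[of T])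
    then show ?case using Suc(2) by (simp add: add.assoc) }
qed (use f in auto)

text \<open>Each step splits the squared norm exactly. Strong stability of \<open>X\<close> then
  removes the remainder, which would otherwise leave an inequality only.\<close>

lemma hitt_norm_sums:
  assumes f: "f \<in> M"
  shows "(\<lambda>k. \<Sum>i<l. (cmod (cinner ((X l g ^^ k) f) (g i)))\<^sup>2) sums (norm f)\<^sup>2"
proof -
  have "(norm f)\<^sup>2 = (\<Sum>k<n. \<Sum>i<l. (cmod (cinner ((X l g ^^ k) f) (g i)))\<^sup>2) + (norm ((X l g ^^ n) f))\<^sup>2" for n
  proof (induction n)
    case (Suc n)
    let ?x = "(X l g ^^ n) f"
    have "?x - (\<Sum>i<l. cinner ?x (g i) *\<^sub>C g i) = T (X l g ?x)"
      using hitt_step(2)[OF hitt_expansion(1)[OF f, of n]] by (metis add_diff_cancel_left')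
    then have "(norm ?x)\<^sup>2 = (\<Sum>i<l. (cmod (cinner ?x (g i)))\<^sup>2) + (norm ((X l g ^^ Suc n) f))\<^sup>2"
      using norm_sq_split[of ?x] by (simp add: T_norm)
    then show ?case using Suc by simp
  qed simp
  then have e: "(\<Sum>k<n. \<Sum>i<l. (cmod (cinner ((X l g ^^ k) f) (g i)))\<^sup>2) = (norm f)\<^sup>2 - (norm ((X l g ^^ n) f))\<^sup>2" for n
    by (metis add_diff_cancel_right')
  have "(\<lambda>n. (norm f)\<^sup>2 - (norm ((X l g ^^ n) f))\<^sup>2) \<longlonglongrightarrow> (norm f)\<^sup>2 - 0\<^sup>2"
    by (intro tendsto_intros X_pow_null)
  then show ?thesis unfolding sums_def e by simp
qed

text \<open>This holds for every vector, also outside \<open>M\<close>, where a step gives only an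
  inequality because \<open>B\<close> is a contraction. It makes \<open>qf\<close> meaningful
  everywhere and its linearity unconditional.\<close>

lemma hitt_coeff_summable:
  assumes i: "i < l"
  shows "summable (\<lambda>k. (cmod (cinner ((X l g ^^ k) f) (g i)))\<^sup>2)"
proof -
  have s: "(\<Sum>k<n. \<Sum>i<l. (cmod (cinner ((X l g ^^ k) f) (g i)))\<^sup>2) + (norm ((X l g ^^ n) f))\<^sup>2 \<le> (norm f)\<^sup>2" for n
  proof (induction n)
    case (Suc n)
    let ?x = "(X l g ^^ n) f"
    have "(norm ((X l g ^^ Suc n) f))\<^sup>2 \<le> (norm (?x - (\<Sum>i<l. cinner ?x (g i) *\<^sub>C g i)))\<^sup>2"
      unfolding funpow.simps o_apply X_eq[of ?x] by (intro power_mono B_norm_le) auto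
    then show ?case using Suc norm_sq_split[of ?x] unfolding sum.lessThan_Suc by linarith
  qed simp
  show ?thesis
  proof (rule bounded_imp_summable)
    fix n
    have "(\<Sum>k\<le>n. (cmod (cinner ((X l g ^^ k) f) (g i)))\<^sup>2) \<le> (\<Sum>k<Suc n. \<Sum>i<l. (cmod (cinner ((X l g ^^ k) f) (g i)))\<^sup>2)"
      unfolding lessThan_Suc_atMost using i by (intro sum_mono member_le_sum[of i "{..<l}" "\<lambda>i. (cmod (cinner ((X l g ^^ _) f) (g i)))\<^sup>2"]) auto
    also have "\<dots> \<le> (norm f)\<^sup>2" using s[of "Suc n"] zero_le_power2[of "norm ((X l g ^^ Suc n) f)"] by linarith
    finally show "(\<Sum>k\<le>n. (cmod (cinner ((X l g ^^ k) f) (g i)))\<^sup>2) \<le> (norm f)\<^sup>2" .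
  qed simp
qed

text \<open>A combination of the \<open>g i\<close> whose function vanishes at 0 lies in
  \<open>M \<inter> range T\<close>. It is also orthogonal to that space, so it is 0.\<close>

lemma g_at_0_independent:
  assumes a: "\<And>j. j < m \<Longrightarrow> (\<Sum>i<l. a i * cf (g i) 0 j) = 0" and i: "i < l"
  shows "a i = 0"
proof -
  define x where "x = (\<Sum>i<l. a i *\<^sub>C g i)"
  have xo: "x \<in> ortho_diff M (M \<inter> range T)" unfolding x_def by (rule onb_projection(1)[OF g])
  have "cinner x (e j) = 0" if "j < m" for j
    using a[OF that] unfolding x_def cf_def by (simp add: cinner_sum_left cinner_scaleC_left)
  then have "PK x = 0" unfolding PK_def by simp
  then have "T (B x) = x" using T_B[of x] by simp
  then have "x \<in> range T" by (metis rangeI)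
  then have "cinner x x = 0" using xo unfolding ortho_diff_def by blast
  then have "x = 0" by (simp add: cinner_self)
  then have "(norm (\<Sum>i<l. a i *\<^sub>C g i))\<^sup>2 = 0" unfolding x_def by simp
  moreover have "(norm (\<Sum>i<l. a i *\<^sub>C g i))\<^sup>2 = (\<Sum>i<l. (cmod (a i))\<^sup>2)"
    by (rule norm_sum_orthonormal) (rule g_ortho)
  ultimately have "(\<Sum>i<l. (cmod (a i))\<^sup>2) = 0" by simp
  then show ?thesis using i by (simp add: sum_nonneg_eq_0_iff)
qed

lemma l_le_m: "l \<le> m"
proof (rule card_independent_le[of l "\<lambda>i. PK (g i)"])
  show "PK (g i) \<in> cspan (e ` {..<m})" for i
    unfolding PK_def by (intro complex_vector.span_sum complex_vector.span_scale complex_vector.span_base) auto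
  fix a i assume z: "(\<Sum>i<l. a i *\<^sub>C PK (g i)) = 0" and i: "i < l"
  have "(\<Sum>i<l. a i * cf (g i) 0 j) = 0" if j: "j < m" for j
  proof -
    have "cinner (PK x) (e j) = cinner x (e j)" for x
    proof -
      have "cinner (PK x) (e j) = (\<Sum>j'<m. if j' = j then cinner x (e j) else 0)"
        unfolding PK_def cinner_sum_left cinner_scaleC_left by (intro sum.cong) (use e_ortho j in auto)
      then show ?thesis using j by simp
    qed
    then have "(\<Sum>i<l. a i * cf (g i) 0 j) = cinner (\<Sum>i<l. a i *\<^sub>C PK (g i)) (e j)"
      by (simp add: cinner_sum_left cinner_scaleC_left cf_def)
    then show ?thesis unfolding z by simp
  qed
  then show "a i = 0" using i by (rule g_at_0_independent)
qed

text \<open>The vector of \<open>L l\<close> whose function is \<open>Q f\<close>. Using it instead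
  of the function keeps closures and projections inside the Hilbert space.\<close>

definition qf :: "'a \<Rightarrow> 'a" where
  "qf f = (SOME x. \<forall>k i. i < m \<longrightarrow> cf x k i = (if i < l then cinner ((X l g ^^ k) f) (g i) else 0))"

lemma cf_qf: "i < m \<Longrightarrow> cf (qf f) k i = (if i < l then cinner ((X l g ^^ k) f) (g i) else 0)"
proof -
  have "summable (\<lambda>k. (cmod (if i < l then cinner ((X l g ^^ k) f) (g i) else 0))\<^sup>2)" for i
    by (cases "i < l") (auto intro: hitt_coeff_summable)
  then have "\<exists>x. \<forall>k i. i < m \<longrightarrow> cf x k i = (if i < l then cinner ((X l g ^^ k) f) (g i) else 0)"
    by (rule riesz_fischer[of "\<lambda>k i. if i < l then cinner ((X l g ^^ k) f) (g i) else 0"]) blast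
  from someI_ex[OF this] show "i < m \<Longrightarrow> cf (qf f) k i = (if i < l then cinner ((X l g ^^ k) f) (g i) else 0)"
    unfolding qf_def by blast
qed

lemma qf_L: "qf f \<in> L l"
  unfolding L_def by (simp add: cf_qf)

lemma qf_add: "qf (x + y) = qf x + qf y"
  by (rule cf_eqI) (simp add: cf_qf cf_add X_pow_add cinner_add_left)

lemma qf_scale: "qf (c *\<^sub>C x) = c *\<^sub>C qf x"
  by (rule cf_eqI) (simp add: cf_qf cf_scale X_pow_scale cinner_scaleC_left)

lemma qf_B: "B (qf f) = qf (X l g f)"
  by (rule cf_eqI) (simp add: cf_qf cf_B funpow_swap1)

lemma qf_norm:
  assumes f: "f \<in> M"
  shows "norm (qf f) = norm f"
proof -
  have "(\<Sum>i<m. (cmod (cf (qf f) k i))\<^sup>2) = (\<Sum>i<l. (cmod (cinner ((X l g ^^ k) f) (g i)))\<^sup>2)" for k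
    by (rule sum.mono_neutral_cong_right) (use l_le_m in \<open>auto simp: cf_qf\<close>)
  then have "(\<lambda>k. \<Sum>i<m. (cmod (cf (qf f) k i))\<^sup>2) sums (norm f)\<^sup>2" using hitt_norm_sums[OF f] by simp
  from sums_unique2[OF parseval this] show ?thesis by simp
qed

lemma represented_by_qf:
  assumes f: "f \<in> M"
  shows "represented_by m (fn m) l g f (fn l (qf f))"
  unfolding represented_by_iff[OF l_le_m]
proof (intro allI impI)
  fix k j assume j: "j < m"
  \<comment> \<open>After \<open>Suc k\<close> steps the remainder is a multiple of
    \<open>T ^^ Suc k\<close> and does not reach the coefficient of index \<open>k\<close>.\<close>
  have "cf f k j = (\<Sum>q<Suc k. \<Sum>i<l. cinner ((X l g ^^ q) f) (g i) * cf (g i) (k - q) j)"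
    by (subst hitt_expansion(2)[OF f, of "Suc k"])
      (simp del: sum.lessThan_Suc funpow.simps add: cf_add cf_sum T_pow_sum T_pow_simps cf_scale cf_T_pow[OF j])
  also have "\<dots> = (\<Sum>i<l. conv (\<lambda>s. cf (qf f) s i) (\<lambda>s. cf (g i) s j) k)"
    unfolding conv_def lessThan_Suc_atMost using l_le_m by (subst sum.swap) (auto simp: cf_qf intro!: sum.cong)
  finally show "cf f k j = (\<Sum>i<l. conv (\<lambda>s. cf (qf f) s i) (\<lambda>s. cf (g i) s j) k)" .
qed

lemma represented_by_unique:
  assumes "represented_by m (fn m) l g f (fn l y)" "represented_by m (fn m) l g f' (fn l y)"
  shows "f = f'"
  using assms unfolding represented_by_iff[OF l_le_m] by (intro cf_eqI) simp

text \<open>The system is triangular with the values of the \<open>g i\<close> at 0 on the diagonal.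
  These are independent, so the coefficients of the difference vanish one after another.\<close>

lemma represented_by_inj:
  assumes y: "y \<in> L l" "y' \<in> L l"
    and r: "represented_by m (fn m) l g f (fn l y)" "represented_by m (fn m) l g f (fn l y')"
  shows "y = y'"
proof -
  define d where "d k i = cf y k i - cf y' k i" for k i
  have c: "(\<Sum>i<l. conv (\<lambda>k. d k i) (\<lambda>s. cf (g i) s j) k) = 0" if "j < m" for j k
    using r that unfolding represented_by_iff[OF l_le_m] d_def conv_diff_left sum_subtractf by simp
  have "\<forall>i<l. d k i = 0" for k
  proof (induction k rule: less_induct)
    case (less k)
    have "(\<Sum>i<l. d k i * cf (g i) 0 j) = 0" if j: "j < m" for j
    proof -
      have "conv (\<lambda>k. d k i) (\<lambda>s. cf (g i) s j) k = d k i * cf (g i) 0 j" if i: "i < l" for i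
      proof -
        have "conv (\<lambda>k. d k i) (\<lambda>s. cf (g i) s j) k = (\<Sum>s\<in>{k}. d s i * cf (g i) (k - s) j)"
          unfolding conv_def by (rule sum.mono_neutral_right) (use less i in auto)
        then show ?thesis by simp
      qed
      then have "(\<Sum>i<l. d k i * cf (g i) 0 j) = (\<Sum>i<l. conv (\<lambda>k. d k i) (\<lambda>s. cf (g i) s j) k)" by simp
      then show ?thesis using c[OF j] by simp
    qed
    then show ?case using g_at_0_independent[of "d k"] by blast
  qed
  then have "cf y k i = cf y' k i" if "i < m" for k i
    using y that by (cases "i < l") (auto simp: d_def L_def)
  then show ?thesis by (rule cf_eqI)
qed

text \<open>Closedness comes from isometry on the closed subspace \<open>M\<close>, and invariance
  from \<open>B (qf f) = qf (X l g f)\<close>.\<close>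

lemma qf_image:
  shows "csubspace (qf ` M)" "closed (qf ` M)" "qf ` M \<subseteq> L l" "s \<in> qf ` M \<Longrightarrow> B s \<in> qf ` M"
proof -
  have q0: "qf 0 = 0" using qf_scale[of 0 0] by simp
  show "csubspace (qf ` M)"
    unfolding complex_vector.subspace_def
  proof (intro conjI ballI allI)
    show "0 \<in> qf ` M" using q0 complex_vector.subspace_0[OF M_sub] by (metis imageI)
    show "x + y \<in> qf ` M" if xy: "x \<in> qf ` M" "y \<in> qf ` M" for x y
    proof -
      obtain a b where "a \<in> M" "x = qf a" "b \<in> M" "y = qf b" using xy by blast
      then show ?thesis using complex_vector.subspace_add[OF M_sub, of a b] by (simp flip: qf_add)
    qed
    show "c *\<^sub>C x \<in> qf ` M" if x: "x \<in> qf ` M" for c x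
    proof -
      obtain a where "a \<in> M" "x = qf a" using x by blast
      then show ?thesis using complex_vector.subspace_scale[OF M_sub, of a c] by (simp flip: qf_scale)
    qed
  qed
  show "closed (qf ` M)"
  proof (rule closed_sequential_limits[THEN iffD2], intro allI impI, elim conjE)
    fix x z assume x: "\<forall>n. x n \<in> qf ` M" and z: "x \<longlonglongrightarrow> z"
    from x have "\<forall>n. \<exists>y. x n = qf y \<and> y \<in> M" by blast
    then obtain y where y: "\<And>n. x n = qf (y n)" "\<And>n. y n \<in> M" by (auto dest: choice)
    have diff: "norm (qf a - qf b) = norm (a - b)" if "a \<in> M" "b \<in> M" for a b
    proof -
      have "qf (a - b) + qf b = qf a" unfolding qf_add[symmetric] by simp
      then have "qf a - qf b = qf (a - b)" by (simp add: algebra_simps)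
      then show ?thesis using qf_norm complex_vector.subspace_diff[OF M_sub that] by simp
    qed
    have "Cauchy x" using z by (rule LIMSEQ_imp_Cauchy)
    then have "Cauchy y" unfolding Cauchy_def dist_norm y(1) diff[OF y(2) y(2)] .
    then obtain w where w: "y \<longlonglongrightarrow> w" using Cauchy_convergent convergent_def by blast
    have wM: "w \<in> M" by (rule closed_sequentially[OF M_closed y(2) w])
    have "(\<lambda>n. norm (y n - w)) \<longlonglongrightarrow> 0" using w by (simp add: LIM_zero tendsto_norm_zero_iff)
    then have "(\<lambda>n. norm (x n - qf w)) \<longlonglongrightarrow> 0" unfolding y(1) diff[OF y(2) wM] .
    then have "x \<longlonglongrightarrow> qf w" by (simp add: tendsto_norm_zero_iff LIM_zero_iff)
    then have "z = qf w" using z LIMSEQ_unique by blast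
    then show "z \<in> qf ` M" using wM by blast
  qed
  show "qf ` M \<subseteq> L l" using qf_L by blast
  show "B s \<in> qf ` M" if "s \<in> qf ` M" for s
    using that hitt_step(1) qf_B by auto
qed

text \<open>The projections of the polynomials onto the model space are bounded, so they multiply \<open>G\<^sub>0\<close> into \<open>H\<^sup>2\<close>;
  therefore the model space cannot be larger than \<open>Q M\<close>.\<close>
lemma model_space_determined:
  assumes \<psi>: "wandering p \<psi>" "\<And>j. j < p \<Longrightarrow> \<psi> j \<in> L l" "\<And>j. j < p \<Longrightarrow> bounded_components l (\<psi> j)"
    and model: "\<And>y. y \<in> L l \<Longrightarrow> fn l y \<in> model_space l p \<Psi> \<longleftrightarrow> (\<forall>k. \<forall>j<p. cinner y ((T ^^ k) (\<psi> j)) = 0)"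
    and M_eq: "M = {f. \<exists>h\<in>model_space l p \<Psi>. represented_by m (fn m) l g f h}"
    and y: "y \<in> L l"
  shows "(\<forall>k. \<forall>j<p. cinner y ((T ^^ k) (\<psi> j)) = 0) \<longleftrightarrow> y \<in> qf ` M"
proof -
  \<comment> \<open>By injectivity of the representation, the \<open>h\<close> that
    \<open>\<Psi>\<close> provides for \<open>f\<close> is the function computed by Hitt's
    algorithm.\<close>
  have qfM: "cinner (qf f) ((T ^^ k) (\<psi> j)) = 0" if f: "f \<in> M" and j: "j < p" for f k j
  proof -
    obtain h where h: "h \<in> model_space l p \<Psi>" "represented_by m (fn m) l g f h" using f M_eq by blast
    then have "h \<in> H2 l" unfolding model_space_def by blast
    then obtain y' where y': "y' \<in> L l" "h = fn l y'" by (rule fn_surj[OF l_le_m]) (rule that)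
    then have "y' = qf f" using represented_by_inj[OF y'(1) qf_L _ represented_by_qf[OF f]] h(2) by blast
    then show ?thesis using h(1) y' model j by blast
  qed
  define a where "a s i k j = cinner ((T ^^ s) (e i)) ((T ^^ k) (\<psi> j))" for s i k j
  \<comment> \<open>The projection of \<open>(T ^^ s) (e i)\<close> onto the complement of all
    translates of the \<open>\<psi> j\<close>. The sum stops at \<open>k = s\<close> because later
    translates are orthogonal to \<open>(T ^^ s) (e i)\<close>; being finite, it preserves
    boundedness of the components.\<close>
  define q where "q s i = (T ^^ s) (e i) + (\<Sum>k\<le>s. \<Sum>j<p. (- a s i k j) *\<^sub>C (T ^^ k) (\<psi> j))" for s i
  have TL: "(T ^^ k) x \<in> L l" if "x \<in> L l" for k x
    using that by (induction k) (auto intro: T_L)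
  have q_M: "q s i \<in> qf ` M" if i: "i < l" for s i
  proof -
    have eL: "e i \<in> L l" unfolding L_def using cf_basis[of i _ 0] i l_le_m by auto
    have qL: "q s i \<in> L l"
      unfolding q_def
      by (intro complex_vector.subspace_add complex_vector.subspace_sum complex_vector.subspace_scale L_subspace TL eL \<psi>(2)) auto
    have "cinner (q s i) ((T ^^ k') (\<psi> j')) = 0" if j': "j' < p" for k' j'
    proof -
      have "(\<Sum>j<p. - a s i k j * cinner ((T ^^ k) (\<psi> j)) ((T ^^ k') (\<psi> j'))) = (if k = k' then - a s i k' j' else 0)" for k
      proof -
        have "(\<Sum>j<p. - a s i k j * cinner ((T ^^ k) (\<psi> j)) ((T ^^ k') (\<psi> j'))) = (\<Sum>j<p. if j = j' then (if k = k' then - a s i k' j' else 0) else 0)"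
          by (intro sum.cong) (use wandering_ortho[OF \<psi>(1)] j' in auto)
        then show ?thesis using j' by simp
      qed
      then have "cinner (q s i) ((T ^^ k') (\<psi> j')) = a s i k' j' + (if k' \<le> s then - a s i k' j' else 0)"
        unfolding q_def by (simp add: cinner_add_left cinner_sum_left cinner_scaleC_left cinner_minus_left flip: a_def)
      moreover have "a s i k' j' = 0" if k': "\<not> k' \<le> s"
      proof -
        obtain t where t: "k' = s + Suc t" using k' less_imp_Suc_add[of s k'] by auto
        have "a s i k' j' = cinner (e i) ((T ^^ Suc t) (\<psi> j'))"
          unfolding a_def t funpow_add[of s] o_apply T_pow_adjoint B_T_pow ..
        then show ?thesis using e_T[of i] i l_le_m by simp
      qed
      ultimately show ?thesis by (cases "k' \<le> s") auto
    qed
    then have qmodel: "fn l (q s i) \<in> model_space l p \<Psi>" using model[OF qL] by blast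
    have "bounded_components l (q s i)"
      unfolding q_def
      by (intro bounded_components_add[OF l_le_m] bounded_components_sum[OF l_le_m] bounded_components_scale[OF l_le_m]
          bounded_components_T_pow[OF l_le_m] bounded_components_e[OF l_le_m] \<psi>(3)) (use i l_le_m in auto)
    then obtain C where C: "\<And>i'. i' < l \<Longrightarrow> bounded_h2 (\<lambda>k. cf (q s i) k i') C"
      unfolding bounded_components_def by blast
    \<comment> \<open>A bounded multiplier keeps the coefficients square summable, so the product is
      a genuine vector \<open>f\<close>, to which the assumed description of \<open>M\<close>
      applies.\<close>
    have "summable (\<lambda>k. (cmod (\<Sum>i'<l. conv (\<lambda>k. cf (q s i) k i') (\<lambda>k. cf (g i') k j) k))\<^sup>2)" if "j < m" for j
      by (intro summable_norm_sq_sum(1) bounded_h2.conv_square_summable(1)[OF C] cf_square_summable that)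
    then obtain f where f: "\<And>k j. j < m \<Longrightarrow> cf f k j = (\<Sum>i'<l. conv (\<lambda>k. cf (q s i) k i') (\<lambda>k. cf (g i') k j) k)"
      by (rule riesz_fischer[of "\<lambda>k j. \<Sum>i'<l. conv (\<lambda>k. cf (q s i) k i') (\<lambda>k. cf (g i') k j) k"]) blast+
    then have rf: "represented_by m (fn m) l g f (fn l (q s i))" unfolding represented_by_iff[OF l_le_m] by blast
    then have fM: "f \<in> M" using M_eq qmodel by blast
    have "q s i = qf f" by (rule represented_by_inj[OF qL qf_L rf represented_by_qf[OF fM]])
    then show ?thesis using fM by blast
  qed
  show ?thesis
  proof
    assume "y \<in> qf ` M"
    then show "\<forall>k. \<forall>j<p. cinner y ((T ^^ k) (\<psi> j)) = 0" using qfM by blast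
  next
    assume R: "\<forall>k. \<forall>j<p. cinner y ((T ^^ k) (\<psi> j)) = 0"
    obtain s where s: "s \<in> qf ` M" "\<And>u. u \<in> qf ` M \<Longrightarrow> cinner (y - s) u = 0"
      using projection_exists[OF qf_image(1,2), of y] by blast
    define z where "z = y - s"
    have zL: "z \<in> L l" unfolding z_def using y s(1) qf_image(3) complex_vector.subspace_diff[OF L_subspace] by blast
    have z\<psi>: "cinner z ((T ^^ k) (\<psi> j)) = 0" if "j < p" for k j
      using R that s(1) qfM unfolding z_def by (auto simp: cinner_diff_left)
    \<comment> \<open>\<open>z\<close> is orthogonal to every \<open>q k i\<close> and to the
      translates of the \<open>\<psi> j\<close>, hence to the vectors \<open>(T ^^ k) (e i)\<close>
      themselves.\<close>
    have "cf z k i = 0" if "i < m" for k i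
    proof (cases "i < l")
      case True
      have "0 = cinner z (q k i)" using s(2)[OF q_M[OF True]] unfolding z_def by simp
      also have "\<dots> = cinner z ((T ^^ k) (e i))"
        unfolding q_def by (simp add: cinner_add_right cinner_sum_right cinner_scaleC_right cinner_minus_right z\<psi>)
      finally show ?thesis unfolding cf_alt by simp
    qed (use zL that in \<open>auto simp: L_def\<close>)
    then have "z = 0" by (intro cf_eqI) (simp add: cf_zero)
    then show "y \<in> qf ` M" using s(1) unfolding z_def by simp
  qed
qed

text \<open>Beurling-Lax applied to the image of \<open>M\<close> under \<open>qf\<close> yields
  \<open>\<Phi>\<close>. For uniqueness, the model space of a competitor is shown to correspond to
  the same image, and two wandering families with one common complement differ by a constant unitary
  matrix.\<close>

theorem nearly_inverse_invariant_representation: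
  "\<exists>l' \<Phi>. l' \<le> l \<and> inner_function l l' \<Phi> \<and>
      M = {f. \<exists>h\<in>model_space l l' \<Phi>. represented_by m (fn m) l g f h} \<and>
      (\<forall>p \<Psi>. p \<le> l \<and> inner_function l p \<Psi> \<and>
          M = {f. \<exists>h\<in>model_space l p \<Psi>. represented_by m (fn m) l g f h} \<longrightarrow>
        p = l' \<and> (\<exists>V. unitary_mat l' V \<and> (\<forall>z\<in>ball 0 1. \<Psi> z = \<Phi> z * V))) \<and>
      (\<exists>Q. Q ` M \<subseteq> model_space l l' \<Phi> \<and>
        (\<forall>f\<in>M. \<forall>h\<in>model_space l l' \<Phi>. represented_by m (fn m) l g f h \<longleftrightarrow> Q f = h) \<and>
        linear_isometry_into_H2 l M Q)"
proof -
  obtain l' \<phi> where l': "l' \<le> l" and \<phi>: "wandering l' \<phi>" "\<And>j. j < l' \<Longrightarrow> \<phi> j \<in> L l"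
    and \<phi>S: "\<And>y. y \<in> L l \<Longrightarrow> (\<forall>k. \<forall>j<l'. cinner y ((T ^^ k) (\<phi> j)) = 0) \<longleftrightarrow> y \<in> qf ` M"
    using beurling_lax[OF l_le_m qf_image] by metis
  define \<Phi> where "\<Phi> = mat_of_columns l l' \<phi>"
  have inner: "inner_function l l' \<Phi>" and cols: "columns l l' \<Phi> \<phi>"
    and b: "\<And>i j. i < l \<Longrightarrow> j < l' \<Longrightarrow> bounded_h2 (\<lambda>k. cf (\<phi> j) k i) 1"
    unfolding \<Phi>_def by (rule wandering_imp_inner_function[OF l_le_m \<phi>]; assumption)+
  have \<Phi>H: "\<Phi> \<in> Hinf l l'" using inner unfolding inner_function_def by blast
  have model: "fn l y \<in> model_space l l' \<Phi> \<longleftrightarrow> y \<in> qf ` M" if "y \<in> L l" for y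
    using model_space_iff[OF l_le_m \<Phi>H _ cols b that] \<phi>S[OF that] l' l_le_m by simp
  have Q_iff: "represented_by m (fn m) l g f h \<longleftrightarrow> fn l (qf f) = h" if f: "f \<in> M" and h: "h \<in> model_space l l' \<Phi>" for f h
  proof -
    have "h \<in> H2 l" using h unfolding model_space_def by blast
    then obtain y where y: "y \<in> L l" "h = fn l y" by (rule fn_surj[OF l_le_m]) (rule that)
    show ?thesis
      using represented_by_inj[OF y(1) qf_L _ represented_by_qf[OF f]] represented_by_qf[OF f] y(2) by auto
  qed
  have M_eq: "M = {f. \<exists>h\<in>model_space l l' \<Phi>. represented_by m (fn m) l g f h}"
  proof (intro Set.equalityI subsetI)
    fix f assume f: "f \<in> M"
    show "f \<in> {f. \<exists>h\<in>model_space l l' \<Phi>. represented_by m (fn m) l g f h}"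
      using represented_by_qf[OF f] model[OF qf_L, of f] f by blast
  next
    fix f assume "f \<in> {f. \<exists>h\<in>model_space l l' \<Phi>. represented_by m (fn m) l g f h}"
    then obtain h where h: "h \<in> model_space l l' \<Phi>" "represented_by m (fn m) l g f h" by blast
    then have "h \<in> H2 l" unfolding model_space_def by blast
    then obtain y where y: "y \<in> L l" "h = fn l y" by (rule fn_surj[OF l_le_m]) (rule that)
    \<comment> \<open>Every function of the model space is \<open>Q f'\<close> for some
      \<open>f'\<close> in \<open>M\<close>, and a function determines the vector that it
      represents.\<close>
    then obtain f' where f': "f' \<in> M" "y = qf f'" using model h(1) by blast
    have "f = f'" using represented_by_unique h(2) y(2) f' represented_by_qf[OF f'(1)] by metis
    then show "f \<in> M" using f'(1) by simp
  qed
  have unique: "p = l' \<and> (\<exists>V. unitary_mat l' V \<and> (\<forall>z\<in>ball 0 1. \<Psi> z = \<Phi> z * V))"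
    if p: "p \<le> l" and \<Psi>: "inner_function l p \<Psi>"
      and M\<Psi>: "M = {f. \<exists>h\<in>model_space l p \<Psi>. represented_by m (fn m) l g f h}" for p \<Psi>
  proof -
    have \<Psi>H: "\<Psi> \<in> Hinf l p" using \<Psi> unfolding inner_function_def by blast
    obtain \<psi> C where \<psi>: "columns l p \<Psi> \<psi>" and C: "\<And>i j. i < l \<Longrightarrow> j < p \<Longrightarrow> bounded_h2 (\<lambda>k. cf (\<psi> j) k i) C"
      by (rule columns_exist[OF l_le_m \<Psi>H]) (rule that, assumption, blast)
    have \<psi>w: "wandering p \<psi>" by (rule inner_function_imp_wandering[OF l_le_m \<Psi> \<psi>]) (rule C)
    have \<psi>L: "\<psi> j \<in> L l" if "j < p" for j using \<psi> that unfolding columns_def by blast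
    have \<psi>b: "bounded_components l (\<psi> j)" if "j < p" for j using C that unfolding bounded_components_def by blast
    have pm: "p \<le> m" using p l_le_m by simp
    have \<psi>S: "(\<forall>k. \<forall>j<p. cinner y ((T ^^ k) (\<psi> j)) = 0) \<longleftrightarrow> y \<in> qf ` M" if "y \<in> L l" for y
    proof (rule model_space_determined[OF \<psi>w _ _ _ M\<Psi> that])
      show "fn l y \<in> model_space l p \<Psi> \<longleftrightarrow> (\<forall>k. \<forall>j<p. cinner y ((T ^^ k) (\<psi> j)) = 0)" if "y \<in> L l" for y
        by (rule model_space_iff[OF l_le_m \<Psi>H pm \<psi> _ that]) (rule C)
    qed (rule \<psi>L \<psi>b, assumption)+
    have unit: "p = l'" "\<exists>V. unitary_mat l' V \<and> (\<forall>j<l'. \<psi> j = (\<Sum>i<l'. V $$ (i, j) *\<^sub>C \<phi> i))"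
      by (rule wandering_unitary[where \<phi> = \<phi> and n = l and S = "qf ` M" and \<psi> = \<psi> and q = p];
          (rule \<phi> \<psi>w \<psi>L \<phi>S \<psi>S qf_image(3) | assumption)+)+
    then obtain V where V: "unitary_mat l' V" "\<And>j. j < l' \<Longrightarrow> \<psi> j = (\<Sum>i<l'. V $$ (i, j) *\<^sub>C \<phi> i)" by blast
    have pl: "p = l'" by (rule unit(1))
    have Vc: "V \<in> carrier_mat l' l'" using V(1) unfolding unitary_mat_def by blast
    have "\<Psi> z = \<Phi> z * V" if z: "z \<in> ball 0 1" for z
    proof (rule eq_matI)
      have \<Psi>c: "\<Psi> z \<in> carrier_mat l l'" using \<Psi>H pl unfolding Hinf_def by blast
      have \<Phi>c: "\<Phi> z \<in> carrier_mat l l'" using \<Phi>H unfolding Hinf_def by blast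
      show "dim_row (\<Psi> z) = dim_row (\<Phi> z * V)" "dim_col (\<Psi> z) = dim_col (\<Phi> z * V)" using \<Psi>c \<Phi>c Vc by auto
      fix i j assume "i < dim_row (\<Phi> z * V)" "j < dim_col (\<Phi> z * V)"
      then have ij: "i < l" "j < l'" using \<Phi>c Vc by auto
      have "(\<lambda>k. \<Sum>i'<l'. V $$ (i', j) * (cf (\<phi> i') k i * z ^ k)) sums (\<Sum>i'<l'. V $$ (i', j) * pser (\<lambda>k. cf (\<phi> i') k i) z)"
        using z ij l_le_m by (intro sums_sum sums_mult pser_sums cf_bounded) auto
      moreover have "cf (\<psi> j) k i * z ^ k = (\<Sum>i'<l'. V $$ (i', j) * (cf (\<phi> i') k i * z ^ k))" for k
        unfolding V(2)[OF ij(2)] cf_sum cf_scale by (simp add: sum_distrib_right mult.assoc)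
      ultimately have "pser (\<lambda>k. cf (\<psi> j) k i) z = (\<Sum>i'<l'. V $$ (i', j) * pser (\<lambda>k. cf (\<phi> i') k i) z)"
        unfolding pser_def[of "\<lambda>k. cf (\<psi> j) k i"] by (simp add: sums_iff)
      also have "\<dots> = (\<Sum>i'<l'. \<Phi> z $$ (i, i') * V $$ (i', j))"
        using cols z ij unfolding columns_def by (intro sum.cong) auto
      also have "\<dots> = (\<Phi> z * V) $$ (i, j)" using \<Phi>c Vc ij by (simp add: scalar_prod_def lessThan_atLeast0)
      finally show "\<Psi> z $$ (i, j) = (\<Phi> z * V) $$ (i, j)" using \<psi> z ij pl unfolding columns_def by auto
    qed
    then show ?thesis using pl V(1) by blast
  qed
  have "linear_isometry_into_H2 l M (\<lambda>f. fn l (qf f))"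
    unfolding linear_isometry_into_H2_def
    using fn_H2[OF l_le_m] fn_add[OF l_le_m] fn_scale[OF l_le_m] fn_norm[OF l_le_m qf_L] qf_norm
    by (simp add: qf_add qf_scale)
  moreover have "(\<lambda>f. fn l (qf f)) ` M \<subseteq> model_space l l' \<Phi>" using model[OF qf_L] by blast
  ultimately have "\<exists>Q. Q ` M \<subseteq> model_space l l' \<Phi> \<and>
        (\<forall>f\<in>M. \<forall>h\<in>model_space l l' \<Phi>. represented_by m (fn m) l g f h \<longleftrightarrow> Q f = h) \<and>
        linear_isometry_into_H2 l M Q"
    using Q_iff by (intro exI[of _ "\<lambda>f. fn l (qf f)"]) blast
  with l' inner M_eq unique show ?thesis by (intro exI[of _ l'] exI[of _ \<Phi>]) blast
qed

end

end

theorem theorem2p4: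
  fixes T :: "'a::complex_hilbert \<Rightarrow> 'a"
    and M :: "'a set"
    and m l :: nat
    and e g :: "nat \<Rightarrow> 'a"
    and U :: "'a \<Rightarrow> complex \<Rightarrow> complex vec"
  assumes separable: "\<exists>D :: 'a set. countable D \<and> closure D = UNIV"
    and infinite_dim: "\<not> (\<exists>B :: 'a set. finite B \<and> cspan B = UNIV)"
    and shift: "shift_of_multiplicity T m"
    and e: "onb_of m e (ortho_diff UNIV (range T))"
    and U: "wold_unitary T m e U"
    and M: "nearly_inverse_invariant T M" "M \<noteq> {0}"
    and g: "onb_of l g (ortho_diff M (M \<inter> range T))"
  shows "\<exists>l' \<Phi>. l' \<le> l \<and> inner_function l l' \<Phi> \<and>
      M = {f. \<exists>h\<in>model_space l l' \<Phi>. represented_by m U l g f h} \<and>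
      (\<forall>p \<Psi>. p \<le> l \<and> inner_function l p \<Psi> \<and>
          M = {f. \<exists>h\<in>model_space l p \<Psi>. represented_by m U l g f h} \<longrightarrow>
        p = l' \<and> (\<exists>V. unitary_mat l' V \<and> (\<forall>z\<in>ball 0 1. \<Psi> z = \<Phi> z * V))) \<and>
      (\<exists>Q. Q ` M \<subseteq> model_space l l' \<Phi> \<and>
        (\<forall>f\<in>M. \<forall>h\<in>model_space l l' \<Phi>. represented_by m U l g f h \<longleftrightarrow> Q f = h) \<and>
        linear_isometry_into_H2 l M Q)"
proof -
  interpret pure_shift T m e
    by unfold_locales (use shift e in \<open>auto simp: shift_of_multiplicity_def\<close>)
  show ?thesis
    unfolding wold_unitary_eq_fn[OF U] by (rule nearly_inverse_invariant_representation[OF M(1) g])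
qed

end
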